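(* Let $(a_n)_{n\in\mathbb N}$ be a strictly positive real sequence with $a_n\to0$ and $\sqrt n\,a_n\to\infty$. Let $\rho_{AB}\in\mathcal S(AB)$ with $V(A:B)_\rho>0$, and put $R_n:=I(A:B)_\rho-a_n$. Then $$\lim_{n\to\infty}-\frac{1}{na_n^2}\log\hat\alpha_{n,\rho}(e^{-nR_n})=\frac{1}{2V(A:B)_\rho},$$ and the same holds with $\hat\alpha_{n,\rho}$ replaced by $\hat\alpha^{\mathrm{iid}}_{n,\rho}$.
   Context: All Hilbert spaces are finite-dimensional, $\log$ is natural, $\mathcal S(A)$ is the set of density operators on $A$. $I(A:B)_\rho=H(A)_\rho+H(B)_\rho-H(AB)_\rho$ (von Neumann entropies). $V(A:B)_\rho=\operatorname{tr}[\rho_{AB}(\log\rho_{AB}-\log(\rho_A\otimes\rho_B)-I(A:B)_\rho)^2]$. $\mathcal S_{\mathrm{sym}}(A^{\otimes n})$: states invariant under all permutations of tensor factors. $\hat\alpha_{n,\rho}(\mu)=\min\{\operatorname{tr}[\rho_{AB}^{\otimes n}(1-T)]:0\le T\le1,\ \max_{\sigma_{A^n}\in\mathcal S_{\mathrm{sym}}(A^{\otimes n}),\tau_{B^n}\in\mathcal S_{\mathrm{sym}}(B^{\otimes n})}\operatorname{tr}[(\sigma_{A^n}\otimes\tau_{B^n})T]\le\mu\}$; $\hat\alpha^{\mathrm{iid}}_{n,\rho}(\mu)=\min\{\operatorname{tr}[\rho_{AB}^{\otimes n}(1-T)]:0\le T\le1,\ \max_{\sigma_A\in\mathcal S(A),\tau_B\in\mathcal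 S(B)}\operatorname{tr}[(\sigma_A^{\otimes n}\otimes\tau_B^{\otimes n})T]\le\mu\}$. *)

theory Defs
  imports "HOL-Analysis.Analysis" "HOL-Combinatorics.Permutations"
begin

text \<open>Operators on a finite-dimensional Hilbert space with orthonormal basis indexed
by a finite carrier set S are represented as matrices 'i => 'i => complex
(entries outside S are irrelevant).\<close>

type_synonym 'i op = "'i \<Rightarrow> 'i \<Rightarrow> complex"

definition mmul :: "'i set \<Rightarrow> 'i op \<Rightarrow> 'i op \<Rightarrow> 'i op" where
  "mmul S M N = (\<lambda>i k. \<Sum>j\<in>S. M i j * N j k)"

definition mtrace :: "'i set \<Rightarrow> 'i op \<Rightarrow> complex" where
  "mtrace S M = (\<Sum>i\<in>S. M i i)"

definition madj :: "'i op \<Rightarrow> 'i op" where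
  "madj M = (\<lambda>i j. cnj (M j i))"

definition mid :: "'i op" where
  "mid = (\<lambda>i j. if i = j then 1 else 0)"

definition psd :: "'i set \<Rightarrow> 'i op \<Rightarrow> bool" where
  "psd S M \<longleftrightarrow> (\<forall>v :: 'i \<Rightarrow> complex.
      Im (\<Sum>i\<in>S. \<Sum>j\<in>S. cnj (v i) * M i j * v j) = 0 \<and>
      Re (\<Sum>i\<in>S. \<Sum>j\<in>S. cnj (v i) * M i j * v j) \<ge> 0)"

definition density_op :: "'i set \<Rightarrow> 'i op \<Rightarrow> bool" where
  "density_op S \<rho> \<longleftrightarrow> psd S \<rho> \<and> mtrace S \<rho> = 1"

definition unitary_on :: "'i set \<Rightarrow> 'i op \<Rightarrow> bool" where
  "unitary_on S U \<longleftrightarrow> (\<forall>i\<in>S. \<forall>j\<in>S.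
      mmul S U (madj U) i j = mid i j \<and> mmul S (madj U) U i j = mid i j)"

definition spectral_decomp :: "'i set \<Rightarrow> 'i op \<Rightarrow> 'i op \<Rightarrow> ('i \<Rightarrow> real) \<Rightarrow> bool" where
  "spectral_decomp S M U d \<longleftrightarrow> unitary_on S U \<and>
     (\<forall>i\<in>S. \<forall>j\<in>S. M i j = (\<Sum>k\<in>S. U i k * complex_of_real (d k) * cnj (U j k)))"

definition mfun :: "'i set \<Rightarrow> (real \<Rightarrow> real) \<Rightarrow> 'i op \<Rightarrow> 'i op" where
  "mfun S f M = (let p = (SOME p. spectral_decomp S M (fst p) (snd p)) in
     (\<lambda>i j. \<Sum>k\<in>S. fst p i k * complex_of_real (f (snd p k)) * cnj (fst p j k)))"

text \<open>Matrix logarithm; since ln 0 = 0 in Isabelle, this is the log on the support.\<close>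
definition mlog :: "'i set \<Rightarrow> 'i op \<Rightarrow> 'i op" where
  "mlog S M = mfun S ln M"

definition vn_entropy :: "'i set \<Rightarrow> 'i op \<Rightarrow> real" where
  "vn_entropy S \<rho> = - Re (mtrace S (mmul S \<rho> (mlog S \<rho>)))"

definition ptrA :: "('a::finite \<times> 'b::finite) op \<Rightarrow> 'a op" where
  "ptrA \<rho> = (\<lambda>a a'. \<Sum>b\<in>UNIV. \<rho> (a, b) (a', b))"

definition ptrB :: "('a::finite \<times> 'b::finite) op \<Rightarrow> 'b op" where
  "ptrB \<rho> = (\<lambda>b b'. \<Sum>a\<in>UNIV. \<rho> (a, b) (a, b'))"

definition tensor2 :: "'a op \<Rightarrow> 'b op \<Rightarrow> ('a \<times> 'b) op" where
  "tensor2 \<sigma> \<tau> = (\<lambda>(a, b) (a', b'). \<sigma> a a' * \<tau> b b')"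

definition mutual_info :: "('a::finite \<times> 'b::finite) op \<Rightarrow> real" where
  "mutual_info \<rho> = vn_entropy UNIV (ptrA \<rho>) + vn_entropy UNIV (ptrB \<rho>) - vn_entropy UNIV \<rho>"

definition mutual_info_var :: "('a::finite \<times> 'b::finite) op \<Rightarrow> real" where
  "mutual_info_var \<rho> = (let L = (\<lambda>i j. mlog UNIV \<rho> i j
        - mlog UNIV (tensor2 (ptrA \<rho>) (ptrB \<rho>)) i j
        - complex_of_real (mutual_info \<rho>) * mid i j)
     in Re (mtrace UNIV (mmul UNIV \<rho> (mmul UNIV L L))))"

text \<open>n-fold tensor powers: basis of H^{\<otimes>n} indexed by lists of length n.\<close>
definition lists_n :: "nat \<Rightarrow> 'i list set" where
  "lists_n n = {xs. length xs = n}"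

definition tpow :: "nat \<Rightarrow> 'i op \<Rightarrow> 'i list op" where
  "tpow n \<rho> = (\<lambda>xs ys. \<Prod>k<n. \<rho> (xs ! k) (ys ! k))"

text \<open>sigma_{A^n} \<otimes> tau_{B^n} viewed as an operator on (AB)^{\<otimes>n}.\<close>
definition prod_state :: "'a list op \<Rightarrow> 'b list op \<Rightarrow> ('a \<times> 'b) list op" where
  "prod_state \<sigma> \<tau> = (\<lambda>zs ws. \<sigma> (map fst zs) (map fst ws) * \<tau> (map snd zs) (map snd ws))"

definition perm_list :: "(nat \<Rightarrow> nat) \<Rightarrow> 'i list \<Rightarrow> 'i list" where
  "perm_list \<pi> xs = map (\<lambda>k. xs ! \<pi> k) [0..<length xs]"

definition symmetric_op :: "nat \<Rightarrow> 'i list op \<Rightarrow> bool" where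
  "symmetric_op n \<sigma> \<longleftrightarrow> (\<forall>\<pi>. \<pi> permutes {..<n} \<longrightarrow>
     (\<forall>xs\<in>lists_n n. \<forall>ys\<in>lists_n n. \<sigma> (perm_list \<pi> xs) (perm_list \<pi> ys) = \<sigma> xs ys))"

definition test_op :: "'i set \<Rightarrow> 'i op \<Rightarrow> bool" where
  "test_op S T \<longleftrightarrow> psd S T \<and> psd S (\<lambda>i j. mid i j - T i j)"

definition alpha_hat :: "('a::finite \<times> 'b::finite) op \<Rightarrow> nat \<Rightarrow> real \<Rightarrow> real" where
  "alpha_hat \<rho> n \<mu> = Inf {Re (mtrace (lists_n n) (mmul (lists_n n) (tpow n \<rho>) (\<lambda>i j. mid i j - T i j))) | T.
      test_op (lists_n n) T \<and>
      (\<forall>(\<sigma> :: 'a list op) (\<tau> :: 'b list op).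
         density_op (lists_n n) \<sigma> \<and> symmetric_op n \<sigma> \<and>
         density_op (lists_n n) \<tau> \<and> symmetric_op n \<tau> \<longrightarrow>
         Re (mtrace (lists_n n) (mmul (lists_n n) (prod_state \<sigma> \<tau>) T)) \<le> \<mu>)}"

definition alpha_hat_iid :: "('a::finite \<times> 'b::finite) op \<Rightarrow> nat \<Rightarrow> real \<Rightarrow> real" where
  "alpha_hat_iid \<rho> n \<mu> = Inf {Re (mtrace (lists_n n) (mmul (lists_n n) (tpow n \<rho>) (\<lambda>i j. mid i j - T i j))) | T.
      test_op (lists_n n) T \<and>
      (\<forall>(\<sigma> :: 'a op) (\<tau> :: 'b op).
         density_op UNIV \<sigma> \<and> density_op UNIV \<tau> \<longrightarrow>
         Re (mtrace (lists_n n) (mmul (lists_n n) (prod_state (tpow n \<sigma>) (tpow n \<tau>)) T)) \<le> \<mu>)}"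

end

theory Submission
  imports Defs "Jordan_Normal_Form.Spectral_Radius" "HOL-Real_Asymp.Real_Asymp"
begin

text \<open>Write \<open>\<rho>\<close> and \<open>\<rho>\<^sub>A \<otimes> \<rho>\<^sub>B\<close> in eigenbases \<open>u\<^sub>k\<close>, \<open>w\<^sub>l\<close> with eigenvalues \<open>d\<^sub>k\<close>, \<open>\<nu>\<^sub>l\<close>. Under the
  joint distribution with weights \<open>d\<^sub>k |<w\<^sub>l, u\<^sub>k>|\<^sup>2\<close> of Nussbaum and Szkola, the variable
  \<open>ln d\<^sub>k - ln \<nu>\<^sub>l\<close> has mean \<open>I(A:B)\<close> and variance \<open>V(A:B)\<close>, and passing to tensor powers amounts to
  taking independent copies. Both error bounds reduce to lower tail probabilities of this
  classical sum, whose moderate deviations follow from the Chernoff bound and from exponential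
  tilting.

  Converse: choose \<open>\<sigma> = \<rho>\<^sub>A\<close>, \<open>\<tau> = \<rho>\<^sub>B\<close>; for every test the errors dominate half of the classical
  ones.

  Achievability: every permutation invariant state is bounded by a universal operator of
  polynomial trace which is block diagonal for the eigenvalues of \<open>\<rho>\<^sub>A\<^sup>n\<close>. A test of Ke Li, which has the
  same error bounds as the classical likelihood ratio test, is applied to \<open>\<rho>\<^sup>n\<close> against the product of
  the two universal operators. By Markov's inequality the eigenvalues of the latter exceed those
  of \<open>(\<rho>\<^sub>A \<otimes> \<rho>\<^sub>B)\<^sup>n\<close> by a factor \<open>exp (\<kappa> n a\<^sub>n)\<close> only with probability at most
  \<open>poly(n) exp (- \<kappa> n a\<^sub>n / 2)\<close>, which is negligible against \<open>exp (- n a\<^sub>n\<^sup>2 / (2 V))\<close>.\<close>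

subsection \<open>Spectral decompositions over a finite index set\<close>

text \<open>The obstacle is that the constraint on the test is composite while the exponent involves
  only the marginals of \<rho>. One operator dominating all alternatives removes the composite part,
  but its eigenvalues are not those of the product of the marginals. Commutation repairs this: in a
  common eigenbasis the two can be compared eigenvalue by eigenvalue, and since only the trace of
  the universal operator is controlled, the comparison holds outside an event of small probability.
  Constant factors, such as the 1/2 in the converse, do not matter because n a_n^2 tends to
  infinity; the same growth makes Chebyshev's inequality effective in the lower tail estimate.

  Only two estimates are proved asymptotically: an upper bound for \<open>alpha_hat\<close> and a
  lower bound for \<open>alpha_hat_iid\<close>. Tensor powers are permutation invariant, so the
  i.i.d. error is the smaller of the two, and these bounds yield both limits.\<close>

definition ip :: "'i set \<Rightarrow> ('i \<Rightarrow> complex) \<Rightarrow> ('i \<Rightarrow> complex) \<Rightarrow> complex" where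
  "ip S u v = (\<Sum>i\<in>S. cnj (u i) * v i)"

definition mvec :: "'i set \<Rightarrow> 'i op \<Rightarrow> ('i \<Rightarrow> complex) \<Rightarrow> 'i \<Rightarrow> complex" where
  "mvec S M v = (\<lambda>i. \<Sum>j\<in>S. M i j * v j)"

definition qform :: "'i set \<Rightarrow> 'i op \<Rightarrow> ('i \<Rightarrow> complex) \<Rightarrow> complex" where
  "qform S M v = (\<Sum>i\<in>S. \<Sum>j\<in>S. cnj (v i) * M i j * v j)"

definition hermitian_on :: "'i set \<Rightarrow> 'i op \<Rightarrow> bool" where
  "hermitian_on S M \<longleftrightarrow> (\<forall>i\<in>S. \<forall>j\<in>S. M i j = cnj (M j i))"

lemma psd_iff_qform: "psd S M \<longleftrightarrow> (\<forall>v. Im (qform S M v) = 0 \<and> Re (qform S M v) \<ge> 0)"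
  by (simp add: psd_def qform_def)

lemma unitary_onI:
  assumes "\<And>i j. i \<in> S \<Longrightarrow> j \<in> S \<Longrightarrow> (\<Sum>k\<in>S. U i k * cnj (U j k)) = (if i = j then 1 else 0)"
    and "\<And>i j. i \<in> S \<Longrightarrow> j \<in> S \<Longrightarrow> (\<Sum>k\<in>S. cnj (U k i) * U k j) = (if i = j then 1 else 0)"
  shows "unitary_on S U"
  using assms by (simp add: unitary_on_def mmul_def madj_def mid_def)

lemma unitary_rows:
  assumes "unitary_on S U" "i \<in> S" "j \<in> S"
  shows "(\<Sum>k\<in>S. U i k * cnj (U j k)) = (if i = j then 1 else 0)"
  using assms by (simp add: unitary_on_def mmul_def madj_def mid_def)

lemma unitary_cols:
  assumes "unitary_on S U" "i \<in> S" "j \<in> S"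
  shows "(\<Sum>k\<in>S. cnj (U k i) * U k j) = (if i = j then 1 else 0)"
  using assms by (simp add: unitary_on_def mmul_def madj_def mid_def)

lemma unitary_madj: "unitary_on S U \<Longrightarrow> unitary_on S (madj U)"
  by (simp add: unitary_on_def madj_def mmul_def)

lemma mmul_assoc: "mmul S (mmul S A B) C = mmul S A (mmul S B C)"
proof (intro ext)
  fix i k
  have "mmul S (mmul S A B) C i k = (\<Sum>j\<in>S. \<Sum>l\<in>S. A i l * B l j * C j k)"
    by (simp add: mmul_def sum_distrib_right)
  also have "\<dots> = (\<Sum>l\<in>S. \<Sum>j\<in>S. A i l * B l j * C j k)"
    by (rule sum.swap)
  also have "\<dots> = mmul S A (mmul S B C) i k"
    by (simp add: mmul_def sum_distrib_left mult.assoc)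
  finally show "mmul S (mmul S A B) C i k = mmul S A (mmul S B C) i k" .
qed

lemma mmul_cong_right:
  "(\<And>j. j \<in> S \<Longrightarrow> B j k = B' j k) \<Longrightarrow> mmul S A B i k = mmul S A B' i k"
  by (simp add: mmul_def)

lemma mmul_cong_left:
  "(\<And>j. j \<in> S \<Longrightarrow> A i j = A' i j) \<Longrightarrow> mmul S A B i k = mmul S A' B i k"
  by (simp add: mmul_def)

lemma mmul_mid_left: "finite S \<Longrightarrow> i \<in> S \<Longrightarrow> mmul S mid B i k = B i k"
  by (simp add: mmul_def mid_def if_distrib[of "\<lambda>z. z * _"] cong: if_cong)

lemma mmul_mid_right: "finite S \<Longrightarrow> k \<in> S \<Longrightarrow> mmul S B mid i k = B i k"
  by (simp add: mmul_def mid_def if_distrib[of "\<lambda>z. _ * z"] cong: if_cong)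

lemma madj_mmul: "madj (mmul S A B) = mmul S (madj B) (madj A)"
  by (intro ext) (simp add: madj_def mmul_def mult.commute)

lemma madj_madj [simp]: "madj (madj A) = A"
  by (intro ext) (simp add: madj_def)

lemma unitary_cancel_left:
  assumes "finite S" "unitary_on S U" "i \<in> S"
  shows "mmul S U (mmul S (madj U) A) i k = A i k"
    and "mmul S (madj U) (mmul S U A) i k = A i k"
proof -
  have "mmul S U (mmul S (madj U) A) i k = mmul S mid A i k"
    unfolding mmul_assoc[symmetric]
    by (rule mmul_cong_left) (use assms in \<open>simp add: unitary_on_def\<close>)
  then show "mmul S U (mmul S (madj U) A) i k = A i k"
    using assms by (simp add: mmul_mid_left)
  have "mmul S (madj U) (mmul S U A) i k = mmul S mid A i k"
    unfolding mmul_assoc[symmetric]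
    by (rule mmul_cong_left) (use assms in \<open>simp add: unitary_on_def\<close>)
  then show "mmul S (madj U) (mmul S U A) i k = A i k"
    using assms by (simp add: mmul_mid_left)
qed

lemma unitary_mmul:
  assumes "finite S" "unitary_on S U" "unitary_on S V"
  shows "unitary_on S (mmul S U V)"
proof -
  have 1: "mmul S (mmul S U V) (madj (mmul S U V)) i j = mid i j" if "i \<in> S" "j \<in> S" for i j
  proof -
    have "mmul S (mmul S U V) (madj (mmul S U V)) i j
        = mmul S U (mmul S V (mmul S (madj V) (madj U))) i j"
      by (simp add: madj_mmul mmul_assoc)
    also have "\<dots> = mmul S U (madj U) i j"
      by (rule mmul_cong_right) (rule unitary_cancel_left(1)[OF assms(1,3)])
    finally show ?thesis using assms(2) that by (simp add: unitary_on_def)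
  qed
  have 2: "mmul S (madj (mmul S U V)) (mmul S U V) i j = mid i j" if "i \<in> S" "j \<in> S" for i j
  proof -
    have "mmul S (madj (mmul S U V)) (mmul S U V) i j
        = mmul S (madj V) (mmul S (madj U) (mmul S U V)) i j"
      by (simp add: madj_mmul mmul_assoc)
    also have "\<dots> = mmul S (madj V) V i j"
      by (rule mmul_cong_right) (rule unitary_cancel_left(2)[OF assms(1,2)])
    finally show ?thesis using assms(3) that by (simp add: unitary_on_def)
  qed
  show ?thesis unfolding unitary_on_def using 1 2 by blast
qed

definition mdiag :: "('i \<Rightarrow> real) \<Rightarrow> 'i op" where
  "mdiag d = (\<lambda>i j. if i = j then complex_of_real (d i) else 0)"

lemma mmul_mdiag_right: "finite S \<Longrightarrow> k \<in> S \<Longrightarrow> mmul S A (mdiag d) i k = A i k * complex_of_real (d k)"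
  by (simp add: mmul_def mdiag_def if_distrib[of "\<lambda>z. _ * z"] cong: if_cong)

lemma mmul_mdiag_left: "finite S \<Longrightarrow> i \<in> S \<Longrightarrow> mmul S (mdiag d) A i k = complex_of_real (d i) * A i k"
  by (simp add: mmul_def mdiag_def if_distrib[of "\<lambda>z. z * _"] cong: if_cong)

lemma spectral_decomp_iff:
  assumes "finite S"
  shows "spectral_decomp S M U d \<longleftrightarrow> unitary_on S U \<and>
    (\<forall>i\<in>S. \<forall>j\<in>S. M i j = mmul S U (mmul S (mdiag d) (madj U)) i j)"
proof -
  have "mmul S U (mmul S (mdiag d) (madj U)) i j
      = (\<Sum>k\<in>S. U i k * complex_of_real (d k) * cnj (U j k))" for i j
    using assms by (simp add: mmul_def[of S U] mmul_mdiag_left madj_def mult.assoc)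
  then show ?thesis by (simp add: spectral_decomp_def)
qed

lemma spectral_decomp_conj:
  assumes S: "finite S" and N: "spectral_decomp S N U d" and H: "unitary_on S H"
    and M: "\<And>i j. i \<in> S \<Longrightarrow> j \<in> S \<Longrightarrow> M i j = mmul S H (mmul S N (madj H)) i j"
  shows "spectral_decomp S M (mmul S H U) d"
  unfolding spectral_decomp_iff[OF S]
proof (intro conjI ballI)
  show "unitary_on S (mmul S H U)"
    using N H S by (simp add: unitary_mmul spectral_decomp_def)
  fix i j assume ij: "i \<in> S" "j \<in> S"
  have "M i j = mmul S H (mmul S (mmul S U (mmul S (mdiag d) (madj U))) (madj H)) i j"
    unfolding M[OF ij]
    by (intro mmul_cong_right mmul_cong_left) (use N ij in \<open>simp add: spectral_decomp_iff[OF S]\<close>)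
  then show "M i j = mmul S (mmul S H U) (mmul S (mdiag d) (madj (mmul S H U))) i j"
    by (simp add: mmul_assoc madj_mmul)
qed

text \<open>The carrier is a finite subset of an arbitrary type, so it is enumerated by
  \<open>e\<close> to obtain a complex matrix of positive dimension, whose spectrum is
  nonempty.\<close>

lemma ex_eigenvector:
  fixes M :: "'i op"
  assumes S: "finite S" "S \<noteq> {}"
  obtains v \<kappa> where "\<exists>i\<in>S. v i \<noteq> 0" "\<And>i. i \<in> S \<Longrightarrow> mvec S M v i = \<kappa> * v i"
proof -
  define n where "n = card S"
  obtain e where e: "bij_betw e {0..<n} S"
    using ex_bij_betw_nat_finite[OF S(1)] n_def by blast
  define A where "A = Matrix.mat n n (\<lambda>(i, j). M (e i) (e j))"
  have A: "A \<in> carrier_mat n n" by (simp add: A_def)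
  have "n \<noteq> 0" using S by (simp add: n_def)
  then obtain k where "eigenvalue A k"
    using spectrum_non_empty[OF A] by (auto simp: spectrum_def)
  then obtain w where w: "w \<in> carrier_vec n" "w \<noteq> 0\<^sub>v n" "A *\<^sub>v w = k \<cdot>\<^sub>v w"
    using A by (auto simp: eigenvalue_def eigenvector_def)
  define g where "g = the_inv_into {0..<n} e"
  have ge: "g (e i) = i" if "i < n" for i
    using e that unfolding g_def bij_betw_def by (simp add: the_inv_into_f_f)
  define v where "v = (\<lambda>x. Matrix.vec_index w (g x))"
  have ve: "v (e i) = Matrix.vec_index w i" if "i < n" for i
    using that by (simp add: v_def ge)
  show ?thesis
  proof (rule that)
    show "\<exists>i\<in>S. v i \<noteq> 0"
    proof (rule ccontr)
      assume *: "\<not> (\<exists>i\<in>S. v i \<noteq> 0)"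
      have "w = 0\<^sub>v n"
      proof (rule Matrix.eq_vecI)
        fix i assume i: "i < dim_vec (0\<^sub>v n :: complex vec)"
        then have "e i \<in> S" using e by (auto simp: bij_betw_def)
        with * i ve[of i] show "Matrix.vec_index w i = Matrix.vec_index (0\<^sub>v n) i" by simp
      qed (use w in simp)
      with w show False by simp
    qed
    fix x assume "x \<in> S"
    then obtain i where i: "i < n" "x = e i" using e by (auto simp: bij_betw_def)
    have "mvec S M v x = (\<Sum>j\<in>{0..<n}. M (e i) (e j) * v (e j))"
      unfolding mvec_def i(2) by (rule sum.reindex_bij_betw[OF e, symmetric])
    also have "\<dots> = (\<Sum>j\<in>{0..<n}. M (e i) (e j) * Matrix.vec_index w j)"
      by (rule sum.cong) (auto simp: ve)
    also have "\<dots> = Matrix.vec_index (A *\<^sub>v w) i"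
      using i w(1) by (simp add: A_def scalar_prod_def)
    also have "\<dots> = k * v x"
      using i w by (simp add: ve)
    finally show "mvec S M v x = k * v x" .
  qed
qed

lemma unitary_mid:
  assumes "unitary_on S U" "i \<in> S" "j \<in> S"
  shows "mmul S U (madj U) i j = mid i j" "mmul S (madj U) U i j = mid i j"
  using assms by (simp_all add: unitary_on_def)

lemma unitary_on_mid:
  assumes "finite S"
  shows "unitary_on S mid"
proof -
  have "madj mid = (mid :: 'a op)" by (intro ext) (simp add: madj_def mid_def)
  then show ?thesis using assms by (simp add: unitary_on_def mmul_mid_left)
qed

text \<open>A reflection can map the unit vector at \<open>s\<close> to \<open>v\<close> only if the entry \<open>v s\<close> is real.\<close>

lemma householder:
  assumes S: "finite S" "s \<in> S" and unit: "(\<Sum>i\<in>S. cnj (v i) * v i) = 1" and re: "cnj (v s) = v s"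
  obtains H where "unitary_on S H" "\<And>i. i \<in> S \<Longrightarrow> H i s = v i"
proof -
  define w where "w = (\<lambda>i. (if i = s then 1 else 0) - v i)"
  \<comment> \<open>This will turn out to be the squared norm of \<open>w\<close>. It vanishes
    exactly when \<open>v\<close> already is the unit vector at \<open>s\<close> on
    \<open>S\<close>, and then the reflection formula would divide by zero.\<close>
  define c where "c = 2 * (1 - v s)"
  have ww: "(\<Sum>i\<in>S. cnj (w i) * w i) = c"
  proof -
    have "(\<Sum>i\<in>S. cnj (w i) * w i)
      = (\<Sum>i\<in>S. (if i = s then 1 - v s - cnj (v s) else 0) + cnj (v i) * v i)"
      by (rule sum.cong) (auto simp: w_def algebra_simps)
    also have "\<dots> = c"
      using S unit by (simp add: sum.distrib c_def re)
    finally show ?thesis .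
  qed
  have cr: "cnj c = c" by (simp add: c_def re)
  show ?thesis
  proof (cases "c = 0")
    case True
    have vi: "v i = (if i = s then 1 else 0)" if "i \<in> S" for i
    proof -
      have "(\<Sum>i\<in>S. complex_of_real ((cmod (w i))\<^sup>2)) = 0"
        using ww True by (simp only: mult.commute[of "cnj _"] complex_norm_square[symmetric])
      then have "complex_of_real (\<Sum>i\<in>S. (cmod (w i))\<^sup>2) = 0" by simp
      then have "(\<Sum>i\<in>S. (cmod (w i))\<^sup>2) = 0" using of_real_eq_0_iff by blast
      then have "(cmod (w i))\<^sup>2 = 0" using that S sum_nonneg_eq_0_iff[of S "\<lambda>i. (cmod (w i))\<^sup>2"] by auto
      then show ?thesis by (auto simp: w_def split: if_splits)
    qed
    show ?thesis
    proof (rule that[of mid])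
      show "unitary_on S mid" using S by (intro unitary_on_mid)
      show "mid i s = v i" if "i \<in> S" for i using vi[OF that] by (simp add: mid_def)
    qed
  next
    case False
    define H where "H = (\<lambda>i j. mid i j - 2 * w i * cnj (w j) / c)"
    have Hadj: "cnj (H j i) = H i j" for i j
      by (simp add: H_def mid_def cr)
    have rows: "(\<Sum>k\<in>S. H i k * cnj (H j k)) = (if i = j then 1 else 0)" if "i \<in> S" "j \<in> S" for i j
    proof -
      have "(\<Sum>k\<in>S. H i k * cnj (H j k)) = (\<Sum>k\<in>S. (if k = i then (if i = j then 1 else 0) - 2 * w i * cnj (w j) / c else 0)
         - (if k = j then 2 * w i * cnj (w j) / c else 0) + (4 * w i * cnj (w j) / c^2) * (cnj (w k) * w k))"
        by (rule sum.cong) (auto simp: H_def mid_def cr algebra_simps power2_eq_square)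
      also have "\<dots> = (if i = j then 1 else 0) - 2 * w i * cnj (w j) / c - 2 * w i * cnj (w j) / c
          + (4 * w i * cnj (w j) / c^2) * c"
        unfolding sum.distrib sum_subtractf sum_distrib_left[symmetric] ww using S that by simp
      also have "\<dots> = (if i = j then 1 else 0)"
        using False by (simp add: power2_eq_square)
      finally show ?thesis .
    qed
    have cols: "(\<Sum>k\<in>S. cnj (H k i) * H k j) = (if i = j then 1 else 0)" if "i \<in> S" "j \<in> S" for i j
      using rows[OF that] by (simp add: Hadj)
    have "H i s = v i" for i
      using False by (simp add: H_def w_def c_def mid_def re field_simps)
    then show ?thesis using that[of H] unitary_onI[OF rows cols] by blast
  qed
qed

text \<open>Deflation by induction on the index set: conjugating by a unitary whose column
  \<open>s\<close> is an eigenvector clears row and column \<open>s\<close> off the diagonal, and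
  the induction hypothesis applies to the remaining block.\<close>

lemma ex_spectral_decomp:
  assumes "finite S" "hermitian_on S M"
  shows "\<exists>U d. spectral_decomp S M U d"
  using assms
proof (induction S arbitrary: M rule: finite_induct)
  case empty
  then show ?case by (auto simp: spectral_decomp_def unitary_on_def)
next
  case (insert s S' M)
  let ?S = "insert s S'"
  have S: "finite ?S" "?S \<noteq> {}" "s \<in> ?S" using insert by auto
  obtain v0 \<kappa> where v0: "\<exists>i\<in>?S. v0 i \<noteq> 0" "\<And>i. i \<in> ?S \<Longrightarrow> mvec ?S M v0 i = \<kappa> * v0 i"
    using ex_eigenvector[OF S(1,2)] by blast
  define N2 where "N2 = (\<Sum>i\<in>?S. (cmod (v0 i))\<^sup>2)"
  have N2: "N2 > 0"
  proof -
    obtain i where i: "i \<in> ?S" "v0 i \<noteq> 0" using v0 by blast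
    have "0 < (cmod (v0 i))\<^sup>2" using i by simp
    also have "\<dots> \<le> N2" unfolding N2_def by (rule member_le_sum) (use i S in auto)
    finally show ?thesis .
  qed
  \<comment> \<open>A phase that makes the entry at \<open>s\<close> real, as the reflection
    requires; an eigenvector with entry 0 at \<open>s\<close> needs no correction.\<close>
  define ph where "ph = (if v0 s = 0 then 1 else cnj (v0 s) / complex_of_real (cmod (v0 s)))"
  have ph: "cmod ph = 1" by (auto simp: ph_def norm_divide)
  have ph2: "cnj ph * ph = 1"
    using ph by (metis complex_norm_square mult.commute of_real_1 one_power2)
  define v where "v = (\<lambda>i. ph * v0 i / complex_of_real (sqrt N2))"
  have vv: "(\<Sum>i\<in>?S. cnj (v i) * v i) = 1"
  proof -
    have sq: "complex_of_real (sqrt N2) * complex_of_real (sqrt N2) = complex_of_real N2"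
      using N2 by (simp flip: of_real_mult)
    have "cnj (v i) * v i = (cnj ph * ph) * (cnj (v0 i) * v0 i) / (complex_of_real (sqrt N2) * complex_of_real (sqrt N2))" for i
      by (simp add: v_def)
    then have "cnj (v i) * v i = complex_of_real ((cmod (v0 i))\<^sup>2) / complex_of_real N2" for i
      unfolding ph2 sq by (simp only: mult_1 mult.commute[of "cnj _"] complex_norm_square[symmetric])
    then have "(\<Sum>i\<in>?S. cnj (v i) * v i) = complex_of_real N2 / complex_of_real N2"
      by (simp only: sum_divide_distrib[symmetric] of_real_sum[symmetric] N2_def)
    then show ?thesis using N2 by simp
  qed
  have vs: "cnj (v s) = v s"
  proof (cases "v0 s = 0")
    case False
    have "ph * v0 s = complex_of_real (cmod (v0 s))"
      using False by (simp add: ph_def field_simps complex_norm_square[symmetric] power2_eq_square flip: of_real_mult)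
    then have "v s = complex_of_real (cmod (v0 s) / sqrt N2)" by (simp add: v_def)
    then show ?thesis by simp
  qed (simp add: v_def)
  have Mv: "(\<Sum>j\<in>?S. M i j * v j) = \<kappa> * v i" if "i \<in> ?S" for i
  proof -
    have "(\<Sum>j\<in>?S. M i j * v j) = ph / complex_of_real (sqrt N2) * mvec ?S M v0 i"
      unfolding mvec_def v_def sum_distrib_left by (rule sum.cong) auto
    then show ?thesis using v0(2)[OF that] by (simp add: v_def)
  qed
  obtain H where H: "unitary_on ?S H" "\<And>i. i \<in> ?S \<Longrightarrow> H i s = v i"
    using householder[OF S(1,3) vv vs] by blast
  define N where "N = mmul ?S (madj H) (mmul ?S M H)"
  have herm: "N i j = cnj (N j i)" if "i \<in> ?S" "j \<in> ?S" for i j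
  proof -
    have M: "madj M k l = M k l" if "k \<in> ?S" "l \<in> ?S" for k l
      proof -
      have "\<forall>j\<in>?S. M k j = cnj (M j k)"
        using insert.prems that(1) unfolding hermitian_on_def by (rule bspec)
      then have "M k l = cnj (M l k)" using that(2) by (rule bspec)
      then show ?thesis by (simp add: madj_def)
    qed
    have "cnj (N j i) = madj N i j" by (simp add: madj_def)
    also have "\<dots> = mmul ?S (madj H) (mmul ?S (madj M) H) i j"
      unfolding N_def madj_mmul by (simp add: mmul_assoc)
    also have "\<dots> = N i j"
      unfolding N_def by (intro mmul_cong_right mmul_cong_left)
        (simp add: M)
    finally show ?thesis by simp
  qed
  have Ncol: "N i s = (if i = s then \<kappa> else 0)" if "i \<in> ?S" for i
  proof -
    have "N i s = (\<Sum>j\<in>?S. cnj (H j i) * (\<Sum>l\<in>?S. M j l * v l))"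
      unfolding N_def mmul_def madj_def by (intro sum.cong arg_cong2[where f="(*)"]) (use H in auto)
    also have "\<dots> = (\<Sum>j\<in>?S. \<kappa> * (cnj (H j i) * H j s))"
      by (intro sum.cong) (use Mv H in auto)
    also have "\<dots> = \<kappa> * (if i = s then 1 else 0)"
      unfolding sum_distrib_left[symmetric] using unitary_cols[OF H(1) that S(3)] by simp
    finally show ?thesis by simp
  qed
  \<comment> \<open>The eigenvalue is a diagonal entry of a hermitian matrix, hence real, and can be
    stored as \<open>Re \<kappa>\<close> below.\<close>
  have \<kappa>: "cnj \<kappa> = \<kappa>" using herm[OF S(3) S(3)] Ncol[OF S(3)] by simp
  have Nrow: "N s j = (if j = s then \<kappa> else 0)" if "j \<in> ?S" for j
    using herm[OF S(3) that] Ncol[OF that] \<kappa> by auto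
  have "hermitian_on S' N" unfolding hermitian_on_def by (intro ballI) (rule herm; simp)
  then obtain U' d' where U': "spectral_decomp S' N U' d'" using insert.IH by blast
  then have uU': "unitary_on S' U'" by (simp add: spectral_decomp_def)
  define U where "U = (\<lambda>i k. if i = s then (if k = s then 1 else 0) else if k = s then 0 else U' i k)"
  define d where "d = (\<lambda>k. if k = s then Re \<kappa> else d' k)"
  have ne: "i \<noteq> s" if "i \<in> S'" for i using that insert.hyps by auto
  have s': "(\<Sum>k\<in>?S. f k) = f s + (\<Sum>k\<in>S'. f k)" for f :: "_ \<Rightarrow> complex"
    using insert.hyps by simp
  have sd: "spectral_decomp ?S N U d"
    unfolding spectral_decomp_def
  proof (intro conjI ballI)
    show "unitary_on ?S U"
    proof (rule unitary_onI)
      fix i j assume ij: "i \<in> ?S" "j \<in> ?S"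
      have "(\<Sum>k\<in>S'. U i k * cnj (U j k)) = (if i = s \<or> j = s then 0 else \<Sum>k\<in>S'. U' i k * cnj (U' j k))"
        by (auto simp: U_def ne intro!: sum.neutral sum.cong)
      then show "(\<Sum>k\<in>?S. U i k * cnj (U j k)) = (if i = j then 1 else 0)"
        unfolding s' using ij unitary_rows[OF uU', of i j] ne by (auto simp: U_def)
      have "(\<Sum>k\<in>S'. cnj (U k i) * U k j) = (if i = s \<or> j = s then 0 else \<Sum>k\<in>S'. cnj (U' k i) * U' k j)"
        by (auto simp: U_def ne intro!: sum.neutral sum.cong)
      then show "(\<Sum>k\<in>?S. cnj (U k i) * U k j) = (if i = j then 1 else 0)"
        unfolding s' using ij unitary_cols[OF uU', of i j] ne by (auto simp: U_def)
    qed
    fix i j assume ij: "i \<in> ?S" "j \<in> ?S"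
    have "(\<Sum>k\<in>S'. U i k * complex_of_real (d k) * cnj (U j k))
        = (if i = s \<or> j = s then 0 else \<Sum>k\<in>S'. U' i k * complex_of_real (d' k) * cnj (U' j k))"
      by (auto simp: U_def d_def ne intro!: sum.neutral sum.cong)
    moreover have "complex_of_real (Re \<kappa>) = \<kappa>" using \<kappa> by (simp add: complex_eq_iff)
    ultimately show "N i j = (\<Sum>k\<in>?S. U i k * complex_of_real (d k) * cnj (U j k))"
      unfolding s' using ij Nrow Ncol U' ne by (auto simp: U_def d_def spectral_decomp_def)
  qed
  have MH: "M i j = mmul ?S H (mmul ?S N (madj H)) i j" if "i \<in> ?S" "j \<in> ?S" for i j
  proof -
    have "mmul ?S H (mmul ?S N (madj H)) i j = mmul ?S H (mmul ?S (madj H) (mmul ?S M (mmul ?S H (madj H)))) i j"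
      by (simp add: N_def mmul_assoc)
    also have "\<dots> = mmul ?S M (mmul ?S H (madj H)) i j"
      using unitary_cancel_left(1)[OF S(1) H(1) that(1)] .
    also have "\<dots> = mmul ?S M mid i j"
      by (rule mmul_cong_right) (use that in \<open>simp only: unitary_mid[OF H(1)]\<close>)
    finally show ?thesis using S that by (simp add: mmul_mid_right)
  qed
  show ?case using spectral_decomp_conj[OF S(1) sd H(1) MH] by blast
qed

lemma cnj_mult_self: "cnj z * z = (complex_of_real (cmod z))\<^sup>2"
  by (metis complex_norm_square mult.commute of_real_power)

text \<open>\<open>mfun\<close> picks its decomposition by \<open>SOME\<close>; independence of that
  choice is what makes it computable. The change of basis \<open>V\<close> intertwines the two
  diagonal matrices, so \<open>V k l\<close> can be nonzero only if \<open>d k = d' l\<close>, and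
  then \<open>f\<close> takes the same value at both.\<close>

lemma spectral_fun_unique:
  fixes f :: "real \<Rightarrow> real"
  assumes S: "finite S" and 1: "spectral_decomp S M U d" and 2: "spectral_decomp S M U' d'"
    and ij: "i \<in> S" "j \<in> S"
  shows "(\<Sum>k\<in>S. U i k * complex_of_real (f (d k)) * cnj (U j k))
       = (\<Sum>k\<in>S. U' i k * complex_of_real (f (d' k)) * cnj (U' j k))"
proof -
  have uU: "unitary_on S U" and uU': "unitary_on S U'"
    using 1 2 by (auto simp: spectral_decomp_def)
  define V where "V = mmul S (madj U) U'"
  have M1: "M i j = mmul S U (mmul S (mdiag d) (madj U)) i j"
    and M2: "M i j = mmul S U' (mmul S (mdiag d') (madj U')) i j" if "i \<in> S" "j \<in> S" for i j
    using 1 2 that by (simp_all add: spectral_decomp_iff[OF S])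
  have VU: "mmul S V (madj U') i j = madj U i j" if "i \<in> S" "j \<in> S" for i j
  proof -
    have "mmul S V (madj U') i j = mmul S (madj U) (mmul S U' (madj U')) i j"
      by (simp add: V_def mmul_assoc)
    also have "\<dots> = mmul S (madj U) mid i j"
      by (rule mmul_cong_right) (use that in \<open>simp only: unitary_mid[OF uU']\<close>)
    finally show ?thesis using S that by (simp add: mmul_mid_right)
  qed
  have DV: "mmul S (mdiag d) V k l = mmul S V (mdiag d') k l" if kl: "k \<in> S" "l \<in> S" for k l
  proof -
    have "mmul S (mdiag d) V k l = mmul S (madj U) (mmul S U (mmul S (mdiag d) V)) k l"
      using unitary_cancel_left(2)[OF S uU kl(1)] by metis
    also have "\<dots> = mmul S (madj U) (mmul S (mmul S U (mmul S (mdiag d) (madj U))) U') k l"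
      by (simp add: V_def mmul_assoc)
    also have "\<dots> = mmul S (madj U) (mmul S (mmul S U' (mmul S (mdiag d') (madj U'))) U') k l"
      by (intro mmul_cong_right mmul_cong_left) (simp add: M1[symmetric] M2[symmetric])
    also have "\<dots> = mmul S V (mmul S (mdiag d') (mmul S (madj U') U')) k l"
      by (simp add: V_def mmul_assoc)
    also have "\<dots> = mmul S V (mmul S (mdiag d') mid) k l"
      by (intro mmul_cong_right) (use that in \<open>simp only: unitary_mid[OF uU']\<close>)
    also have "\<dots> = mmul S V (mdiag d') k l"
      by (intro mmul_cong_right) (use S that in \<open>simp add: mmul_mid_right\<close>)
    finally show ?thesis .
  qed
  have FV: "mmul S (mdiag (f \<circ> d)) V k l = mmul S V (mdiag (f \<circ> d')) k l" if kl: "k \<in> S" "l \<in> S" for k l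
  proof (cases "V k l = 0")
    case False
    then have "d k = d' l" using DV[OF kl] S kl by (simp add: mmul_mdiag_left mmul_mdiag_right)
    then show ?thesis using S kl by (simp add: mmul_mdiag_left mmul_mdiag_right)
  qed (use S kl in \<open>simp add: mmul_mdiag_left mmul_mdiag_right\<close>)
  have "mmul S U (mmul S (mdiag (f \<circ> d)) (madj U)) i j
      = mmul S U (mmul S (mdiag (f \<circ> d)) (mmul S V (madj U'))) i j"
    by (intro mmul_cong_right) (simp add: VU ij)
  also have "\<dots> = mmul S U (mmul S (mmul S (mdiag (f \<circ> d)) V) (madj U')) i j"
    by (simp add: mmul_assoc)
  also have "\<dots> = mmul S U (mmul S (mmul S V (mdiag (f \<circ> d'))) (madj U')) i j"
    by (intro mmul_cong_right mmul_cong_left) (simp add: FV)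
  also have "\<dots> = mmul S U (mmul S (madj U) (mmul S U' (mmul S (mdiag (f \<circ> d')) (madj U')))) i j"
    by (simp add: V_def mmul_assoc)
  also have "\<dots> = mmul S U' (mmul S (mdiag (f \<circ> d')) (madj U')) i j"
    by (rule unitary_cancel_left(1)[OF S uU ij(1)])
  finally show ?thesis
    using S by (simp add: mmul_def[of S U] mmul_def[of S U'] mmul_mdiag_left madj_def mult.assoc)
qed

lemma mfun_spectral:
  assumes "finite S" "spectral_decomp S M U d" "i \<in> S" "j \<in> S"
  shows "mfun S f M i j = (\<Sum>k\<in>S. U i k * complex_of_real (f (d k)) * cnj (U j k))"
proof -
  define p where "p = (SOME p. spectral_decomp S M (fst p) (snd p))"
  have "spectral_decomp S M (fst p) (snd p)"
    unfolding p_def by (rule someI[of _ "(U, d)"]) (use assms in simp)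
  from spectral_fun_unique[OF assms(1) this assms(2,3,4)]
  show ?thesis by (simp add: mfun_def p_def Let_def)
qed

section \<open>Quadratic forms, positivity and traces in an eigenbasis\<close>

lemma qform_restrict:
  assumes "finite S" "T \<subseteq> S" "\<And>i. i \<in> S - T \<Longrightarrow> v i = 0"
  shows "qform S M v = qform T M v"
proof -
  have "(\<Sum>j\<in>S. cnj (v i) * M i j * v j) = (\<Sum>j\<in>T. cnj (v i) * M i j * v j)" for i
    by (rule sum.mono_neutral_right) (use assms in auto)
  then have "qform S M v = (\<Sum>i\<in>S. \<Sum>j\<in>T. cnj (v i) * M i j * v j)"
    by (simp add: qform_def)
  also have "\<dots> = qform T M v" unfolding qform_def
    by (rule sum.mono_neutral_right) (use assms in auto)
  finally show ?thesis .
qed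

text \<open>Polarisation: the form is real on every vector supported on \<open>i\<close> and
  \<open>j\<close> with entries 1 and c; c = 1 compares the imaginary parts of \<open>M i j\<close>
  and \<open>M j i\<close>, and c = \<i> the real parts.\<close>

lemma psd_hermitian:
  assumes "finite S" "psd S M"
  shows "hermitian_on S M"
  unfolding hermitian_on_def
proof (intro ballI)
  fix i j assume ij: "i \<in> S" "j \<in> S"
  have im: "Im (qform S M v) = 0" for v using assms by (simp add: psd_iff_qform)
  have diag: "Im (M k k) = 0" if "k \<in> S" for k
  proof -
    have "qform S M (\<lambda>x. if x = k then 1 else 0) = qform {k} M (\<lambda>x. if x = k then 1 else 0)"
      by (rule qform_restrict) (use assms that in auto)
    then show ?thesis using im[of "\<lambda>x. if x = k then 1 else 0"] by (simp add: qform_def)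
  qed
  show "M i j = cnj (M j i)"
  proof (cases "i = j")
    case True
    then show ?thesis using diag[OF ij(1)] by (simp add: complex_eq_iff)
  next
    case False
    have *: "Im (M i i + c * M i j + cnj c * M j i + cnj c * c * M j j) = 0" for c
    proof -
      let ?v = "\<lambda>x. if x = i then 1 else if x = j then c else 0"
      have "qform S M ?v = qform {i, j} M ?v"
        by (rule qform_restrict) (use assms ij in auto)
      then show ?thesis using im[of ?v] False by (simp add: qform_def algebra_simps)
    qed
    from *[of 1] *[of \<i>] diag[OF ij(1)] diag[OF ij(2)] show ?thesis
      by (simp add: complex_eq_iff)
  qed
qed

lemma qform_spectral:
  assumes "finite S" "spectral_decomp S M U d"
  shows "qform S M v = complex_of_real (\<Sum>k\<in>S. d k * (cmod (ip S (\<lambda>i. U i k) v))\<^sup>2)"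
proof -
  have "qform S M v = (\<Sum>i\<in>S. \<Sum>j\<in>S. \<Sum>k\<in>S. d k * (cnj (v i) * U i k) * (cnj (U j k) * v j))"
    unfolding qform_def using assms(2)
    by (intro sum.cong) (simp_all add: spectral_decomp_def sum_distrib_left sum_distrib_right mult_ac)
  also have "\<dots> = (\<Sum>i\<in>S. \<Sum>k\<in>S. \<Sum>j\<in>S. d k * (cnj (v i) * U i k) * (cnj (U j k) * v j))"
    by (intro sum.cong[OF refl] sum.swap)
  also have "\<dots> = (\<Sum>k\<in>S. \<Sum>i\<in>S. \<Sum>j\<in>S. d k * (cnj (v i) * U i k) * (cnj (U j k) * v j))"
    by (rule sum.swap)
  also have "\<dots> = (\<Sum>k\<in>S. d k * (cnj (ip S (\<lambda>i. U i k) v) * ip S (\<lambda>i. U i k) v))"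
    by (intro sum.cong[OF refl]) (simp add: ip_def sum_distrib_left sum_distrib_right mult_ac)
  also have "\<dots> = complex_of_real (\<Sum>k\<in>S. d k * (cmod (ip S (\<lambda>i. U i k) v))\<^sup>2)"
    by (simp add: cnj_mult_self)
  finally show ?thesis .
qed

lemma mid_spectral:
  assumes "finite S" "unitary_on S U"
  shows "spectral_decomp S mid U (\<lambda>_. 1)"
  using assms unitary_rows[OF assms(2)] by (simp add: spectral_decomp_def mid_def)

definition nsq :: "'i set \<Rightarrow> ('i \<Rightarrow> complex) \<Rightarrow> real" where
  "nsq S v = (\<Sum>i\<in>S. (cmod (v i))\<^sup>2)"

lemma nsq_nonneg: "nsq S v \<ge> 0"
  by (simp add: nsq_def sum_nonneg)

lemma ip_self: "ip S v v = complex_of_real (nsq S v)"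
  by (simp add: ip_def nsq_def cnj_mult_self)

lemma qform_mid: "finite S \<Longrightarrow> qform S mid v = complex_of_real (nsq S v)"
  by (simp add: qform_def mid_def nsq_def cnj_mult_self
      if_distrib[of "\<lambda>z. _ * z"] if_distrib[of "\<lambda>z. z * _"] cong: if_cong)

text \<open>The identity has a spectral decomposition in every unitary, so this is
  \<open>qform_spectral\<close> with all eigenvalues equal to 1.\<close>

lemma parseval:
  assumes "finite S" "unitary_on S U"
  shows "(\<Sum>k\<in>S. (cmod (ip S (\<lambda>i. U i k) v))\<^sup>2) = nsq S v"
proof -
  have "complex_of_real (nsq S v) = complex_of_real (\<Sum>k\<in>S. (cmod (ip S (\<lambda>i. U i k) v))\<^sup>2)"
    using qform_spectral[OF assms(1) mid_spectral[OF assms], of v] qform_mid[OF assms(1), of v] by simp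
  then show ?thesis using of_real_eq_iff by metis
qed

lemma nsq_unitary:
  assumes "finite S" "unitary_on S U"
  shows "nsq S (mvec S U v) = nsq S v"
  using parseval[OF assms(1) unitary_madj[OF assms(2)], of v]
  by (simp add: nsq_def mvec_def ip_def madj_def)

lemma ip_unitary_cols:
  assumes "unitary_on S U" "k \<in> S" "l \<in> S"
  shows "ip S (\<lambda>i. U i k) (\<lambda>i. U i l) = (if k = l then 1 else 0)"
  using unitary_cols[OF assms] by (simp add: ip_def)

lemma qform_eigenvector:
  assumes "finite S" "spectral_decomp S M U d" "k \<in> S"
  shows "qform S M (\<lambda>i. U i k) = complex_of_real (d k)"
proof -
  have "(\<Sum>l\<in>S. d l * (cmod (ip S (\<lambda>i. U i l) (\<lambda>i. U i k)))\<^sup>2) = (\<Sum>l\<in>S. if l = k then d k else 0)"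
    using assms by (intro sum.cong) (auto simp: ip_unitary_cols spectral_decomp_def)
  then show ?thesis using assms by (simp add: qform_spectral)
qed

lemma psd_eigenvalue_nonneg:
  assumes "finite S" "spectral_decomp S M U d" "psd S M" "k \<in> S"
  shows "d k \<ge> 0"
  using qform_eigenvector[OF assms(1,2,4)] assms(3) by (auto simp: psd_iff_qform dest: spec[of _ "\<lambda>i. U i k"])

lemma psd_spectral:
  assumes "finite S" "spectral_decomp S M U d" "\<And>k. k \<in> S \<Longrightarrow> d k \<ge> 0"
  shows "psd S M"
  using assms by (simp add: psd_iff_qform qform_spectral sum_nonneg)

lemma trace_spectral:
  assumes "spectral_decomp S R U d"
  shows "mtrace S (mmul S R T) = (\<Sum>k\<in>S. complex_of_real (d k) * qform S T (\<lambda>i. U i k))"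
proof -
  have "mtrace S (mmul S R T) = (\<Sum>i\<in>S. \<Sum>j\<in>S. \<Sum>k\<in>S. d k * (cnj (U j k) * T j i * U i k))"
    unfolding mtrace_def mmul_def using assms
    by (intro sum.cong) (simp_all add: spectral_decomp_def sum_distrib_left sum_distrib_right mult_ac)
  also have "\<dots> = (\<Sum>i\<in>S. \<Sum>k\<in>S. \<Sum>j\<in>S. d k * (cnj (U j k) * T j i * U i k))"
    by (intro sum.cong[OF refl] sum.swap)
  also have "\<dots> = (\<Sum>k\<in>S. \<Sum>i\<in>S. \<Sum>j\<in>S. d k * (cnj (U j k) * T j i * U i k))"
    by (rule sum.swap)
  also have "\<dots> = (\<Sum>k\<in>S. \<Sum>j\<in>S. \<Sum>i\<in>S. d k * (cnj (U j k) * T j i * U i k))"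
    by (intro sum.cong[OF refl] sum.swap)
  also have "\<dots> = (\<Sum>k\<in>S. complex_of_real (d k) * qform S T (\<lambda>i. U i k))"
    by (simp add: qform_def sum_distrib_left)
  finally show ?thesis .
qed

lemma Re_trace_spectral:
  assumes "spectral_decomp S R U d"
  shows "Re (mtrace S (mmul S R T)) = (\<Sum>k\<in>S. d k * Re (qform S T (\<lambda>i. U i k)))"
  by (simp add: trace_spectral[OF assms])

lemma trace_eigenvalues:
  assumes "finite S" "spectral_decomp S M U d"
  shows "mtrace S M = complex_of_real (\<Sum>k\<in>S. d k)"
proof -
  have "mtrace S (mmul S M mid) = mtrace S M"
    unfolding mtrace_def by (intro sum.cong) (use assms in \<open>auto simp: mmul_mid_right\<close>)
  moreover have "qform S mid (\<lambda>i. U i k) = 1" if "k \<in> S" for k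
    using ip_unitary_cols[of S U k k] that assms
    by (simp add: qform_mid ip_self spectral_decomp_def)
  ultimately show ?thesis using trace_spectral[OF assms(2), of mid] by simp
qed

lemma psd_ex_spectral:
  assumes "finite S" "psd S M"
  obtains U d where "spectral_decomp S M U d" "\<And>k. k \<in> S \<Longrightarrow> d k \<ge> 0"
  using ex_spectral_decomp[OF assms(1) psd_hermitian[OF assms]] psd_eigenvalue_nonneg[OF assms(1) _ assms(2)]
  by blast

lemma psd_trace_nonneg:
  assumes "finite S" "psd S R" "psd S T"
  shows "Re (mtrace S (mmul S R T)) \<ge> 0"
proof -
  obtain U d where "spectral_decomp S R U d" "\<And>k. k \<in> S \<Longrightarrow> d k \<ge> 0"
    using psd_ex_spectral[OF assms(1,2)] by blast
  then show ?thesis using assms(3) by (auto simp: Re_trace_spectral psd_iff_qform intro!: sum_nonneg)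
qed

subsection \<open>Tests for a pair of operators\<close>

lemma mvec_mmul: "mvec S (mmul S A B) v = mvec S A (mvec S B v)"
proof
  fix i
  have "mvec S (mmul S A B) v i = (\<Sum>k\<in>S. \<Sum>j\<in>S. A i j * B j k * v k)"
    by (simp add: mvec_def mmul_def sum_distrib_right)
  also have "\<dots> = (\<Sum>j\<in>S. \<Sum>k\<in>S. A i j * B j k * v k)" by (rule sum.swap)
  finally show "mvec S (mmul S A B) v i = mvec S A (mvec S B v) i"
    by (simp add: mvec_def sum_distrib_left mult.assoc)
qed

lemma mvec_cong_op: "(\<And>j. j \<in> S \<Longrightarrow> A i j = B i j) \<Longrightarrow> mvec S A v i = mvec S B v i"
  by (simp add: mvec_def)

lemma ip_cong: "(\<And>i. i \<in> S \<Longrightarrow> u i = u' i) \<Longrightarrow> (\<And>i. i \<in> S \<Longrightarrow> v i = v' i) \<Longrightarrow> ip S u v = ip S u' v'"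
  by (simp add: ip_def)

lemma nsq_cong: "(\<And>i. i \<in> S \<Longrightarrow> u i = u' i) \<Longrightarrow> nsq S u = nsq S u'"
  by (simp add: nsq_def)

lemma qform_ip: "qform S M v = ip S v (mvec S M v)"
  by (simp add: qform_def ip_def mvec_def sum_distrib_left mult.assoc)

lemma ip_mvec_madj: "ip S u (mvec S A v) = ip S (mvec S (madj A) u) v"
proof -
  have "ip S u (mvec S A v) = (\<Sum>i\<in>S. \<Sum>j\<in>S. cnj (u i) * A i j * v j)"
    by (simp add: ip_def mvec_def sum_distrib_left mult.assoc)
  also have "\<dots> = (\<Sum>j\<in>S. \<Sum>i\<in>S. cnj (u i) * A i j * v j)" by (rule sum.swap)
  finally show ?thesis
    by (simp add: ip_def mvec_def madj_def sum_distrib_right sum_distrib_left mult_ac)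
qed

lemma hermitian_cnj: "hermitian_on S M \<Longrightarrow> i \<in> S \<Longrightarrow> j \<in> S \<Longrightarrow> cnj (M j i) = M i j"
  unfolding hermitian_on_def by metis

lemma ip_hermitian:
  assumes "hermitian_on S T"
  shows "ip S u (mvec S T v) = ip S (mvec S T u) v"
  unfolding ip_mvec_madj
  by (intro ip_cong mvec_cong_op) (simp_all add: madj_def hermitian_cnj[OF assms])

lemma ip_commute: "ip S u v = cnj (ip S v u)"
  by (simp add: ip_def mult.commute)

lemma ip_add_right: "ip S u (\<lambda>i. v i + w i) = ip S u v + ip S u w"
  by (simp add: ip_def algebra_simps sum.distrib)

lemma ip_diff_right: "ip S u (\<lambda>i. v i - w i) = ip S u v - ip S u w"
  by (simp add: ip_def algebra_simps sum_subtractf)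

lemma ip_scale_right: "ip S u (\<lambda>i. c * v i) = c * ip S u v"
  by (simp add: ip_def sum_distrib_left mult_ac)

lemma mvec_diff: "mvec S A (\<lambda>i. v i - w i) = (\<lambda>i. mvec S A v i - mvec S A w i)"
  by (simp add: mvec_def algebra_simps sum_subtractf)

lemma mvec_mid_minus:
  assumes "finite S" "i \<in> S"
  shows "mvec S (\<lambda>i j. mid i j - T i j) v i = v i - mvec S T v i"
  using assms by (simp add: mvec_def mid_def algebra_simps sum_subtractf
      if_distrib[of "\<lambda>z. _ * z"] cong: if_cong)

lemma qform_mid_minus:
  assumes "finite S"
  shows "qform S (\<lambda>i j. mid i j - T i j) v = complex_of_real (nsq S v) - qform S T v"
  unfolding qform_ip ip_self[symmetric] ip_diff_right[symmetric]
  by (rule ip_cong) (simp_all add: mvec_mid_minus assms)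

lemma nsq_zero: "finite S \<Longrightarrow> nsq S v = 0 \<Longrightarrow> i \<in> S \<Longrightarrow> v i = 0"
  by (simp add: nsq_def sum_nonneg_eq_0_iff)

lemma ip_cauchy_schwarz:
  assumes "finite S"
  shows "(cmod (ip S u v))\<^sup>2 \<le> nsq S u * nsq S v"
proof -
  have "cmod (ip S u v) \<le> (\<Sum>i\<in>S. \<bar>cmod (u i)\<bar> * \<bar>cmod (v i)\<bar>)"
    unfolding ip_def by (rule order_trans[OF norm_sum]) (simp add: norm_mult)
  also have "\<dots> \<le> L2_set (\<lambda>i. cmod (u i)) S * L2_set (\<lambda>i. cmod (v i)) S"
    by (rule L2_set_mult_ineq)
  finally have "(cmod (ip S u v))\<^sup>2 \<le> (L2_set (\<lambda>i. cmod (u i)) S * L2_set (\<lambda>i. cmod (v i)) S)\<^sup>2"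
    by (rule power_mono) simp
  also have "\<dots> = nsq S u * nsq S v"
    by (simp add: L2_set_def nsq_def power_mult_distrib sum_nonneg)
  finally show ?thesis .
qed

lemma qform_projector:
  assumes "finite S" "hermitian_on S T" "\<And>i j. i \<in> S \<Longrightarrow> j \<in> S \<Longrightarrow> mmul S T T i j = T i j"
  shows "qform S T v = complex_of_real (nsq S (mvec S T v))"
proof -
  have "qform S T v = ip S v (mvec S T (mvec S T v))"
    unfolding qform_ip mvec_mmul[symmetric]
    by (intro ip_cong mvec_cong_op) (simp_all add: assms)
  then show ?thesis by (simp add: ip_hermitian[OF assms(2)] ip_self)
qed

text \<open>Positivity of the complement is the contraction property: the squared norm of T v equals
  <v, T v>, and Cauchy-Schwarz lets one factor cancel.\<close>

lemma projector_test_op: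
  assumes "finite S" "hermitian_on S T" "\<And>i j. i \<in> S \<Longrightarrow> j \<in> S \<Longrightarrow> mmul S T T i j = T i j"
  shows "test_op S T"
proof -
  note q = qform_projector[OF assms]
  have "nsq S (mvec S T v) \<le> nsq S v" for v
  proof -
    have "nsq S (mvec S T v) = cmod (ip S v (mvec S T v))"
      using q[of v] by (simp add: qform_ip nsq_nonneg)
    then have "(nsq S (mvec S T v))\<^sup>2 \<le> nsq S v * nsq S (mvec S T v)"
      using ip_cauchy_schwarz[OF assms(1), of v "mvec S T v"] by simp
    then show ?thesis
      using nsq_nonneg[of S v] nsq_nonneg[of S "mvec S T v"]
      by (cases "nsq S (mvec S T v) = 0") (simp_all add: power2_eq_square mult_le_cancel_right)
  qed
  then show ?thesis
    by (simp add: test_op_def psd_iff_qform q qform_mid_minus[OF assms(1)] nsq_nonneg)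
qed

text \<open>Adding the vectors in order of increasing \<open>d\<close>, each new direction of the projector lies in
  the span of the coordinates \<open>l\<close> with \<open>\<mu> l < d k / L\<close>, so it contributes at most \<open>d k / L\<close> to the
  weighted trace.\<close>

lemma ordered_span_projector:
  fixes V :: "'i \<Rightarrow> 'k \<Rightarrow> complex" and d :: "'k \<Rightarrow> real"
  assumes S: "finite S" and F: "finite F" and L: "L > 0" and dpos: "\<And>k. d k \<ge> 0"
    and \<xi>: "\<xi> = (\<lambda>k l. if d k > L * \<mu> l then V l k else 0)"
  shows "\<exists>T. hermitian_on S T \<and> (\<forall>i\<in>S. \<forall>j\<in>S. mmul S T T i j = T i j) \<and>
    (\<forall>k\<in>F. \<forall>l\<in>S. mvec S T (\<xi> k) l = \<xi> k l) \<and>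
    (\<forall>l\<in>S. \<forall>m\<in>S. T l m \<noteq> 0 \<longrightarrow> (\<exists>k\<in>F. d k > L * \<mu> l)) \<and>
    (\<Sum>l\<in>S. \<mu> l * Re (T l l)) \<le> (\<Sum>k\<in>F. d k / L)"
  using F
\<comment> \<open>Indices enter in order of increasing \<open>d\<close>, so the new \<open>k\<close>
  dominates all earlier ones, and a support condition met for an earlier index also holds for
  \<open>k\<close>.\<close>
proof (induction F rule: finite_ranking_induct[where f = d])
  case empty
  show ?case by (rule exI[of _ "\<lambda>_ _. 0"]) (simp add: hermitian_on_def mmul_def)
next
  case (insert k F)
  show ?case
  proof (cases "k \<in> F")
    case True
    then show ?thesis using insert by (simp add: insert_absorb)
  next
    case False
    obtain T where T: "hermitian_on S T" "\<And>i j. i \<in> S \<Longrightarrow> j \<in> S \<Longrightarrow> mmul S T T i j = T i j"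
      "\<And>k l. k \<in> F \<Longrightarrow> l \<in> S \<Longrightarrow> mvec S T (\<xi> k) l = \<xi> k l"
      "\<And>l m. l \<in> S \<Longrightarrow> m \<in> S \<Longrightarrow> T l m \<noteq> 0 \<Longrightarrow> \<exists>k\<in>F. d k > L * \<mu> l"
      "(\<Sum>l\<in>S. \<mu> l * Re (T l l)) \<le> (\<Sum>k\<in>F. d k / L)"
      using insert.IH by blast
    \<comment> \<open>Gram-Schmidt: the part of \<open>\<xi> k\<close> orthogonal to the range of
      \<open>T\<close>.\<close>
    define e where "e = (\<lambda>l. \<xi> k l - mvec S T (\<xi> k) l)"
    define n where "n = nsq S e"
    have TTv: "mvec S T (mvec S T v) l = mvec S T v l" if "l \<in> S" for v l
      unfolding mvec_mmul[symmetric] by (rule mvec_cong_op) (simp add: T that)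
    have Te: "mvec S T e l = 0" if "l \<in> S" for l
      unfolding e_def mvec_diff using TTv[OF that] by simp
    have e_supp: "d k > L * \<mu> l" if l: "l \<in> S" "e l \<noteq> 0" for l
    proof (cases "\<xi> k l = 0")
      case True
      then have "mvec S T (\<xi> k) l \<noteq> 0" using l by (simp add: e_def)
      then obtain m where "m \<in> S" "T l m \<noteq> 0"
        unfolding mvec_def by (metis (no_types, lifting) mult_zero_left sum.neutral)
      then obtain k' where "k' \<in> F" "d k' > L * \<mu> l" using T(4) l by blast
      then show ?thesis using insert.hyps(2)[of k'] by simp
    qed (simp add: \<xi> split: if_splits)
    show ?thesis
    proof (cases "n = 0")
      case True
      then have e0: "e l = 0" if "l \<in> S" for l
        using nsq_zero[OF S _ that, of e] n_def by simp
      have "mvec S T (\<xi> k') l = \<xi> k' l" if "k' \<in> insert k F" "l \<in> S" for k' l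
        using that T(3) e0[of l] by (auto simp: e_def)
      moreover have "(\<Sum>l\<in>S. \<mu> l * Re (T l l)) \<le> (\<Sum>k\<in>insert k F. d k / L)"
        using T(5) False insert.hyps L dpos[of k] by (simp add: add_increasing)
      ultimately show ?thesis using T(1,2,4) by (intro exI[of _ T]) blast
    next
      case nz: False
      then have n: "n > 0" using nsq_nonneg[of S e] by (simp add: n_def)
      \<comment> \<open>The projector onto the range of \<open>T\<close> enlarged by
        \<open>e\<close>; the two parts are orthogonal because \<open>T\<close> annihilates
        \<open>e\<close>.\<close>
      define T' where "T' = (\<lambda>i j. T i j + e i * cnj (e j) / n)"
      have T'v: "mvec S T' v l = mvec S T v l + e l * (ip S e v / n)" for v l
        by (simp add: mvec_def T'_def ip_def algebra_simps sum.distrib sum_distrib_left sum_divide_distrib)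
      have ieT: "ip S e (mvec S T v) = 0" for v
        unfolding ip_hermitian[OF T(1)] using Te by (simp add: ip_def)
      have herm: "hermitian_on S T'"
        using hermitian_cnj[OF T(1)] by (simp add: hermitian_on_def T'_def)
      have idem: "mmul S T' T' i j = T' i j" if "i \<in> S" "j \<in> S" for i j
      proof -
        let ?c = "\<lambda>i. T' i j"
        have "mmul S T' T' i j = mvec S T' ?c i" by (simp add: mmul_def mvec_def)
        also have "\<dots> = mvec S T ?c i + e i * (ip S e ?c / n)" by (rule T'v)
        also have "mvec S T ?c i = mmul S T T i j + (cnj (e j) / n) * mvec S T e i"
          by (simp add: mvec_def mmul_def T'_def algebra_simps sum.distrib sum_distrib_left sum_divide_distrib)
        also have "\<dots> = T i j" using T(2) that Te by simp
        also have "ip S e ?c = cnj (mvec S T e j) + cnj (e j) / n * ip S e e"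
        proof -
          have "cnj (e i) * T' i j = cnj (T j i * e i) + cnj (e j) / n * (cnj (e i) * e i)" if "i \<in> S" for i
            using hermitian_cnj[OF T(1) that \<open>j \<in> S\<close>] by (simp add: T'_def algebra_simps)
          then have "ip S e ?c = (\<Sum>i\<in>S. cnj (T j i * e i) + cnj (e j) / n * (cnj (e i) * e i))"
            unfolding ip_def by (rule sum.cong[OF refl])
          then show ?thesis
            by (simp only: sum.distrib sum_distrib_left[symmetric] ip_def mvec_def cnj_sum)
        qed
        also have "\<dots> = cnj (e j)" using n Te[OF that(2)] by (simp add: ip_self n_def[symmetric])
        finally show ?thesis by (simp add: T'_def)
      qed
      have span: "mvec S T' (\<xi> k') l = \<xi> k' l" if k': "k' \<in> insert k F" and l: "l \<in> S" for k' l
      proof (cases "k' = k")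
        case True
        have "ip S e (\<xi> k) = ip S e e + ip S e (mvec S T (\<xi> k))"
          unfolding ip_add_right[symmetric] by (simp add: e_def)
        then have "ip S e (\<xi> k) = n" by (simp add: ieT ip_self n_def)
        then show ?thesis using True n by (simp add: T'v) (simp add: e_def)
      next
        case False
        then have "k' \<in> F" using k' by simp
        have "ip S e (\<xi> k') = ip S e (mvec S T (\<xi> k'))"
          by (rule ip_cong) (simp_all add: T(3) \<open>k' \<in> F\<close>)
        then show ?thesis using T(3)[OF \<open>k' \<in> F\<close> l] by (simp add: T'v ieT)
      qed
      have supp: "\<exists>k\<in>insert k F. d k > L * \<mu> l" if "l \<in> S" "m \<in> S" "T' l m \<noteq> 0" for l m
      proof (cases "T l m = 0")
        case True
        then have "e l \<noteq> 0" using that by (auto simp: T'_def)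
        then show ?thesis using e_supp that by blast
      qed (use T(4) that in blast)
      have "(\<Sum>l\<in>S. \<mu> l * Re (T' l l)) = (\<Sum>l\<in>S. \<mu> l * Re (T l l)) + (\<Sum>l\<in>S. \<mu> l * (cmod (e l))\<^sup>2 / n)"
      proof -
        have "e l * cnj (e l) / complex_of_real n = complex_of_real ((cmod (e l))\<^sup>2 / n)" for l
          by (simp add: complex_norm_square del: of_real_power)
        then have "Re (T' l l) = Re (T l l) + (cmod (e l))\<^sup>2 / n" for l
          unfolding T'_def by (metis Re_complex_of_real plus_complex.sel(1))
        then show ?thesis by (simp add: algebra_simps sum.distrib)
      qed
      \<comment> \<open>Only coordinates with \<open>e l \<noteq> 0\<close> count, where
        \<open>\<mu> l\<close> lies below \<open>d k / L\<close>; the weights |e l|^2 / n sum to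
        1.\<close>
      also have "(\<Sum>l\<in>S. \<mu> l * (cmod (e l))\<^sup>2 / n) \<le> (\<Sum>l\<in>S. d k / L * ((cmod (e l))\<^sup>2 / n))"
      proof (rule sum_mono)
        fix l assume l: "l \<in> S"
        show "\<mu> l * (cmod (e l))\<^sup>2 / n \<le> d k / L * ((cmod (e l))\<^sup>2 / n)"
        proof (cases "e l = 0")
          case False
          then have "\<mu> l \<le> d k / L" using e_supp[OF l] L by (simp add: field_simps)
          then show ?thesis using n mult_right_mono[of "\<mu> l" "d k / L" "(cmod (e l))\<^sup>2 / n"] by simp
        qed simp
      qed
      also have "(\<Sum>l\<in>S. d k / L * ((cmod (e l))\<^sup>2 / n)) = d k / L"
        unfolding sum_distrib_left[symmetric] sum_divide_distrib[symmetric] nsq_def[symmetric] n_def[symmetric]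
        using n by simp
      finally have tr: "(\<Sum>l\<in>S. \<mu> l * Re (T' l l)) \<le> (\<Sum>k\<in>insert k F. d k / L)"
        using T(5) False insert.hyps by simp
      show ?thesis using herm idem span supp tr by blast
    qed
  qed
qed

lemma qform_conj:
  "qform S (mmul S W (mmul S T (madj W))) v = qform S T (mvec S (madj W) v)"
  unfolding qform_ip mvec_mmul ip_mvec_madj[of S v W] ..

lemma mvec_madj_ip: "mvec S (madj W) v l = ip S (\<lambda>i. W i l) v"
  by (simp add: mvec_def madj_def ip_def)

lemma qform_unit_vector:
  assumes "finite S" "l \<in> S" "\<And>m. m \<in> S \<Longrightarrow> v m = (if m = l then 1 else 0)"
  shows "qform S T v = T l l"
proof -
  have "qform S T v = qform {l} T v" by (rule qform_restrict) (use assms in auto)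
  then show ?thesis using assms by (simp add: qform_def)
qed

text \<open>The joint distribution of Nussbaum and Szkola for operators with eigenvectors \<open>U\<close> and \<open>W\<close>; only
  the eigenvalues \<open>d\<close> of the first one enter.\<close>

definition ns_weight :: "'i set \<Rightarrow> 'i op \<Rightarrow> ('i \<Rightarrow> real) \<Rightarrow> 'i op \<Rightarrow> 'i \<Rightarrow> 'i \<Rightarrow> real" where
  "ns_weight S U d W k l = d k * (cmod (ip S (\<lambda>i. W i l) (\<lambda>i. U i k)))\<^sup>2"

text \<open>In the coordinates of \<open>W\<close>, the vector \<open>\<xi> k\<close> keeps the part
  of column \<open>k\<close> of \<open>U\<close> on which the likelihood ratio exceeds
  \<open>L\<close>. A projector fixing every \<open>\<xi> k\<close> captures at least the mass of
  that part, which gives the first bound; the second is the weighted trace of the projector.\<close>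

lemma likelihood_ratio_test:
  assumes S: "finite S" and W: "unitary_on S W" and L: "L > 0" and dpos: "\<And>k. d k \<ge> 0"
  obtains T where "test_op S T"
    "(\<Sum>k\<in>S. d k * Re (qform S (\<lambda>i j. mid i j - T i j) (\<lambda>i. U i k)))
      \<le> (\<Sum>k\<in>S. \<Sum>l\<in>S. if d k \<le> L * \<mu> l then ns_weight S U d W k l else 0)"
    "(\<Sum>l\<in>S. \<mu> l * Re (qform S T (\<lambda>i. W i l))) \<le> (\<Sum>k\<in>S. d k) / L"
proof -
  define V where "V = (\<lambda>l k. ip S (\<lambda>i. W i l) (\<lambda>i. U i k))"
  define \<xi> where "\<xi> = (\<lambda>k l. if d k > L * \<mu> l then V l k else 0)"
  obtain T0 where T0: "hermitian_on S T0" "\<And>i j. i \<in> S \<Longrightarrow> j \<in> S \<Longrightarrow> mmul S T0 T0 i j = T0 i j"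
      "\<And>k l. k \<in> S \<Longrightarrow> l \<in> S \<Longrightarrow> mvec S T0 (\<xi> k) l = \<xi> k l"
      "(\<Sum>l\<in>S. \<mu> l * Re (T0 l l)) \<le> (\<Sum>k\<in>S. d k / L)"
    using ordered_span_projector[OF S S L dpos \<xi>_def] by blast
  define T where "T = mmul S W (mmul S T0 (madj W))"
  have qT: "qform S T v = qform S T0 (mvec S (madj W) v)" for v
    by (simp add: T_def qform_conj)
  have nW: "nsq S (mvec S (madj W) v) = nsq S v" for v
    by (rule nsq_unitary[OF S unitary_madj[OF W]])
  have qT': "qform S (\<lambda>i j. mid i j - T i j) v = qform S (\<lambda>i j. mid i j - T0 i j) (mvec S (madj W) v)" for v
    by (simp add: qform_mid_minus[OF S] qT nW)
  have test: "test_op S T"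
    using projector_test_op[OF S T0(1,2)] by (simp add: test_op_def psd_iff_qform qT qT')
  have errI: "(\<Sum>k\<in>S. d k * Re (qform S (\<lambda>i j. mid i j - T i j) (\<lambda>i. U i k)))
      \<le> (\<Sum>k\<in>S. \<Sum>l\<in>S. if d k \<le> L * \<mu> l then ns_weight S U d W k l else 0)"
  proof (rule sum_mono)
    fix k assume k: "k \<in> S"
    define v where "v = (\<lambda>l. V l k)"
    have v: "mvec S (madj W) (\<lambda>i. U i k) = v"
      by (intro ext) (simp add: v_def V_def mvec_madj_ip)
    \<comment> \<open>Two readings of <\<xi> k, v>: the truncation makes it the squared norm of
      \<open>\<xi> k\<close>, and invariance of \<open>\<xi> k\<close> under \<open>T0\<close> makes
      it <\<xi> k, T0 v>. Cauchy-Schwarz then bounds the truncated mass by the squared norm of T0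
      v.\<close>
    have "ip S (\<xi> k) v = nsq S (\<xi> k)"
      unfolding ip_self[symmetric] ip_def by (rule sum.cong) (auto simp: \<xi>_def v_def)
    moreover have "ip S (\<xi> k) v = ip S (mvec S T0 (\<xi> k)) v"
      by (rule ip_cong) (simp_all add: T0(3) k)
    ultimately have "complex_of_real (nsq S (\<xi> k)) = ip S (\<xi> k) (mvec S T0 v)"
      by (simp add: ip_hermitian[OF T0(1)])
    then have "(nsq S (\<xi> k))\<^sup>2 \<le> nsq S (\<xi> k) * nsq S (mvec S T0 v)"
      using ip_cauchy_schwarz[OF S, of "\<xi> k" "mvec S T0 v"]
      by (metis norm_of_real power2_abs)
    then have "nsq S (\<xi> k) \<le> nsq S (mvec S T0 v)"
      using nsq_nonneg[of S "\<xi> k"] nsq_nonneg[of S "mvec S T0 v"]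
      by (cases "nsq S (\<xi> k) = 0") (simp_all add: power2_eq_square)
    then have "Re (qform S (\<lambda>i j. mid i j - T i j) (\<lambda>i. U i k)) \<le> nsq S v - nsq S (\<xi> k)"
      by (simp add: qT' v qform_mid_minus[OF S] qform_projector[OF S T0(1,2)])
    also have "\<dots> = (\<Sum>l\<in>S. if d k \<le> L * \<mu> l then (cmod (V l k))\<^sup>2 else 0)"
      unfolding nsq_def sum_subtractf[symmetric] by (rule sum.cong) (auto simp: v_def \<xi>_def)
    finally have "d k * Re (qform S (\<lambda>i j. mid i j - T i j) (\<lambda>i. U i k))
        \<le> d k * (\<Sum>l\<in>S. if d k \<le> L * \<mu> l then (cmod (V l k))\<^sup>2 else 0)"
      using dpos by (rule mult_left_mono)
    also have "\<dots> = (\<Sum>l\<in>S. if d k \<le> L * \<mu> l then ns_weight S U d W k l else 0)"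
      unfolding sum_distrib_left by (rule sum.cong) (auto simp: ns_weight_def V_def)
    finally show "d k * Re (qform S (\<lambda>i j. mid i j - T i j) (\<lambda>i. U i k))
        \<le> (\<Sum>l\<in>S. if d k \<le> L * \<mu> l then ns_weight S U d W k l else 0)" .
  qed
  have "(\<Sum>l\<in>S. \<mu> l * Re (qform S T (\<lambda>i. W i l))) \<le> (\<Sum>k\<in>S. d k) / L"
  proof -
    have "qform S T (\<lambda>i. W i l) = T0 l l" if "l \<in> S" for l
      unfolding qT by (rule qform_unit_vector[OF S that]) (simp add: mvec_madj_ip ip_unitary_cols[OF W _ that])
    then show ?thesis using T0(4) by (simp add: sum_divide_distrib)
  qed
  with test errI show ?thesis by (rule that)
qed

lemma nsq_mvec_spectral:
  assumes S: "finite S" and U: "spectral_decomp S T U d"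
  shows "nsq S (mvec S T v) = (\<Sum>k\<in>S. (d k)\<^sup>2 * (cmod (ip S (\<lambda>i. U i k) v))\<^sup>2)"
proof -
  have uU: "unitary_on S U" using U by (simp add: spectral_decomp_def)
  define c where "c = (\<lambda>k. ip S (\<lambda>i. U i k) v)"
  have "mvec S T v i = mvec S U (\<lambda>k. d k * c k) i" if "i \<in> S" for i
  proof -
    have "mvec S T v i = (\<Sum>j\<in>S. \<Sum>k\<in>S. U i k * d k * cnj (U j k) * v j)"
      unfolding mvec_def using U that by (intro sum.cong) (simp_all add: spectral_decomp_def sum_distrib_right)
    also have "\<dots> = (\<Sum>k\<in>S. \<Sum>j\<in>S. U i k * d k * cnj (U j k) * v j)" by (rule sum.swap)
    finally show ?thesis by (simp add: mvec_def c_def ip_def sum_distrib_left mult_ac)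
  qed
  then have "nsq S (mvec S T v) = nsq S (\<lambda>k. d k * c k)"
    using nsq_cong[of S "mvec S T v"] nsq_unitary[OF S uU] by metis
  then show ?thesis
    by (simp add: nsq_def norm_mult power_mult_distrib c_def)
qed

text \<open>The operator inequality T^2 <= T, valid because the eigenvalues of a test lie in [0,1].
  It lets the converse treat arbitrary tests like projections.\<close>

lemma test_op_contract:
  assumes S: "finite S" and T: "test_op S T"
  shows "nsq S (mvec S T v) \<le> Re (qform S T v)"
proof -
  have psd: "psd S T" "psd S (\<lambda>i j. mid i j - T i j)" using T by (auto simp: test_op_def)
  obtain U d where U: "spectral_decomp S T U d" and d: "\<And>k. k \<in> S \<Longrightarrow> d k \<ge> 0"
    using psd_ex_spectral[OF S psd(1)] by blast
  have uU: "unitary_on S U" using U by (simp add: spectral_decomp_def)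
  have d1: "d k \<le> 1" if "k \<in> S" for k
  proof -
    have "0 \<le> Re (qform S (\<lambda>i j. mid i j - T i j) (\<lambda>i. U i k))"
      using psd(2) by (simp add: psd_iff_qform)
    moreover have "nsq S (\<lambda>i. U i k) = 1"
      using ip_unitary_cols[OF uU that that] by (simp add: ip_self)
    ultimately show ?thesis
      by (simp add: qform_mid_minus[OF S] qform_eigenvector[OF S U that])
  qed
  have "nsq S (mvec S T v) \<le> (\<Sum>k\<in>S. d k * (cmod (ip S (\<lambda>i. U i k) v))\<^sup>2)"
    unfolding nsq_mvec_spectral[OF S U]
    by (intro sum_mono mult_right_mono) (simp_all add: power2_eq_square mult_left_le d d1)
  then show ?thesis by (simp add: qform_spectral[OF S U])
qed

lemma test_op_compl: "test_op S T \<Longrightarrow> test_op S (\<lambda>i j. mid i j - T i j)"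
  by (simp add: test_op_def)

text \<open>The overlap <w_l, u_k> splits into x = <w_l, (1 - T) u_k> and y = <w_l, T u_k>, and |x +
  y|^2 <= 2 |x|^2 + 2 |y|^2 costs the factor 1/2. The minimum is replaced by \<open>d k\<close> next
  to |x|^2 and by \<open>\<eta> * \<nu> l\<close> next to |y|^2; Parseval over l, respectively over
  k, then leaves squared norms controlled by the two errors.\<close>

lemma nussbaum_szkola_converse:
  assumes S: "finite S" and R: "spectral_decomp S R U d" and Q: "spectral_decomp S Q W \<nu>"
    and T: "test_op S T" and dpos: "\<And>k. k \<in> S \<Longrightarrow> d k \<ge> 0" and npos: "\<And>l. l \<in> S \<Longrightarrow> \<nu> l \<ge> 0"
    and \<eta>: "\<eta> \<ge> 0"
  shows "Re (mtrace S (mmul S R (\<lambda>i j. mid i j - T i j))) + \<eta> * Re (mtrace S (mmul S Q T))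
    \<ge> (\<Sum>k\<in>S. \<Sum>l\<in>S. min (d k) (\<eta> * \<nu> l) * (cmod (ip S (\<lambda>i. W i l) (\<lambda>i. U i k)))\<^sup>2) / 2"
proof -
  let ?T = "\<lambda>i j. mid i j - T i j"
  have uU: "unitary_on S U" and uW: "unitary_on S W" using R Q by (auto simp: spectral_decomp_def)
  define u w where "u = (\<lambda>k i. U i k)" and "w = (\<lambda>l i. W i l)"
  have hT: "hermitian_on S T" using T psd_hermitian[OF S] by (simp add: test_op_def)
  define x y where "x = (\<lambda>k l. ip S (w l) (mvec S ?T (u k)))" and "y = (\<lambda>k l. ip S (w l) (mvec S T (u k)))"
  have xy: "ip S (w l) (u k) = x k l + y k l" for k l
    unfolding x_def y_def ip_add_right[symmetric]
    by (rule ip_cong) (simp_all add: mvec_mid_minus S)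
  have "(\<Sum>k\<in>S. \<Sum>l\<in>S. d k * (cmod (x k l))\<^sup>2) = (\<Sum>k\<in>S. d k * nsq S (mvec S ?T (u k)))"
    unfolding x_def sum_distrib_left[symmetric] w_def
    by (simp only: parseval[OF S uW])
  also have "\<dots> \<le> (\<Sum>k\<in>S. d k * Re (qform S ?T (u k)))"
    by (intro sum_mono mult_left_mono test_op_contract[OF S test_op_compl[OF T]] dpos)
  also have "\<dots> = Re (mtrace S (mmul S R ?T))"
    by (simp add: Re_trace_spectral[OF R] u_def)
  finally have 1: "(\<Sum>k\<in>S. \<Sum>l\<in>S. d k * (cmod (x k l))\<^sup>2) \<le> Re (mtrace S (mmul S R ?T))" .
  have ysw: "cmod (y k l) = cmod (ip S (u k) (mvec S T (w l)))" for k l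
    unfolding y_def using ip_commute[of S "w l" "mvec S T (u k)"] ip_hermitian[OF hT, of "u k" "w l"]
    by simp
  have "(\<Sum>k\<in>S. \<Sum>l\<in>S. \<nu> l * (cmod (y k l))\<^sup>2) = (\<Sum>l\<in>S. \<Sum>k\<in>S. \<nu> l * (cmod (y k l))\<^sup>2)"
    by (rule sum.swap)
  also have "\<dots> = (\<Sum>l\<in>S. \<nu> l * nsq S (mvec S T (w l)))"
    unfolding ysw sum_distrib_left[symmetric] u_def
    by (simp only: parseval[OF S uU])
  also have "\<dots> \<le> (\<Sum>l\<in>S. \<nu> l * Re (qform S T (w l)))"
    by (intro sum_mono mult_left_mono test_op_contract[OF S T] npos)
  also have "\<dots> = Re (mtrace S (mmul S Q T))"
    by (simp add: Re_trace_spectral[OF Q] w_def)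
  finally have "\<eta> * (\<Sum>k\<in>S. \<Sum>l\<in>S. \<nu> l * (cmod (y k l))\<^sup>2) \<le> \<eta> * Re (mtrace S (mmul S Q T))"
    using \<eta> by (rule mult_left_mono)
  then have 2: "(\<Sum>k\<in>S. \<Sum>l\<in>S. \<eta> * \<nu> l * (cmod (y k l))\<^sup>2) \<le> \<eta> * Re (mtrace S (mmul S Q T))"
    by (simp add: sum_distrib_left mult.assoc)
  have "(\<Sum>k\<in>S. \<Sum>l\<in>S. min (d k) (\<eta> * \<nu> l) * (cmod (x k l + y k l))\<^sup>2) / 2
      \<le> (\<Sum>k\<in>S. \<Sum>l\<in>S. d k * (cmod (x k l))\<^sup>2 + \<eta> * \<nu> l * (cmod (y k l))\<^sup>2)"
    unfolding sum_divide_distrib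
  proof (intro sum_mono)
    fix k l assume kl: "k \<in> S" "l \<in> S"
    define a b m where "a = cmod (x k l)" and "b = cmod (y k l)" and "m = min (d k) (\<eta> * \<nu> l)"
    have m: "0 \<le> m" "m \<le> d k" "m \<le> \<eta> * \<nu> l"
      using dpos[OF kl(1)] npos[OF kl(2)] \<eta> by (auto simp: m_def)
    have "(cmod (x k l + y k l))\<^sup>2 \<le> (a + b)\<^sup>2"
      unfolding a_def b_def by (intro power_mono norm_triangle_ineq) simp
    also have "\<dots> \<le> 2 * (a\<^sup>2 + b\<^sup>2)"
      using zero_le_power2[of "a - b"] by (simp add: power2_eq_square algebra_simps)
    finally have "m * (cmod (x k l + y k l))\<^sup>2 / 2 \<le> m * a\<^sup>2 + m * b\<^sup>2"
      using mult_left_mono[OF _ m(1)] by (fastforce simp: algebra_simps)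
    also have "\<dots> \<le> d k * a\<^sup>2 + \<eta> * \<nu> l * b\<^sup>2"
      by (intro add_mono mult_right_mono m) simp_all
    finally show "min (d k) (\<eta> * \<nu> l) * (cmod (x k l + y k l))\<^sup>2 / 2
        \<le> d k * (cmod (x k l))\<^sup>2 + \<eta> * \<nu> l * (cmod (y k l))\<^sup>2"
      by (simp add: a_def b_def m_def)
  qed
  also have "\<dots> \<le> Re (mtrace S (mmul S R ?T)) + \<eta> * Re (mtrace S (mmul S Q T))"
    unfolding sum.distrib using 1 2 by simp
  finally show ?thesis unfolding xy[symmetric] u_def w_def .
qed

subsection \<open>Tensor powers and products\<close>

lemma finite_lists_n [simp]: "finite (lists_n n :: 'a::finite list set)"
  unfolding lists_n_def using finite_lists_length_eq[of "UNIV :: 'a set" n] by simp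

lemma lists_n_Suc: "lists_n (Suc n) = (\<lambda>(xs, x). xs @ [x]) ` (lists_n n \<times> UNIV)"
proof (rule equalityI; rule subsetI)
  fix ys :: "'a list" assume "ys \<in> lists_n (Suc n)"
  then have "length ys = Suc n" by (simp add: lists_n_def)
  then have "ys = butlast ys @ [last ys]" "length (butlast ys) = n"
    by (auto intro: append_butlast_last_id[symmetric])
  then show "ys \<in> (\<lambda>(xs, x). xs @ [x]) ` (lists_n n \<times> UNIV)"
    by (force simp: lists_n_def)
qed (auto simp: lists_n_def)

lemma sum_lists_n_Suc:
  fixes h :: "'a::finite list \<Rightarrow> 'b::comm_monoid_add"
  shows "(\<Sum>ks\<in>lists_n (Suc n). h ks) = (\<Sum>xs\<in>lists_n n. \<Sum>x\<in>UNIV. h (xs @ [x]))"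
proof -
  have inj: "inj_on (\<lambda>(xs, x). xs @ [x]) (lists_n n \<times> (UNIV :: 'a set))"
    by (auto simp: inj_on_def)
  show ?thesis
    unfolding lists_n_Suc by (subst sum.reindex[OF inj]) (simp add: case_prod_unfold o_def sum.cartesian_product)
qed

text \<open>Distributivity, and the reason why unitarity, eigenvalues, inner products and partial
  traces all factorise over tensor powers.\<close>

lemma sum_prod_lists:
  fixes f :: "nat \<Rightarrow> 'a::finite \<Rightarrow> 'b::comm_semiring_1"
  shows "(\<Sum>xs\<in>lists_n n. \<Prod>k<n. f k (xs ! k)) = (\<Prod>k<n. \<Sum>x\<in>UNIV. f k x)"
proof (induction n)
  case 0
  have "lists_n 0 = {[] :: 'a list}" by (auto simp: lists_n_def)
  then show ?case by simp
next
  case (Suc n)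
  have "(\<Sum>xs\<in>lists_n (Suc n). \<Prod>k<Suc n. f k (xs ! k))
     = (\<Sum>xs\<in>lists_n n. \<Sum>x\<in>UNIV. (\<Prod>k<n. f k (xs ! k)) * f n x)"
    unfolding sum_lists_n_Suc
  proof (intro sum.cong refl)
    fix xs :: "'a list" and x assume "xs \<in> lists_n n"
    then have len: "length xs = n" by (simp add: lists_n_def)
    then have "(\<Prod>k<n. f k ((xs @ [x]) ! k)) = (\<Prod>k<n. f k (xs ! k))"
      by (intro prod.cong) (auto simp: nth_append)
    then show "(\<Prod>k<Suc n. f k ((xs @ [x]) ! k)) = (\<Prod>k<n. f k (xs ! k)) * f n x"
      using len by (simp add: nth_append)
  qed
  also have "\<dots> = (\<Sum>xs\<in>lists_n n. \<Prod>k<n. f k (xs ! k)) * (\<Sum>x\<in>UNIV. f n x)"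
    by (simp add: sum_product)
  finally show ?case by (simp add: Suc.IH)
qed

lemma zip_map_fst_snd: "zip (map fst zs) (map snd zs) = zs"
  by (induction zs) auto

lemma bij_betw_lists_n_unzip:
  "bij_betw (\<lambda>zs. (map fst zs, map snd zs)) (lists_n n) (lists_n n \<times> lists_n n)"
proof (rule bij_betwI[where g = "\<lambda>(xs, ys). zip xs ys"])
  show "(\<lambda>zs. (map fst zs, map snd zs)) \<in> lists_n n \<rightarrow> lists_n n \<times> lists_n n"
    by (auto simp: lists_n_def)
qed (auto simp: lists_n_def zip_map_fst_snd)

lemma sum_lists_n_pair:
  "(\<Sum>zs\<in>lists_n n. g (map fst zs) (map snd zs)) = (\<Sum>xs\<in>lists_n n. \<Sum>ys\<in>lists_n n. g xs ys)"
  using sum.reindex_bij_betw[OF bij_betw_lists_n_unzip, of "\<lambda>(xs, ys). g xs ys" n]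
  by (simp add: sum.cartesian_product)

lemma sum_lists_n_zip:
  "(\<Sum>zs\<in>lists_n n. h zs) = (\<Sum>xs\<in>lists_n n. \<Sum>ys\<in>lists_n n. h (zip xs ys))"
  using sum_lists_n_pair[of "\<lambda>xs ys. h (zip xs ys)" n] by (simp add: zip_map_fst_snd)

lemma prod_delta:
  assumes "xs \<in> lists_n n" "ys \<in> lists_n n"
  shows "(\<Prod>k<n. if xs ! k = ys ! k then 1 else 0) = (if xs = ys then 1 else (0 :: 'b::comm_semiring_1))"
proof (cases "xs = ys")
  case False
  then obtain k where "k < n" "xs ! k \<noteq> ys ! k"
    using assms nth_equalityI[of xs ys] by (auto simp: lists_n_def)
  then have "(\<Prod>k<n. if xs ! k = ys ! k then 1 else (0 :: 'b)) = 0"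
    by (intro prod_zero) auto
  then show ?thesis using False by simp
qed simp

lemma unitary_tpow:
  fixes U :: "'a::finite op"
  assumes "unitary_on UNIV U"
  shows "unitary_on (lists_n n) (tpow n U)"
proof (rule unitary_onI)
  fix xs ys :: "'a list" assume xy: "xs \<in> lists_n n" "ys \<in> lists_n n"
  have "(\<Sum>ks\<in>lists_n n. tpow n U xs ks * cnj (tpow n U ys ks))
      = (\<Prod>i<n. \<Sum>k\<in>UNIV. U (xs ! i) k * cnj (U (ys ! i) k))"
    unfolding sum_prod_lists[symmetric] by (simp add: tpow_def prod.distrib)
  also have "\<dots> = (if xs = ys then 1 else 0)"
    using unitary_rows[OF assms] prod_delta[OF xy] by simp
  finally show "(\<Sum>ks\<in>lists_n n. tpow n U xs ks * cnj (tpow n U ys ks)) = (if xs = ys then 1 else 0)" .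
  have "(\<Sum>ks\<in>lists_n n. cnj (tpow n U ks xs) * tpow n U ks ys)
      = (\<Prod>i<n. \<Sum>k\<in>UNIV. cnj (U k (xs ! i)) * U k (ys ! i))"
    unfolding sum_prod_lists[symmetric] by (simp add: tpow_def prod.distrib)
  also have "\<dots> = (if xs = ys then 1 else 0)"
    using unitary_cols[OF assms] prod_delta[OF xy] by simp
  finally show "(\<Sum>ks\<in>lists_n n. cnj (tpow n U ks xs) * tpow n U ks ys) = (if xs = ys then 1 else 0)" .
qed

text \<open>Serves twice: for the eigenvalues of a tensor power and, applied to probability weights,
  for the law of independent copies.\<close>

definition eig_tpow :: "nat \<Rightarrow> ('i \<Rightarrow> real) \<Rightarrow> 'i list \<Rightarrow> real" where
  "eig_tpow n d ks = (\<Prod>i<n. d (ks ! i))"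

lemma spectral_tpow:
  fixes U :: "'a::finite op"
  assumes "spectral_decomp UNIV M U d"
  shows "spectral_decomp (lists_n n) (tpow n M) (tpow n U) (eig_tpow n d)"
proof -
  have "tpow n M xs ys = (\<Sum>ks\<in>lists_n n. tpow n U xs ks * complex_of_real (eig_tpow n d ks) * cnj (tpow n U ys ks))"
    for xs ys
  proof -
    have "tpow n M xs ys = (\<Prod>i<n. \<Sum>k\<in>UNIV. U (xs ! i) k * complex_of_real (d k) * cnj (U (ys ! i) k))"
      using assms by (simp add: tpow_def spectral_decomp_def)
    then show ?thesis
      unfolding sum_prod_lists[symmetric] by (simp add: tpow_def eig_tpow_def prod.distrib)
  qed
  then show ?thesis using assms by (simp add: spectral_decomp_def unitary_tpow)
qed

lemma eig_tpow_nonneg: "(\<And>k. d k \<ge> 0) \<Longrightarrow> eig_tpow n d ks \<ge> 0"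
  by (simp add: eig_tpow_def prod_nonneg)

lemma ip_tpow:
  fixes U W :: "'a::finite op"
  shows "ip (lists_n n) (\<lambda>xs. tpow n W xs ls) (\<lambda>xs. tpow n U xs ks)
    = (\<Prod>i<n. ip UNIV (\<lambda>x. W x (ls ! i)) (\<lambda>x. U x (ks ! i)))"
  unfolding ip_def sum_prod_lists[symmetric] by (simp add: tpow_def prod.distrib)

lemma sum_UNIV_pair: "(\<Sum>z\<in>UNIV. f z) = (\<Sum>x\<in>UNIV. \<Sum>y\<in>UNIV. f (x, y))"
  by (simp add: UNIV_Times_UNIV[symmetric] sum.cartesian_product del: UNIV_Times_UNIV)

lemma spectral_tensor2:
  assumes A: "spectral_decomp UNIV A U d" and B: "spectral_decomp UNIV B W e"
  shows "spectral_decomp UNIV (tensor2 A B) (tensor2 U W) (\<lambda>(k, l). d k * e l)"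
proof -
  have uU: "unitary_on UNIV U" and uW: "unitary_on UNIV W"
    using A B by (auto simp: spectral_decomp_def)
  have "unitary_on UNIV (tensor2 U W)"
  proof (rule unitary_onI)
    fix x y :: "'a \<times> 'b"
    obtain a b a' b' where x: "x = (a, b)" and y: "y = (a', b')" by fastforce
    have "(\<Sum>k\<in>UNIV. tensor2 U W x k * cnj (tensor2 U W y k))
        = (\<Sum>k\<in>UNIV. U a k * cnj (U a' k)) * (\<Sum>l\<in>UNIV. W b l * cnj (W b' l))"
      by (simp add: sum_UNIV_pair x y tensor2_def sum_product mult_ac)
    then show "(\<Sum>k\<in>UNIV. tensor2 U W x k * cnj (tensor2 U W y k)) = (if x = y then 1 else 0)"
      by (simp add: unitary_rows[OF uU] unitary_rows[OF uW] x y)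
    have "(\<Sum>k\<in>UNIV. cnj (tensor2 U W k x) * tensor2 U W k y)
        = (\<Sum>k\<in>UNIV. cnj (U k a) * U k a') * (\<Sum>l\<in>UNIV. cnj (W l b) * W l b')"
      by (simp add: sum_UNIV_pair x y tensor2_def sum_product mult_ac)
    then show "(\<Sum>k\<in>UNIV. cnj (tensor2 U W k x) * tensor2 U W k y) = (if x = y then 1 else 0)"
      by (simp add: unitary_cols[OF uU] unitary_cols[OF uW] x y)
  qed
  moreover have "tensor2 A B x y = (\<Sum>k\<in>UNIV. tensor2 U W x k * complex_of_real (case k of (k, l) \<Rightarrow> d k * e l)
      * cnj (tensor2 U W y k))" for x y
  proof -
    obtain a b a' b' where x: "x = (a, b)" and y: "y = (a', b')" by fastforce
    show ?thesis using A B
      by (simp add: sum_UNIV_pair x y tensor2_def sum_product mult_ac spectral_decomp_def)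
  qed
  ultimately show ?thesis by (simp add: spectral_decomp_def)
qed

lemma unitary_prod_state:
  fixes U :: "'a::finite list op" and W :: "'b::finite list op"
  assumes uU: "unitary_on (lists_n n) U" and uW: "unitary_on (lists_n n) W"
  shows "unitary_on (lists_n n) (prod_state U W)"
proof (rule unitary_onI)
  fix x y :: "('a \<times> 'b) list" assume xy: "x \<in> lists_n n" "y \<in> lists_n n"
  have m: "map fst x \<in> lists_n n" "map snd x \<in> lists_n n" "map fst y \<in> lists_n n" "map snd y \<in> lists_n n"
    using xy by (auto simp: lists_n_def)
  have eq: "map fst x = map fst y \<and> map snd x = map snd y \<longleftrightarrow> x = y"
    by (metis zip_map_fst_snd)
  have "(\<Sum>k\<in>lists_n n. prod_state U W x k * cnj (prod_state U W y k))
      = (\<Sum>k\<in>lists_n n. U (map fst x) k * cnj (U (map fst y) k)) * (\<Sum>k\<in>lists_n n. W (map snd x) k * cnj (W (map snd y) k))"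
    unfolding sum_product sum_lists_n_pair[symmetric]
    by (simp add: prod_state_def mult_ac)
  then show "(\<Sum>k\<in>lists_n n. prod_state U W x k * cnj (prod_state U W y k)) = (if x = y then 1 else 0)"
    using eq by (auto simp: unitary_rows[OF uU m(1,3)] unitary_rows[OF uW m(2,4)])
  have "(\<Sum>k\<in>lists_n n. cnj (prod_state U W k x) * prod_state U W k y)
      = (\<Sum>k\<in>lists_n n. cnj (U k (map fst x)) * U k (map fst y)) * (\<Sum>k\<in>lists_n n. cnj (W k (map snd x)) * W k (map snd y))"
    unfolding sum_product sum_lists_n_pair[symmetric]
    by (simp add: prod_state_def mult_ac)
  then show "(\<Sum>k\<in>lists_n n. cnj (prod_state U W k x) * prod_state U W k y) = (if x = y then 1 else 0)"
    using eq by (auto simp: unitary_cols[OF uU m(1,3)] unitary_cols[OF uW m(2,4)])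
qed

lemma spectral_prod_state:
  fixes U :: "'a::finite list op" and W :: "'b::finite list op"
  assumes A: "spectral_decomp (lists_n n) A U d" and B: "spectral_decomp (lists_n n) B W e"
  shows "spectral_decomp (lists_n n) (prod_state A B) (prod_state U W) (\<lambda>k. d (map fst k) * e (map snd k))"
proof -
  have "prod_state A B x y = (\<Sum>k\<in>lists_n n. prod_state U W x k * complex_of_real (d (map fst k) * e (map snd k))
      * cnj (prod_state U W y k))" if xy: "x \<in> lists_n n" "y \<in> lists_n n" for x y
  proof -
    have m: "map fst x \<in> lists_n n" "map snd x \<in> lists_n n" "map fst y \<in> lists_n n" "map snd y \<in> lists_n n"
      using xy by (auto simp: lists_n_def)
    have "prod_state A B x y = (\<Sum>k\<in>lists_n n. U (map fst x) k * complex_of_real (d k) * cnj (U (map fst y) k))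
       * (\<Sum>k\<in>lists_n n. W (map snd x) k * complex_of_real (e k) * cnj (W (map snd y) k))"
      using A B m by (simp add: prod_state_def spectral_decomp_def)
    then show ?thesis unfolding sum_product sum_lists_n_pair[symmetric]
      by (simp add: prod_state_def mult_ac)
  qed
  then show ?thesis using A B by (simp add: spectral_decomp_def unitary_prod_state)
qed

lemma prod_state_tpow:
  assumes "x \<in> lists_n n" "y \<in> lists_n n"
  shows "prod_state (tpow n \<sigma>) (tpow n \<tau>) x y = tpow n (tensor2 \<sigma> \<tau>) x y"
  using assms by (simp add: prod_state_def tpow_def tensor2_def lists_n_def case_prod_unfold prod.distrib)

lemma prod_state_mmul:
  fixes U U' :: "'a::finite list op" and W W' :: "'b::finite list op"
  shows "mmul (lists_n n) (prod_state U W) (prod_state U' W') = prod_state (mmul (lists_n n) U U') (mmul (lists_n n) W W')"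
proof (intro ext)
  fix x y
  show "mmul (lists_n n) (prod_state U W) (prod_state U' W') x y = prod_state (mmul (lists_n n) U U') (mmul (lists_n n) W W') x y"
    unfolding mmul_def prod_state_def sum_product sum_lists_n_pair[symmetric] by (simp add: mult_ac)
qed

lemma psd_prod_state:
  fixes A :: "'a::finite list op" and B :: "'b::finite list op"
  assumes "psd (lists_n n) A" "psd (lists_n n) B"
  shows "psd (lists_n n) (prod_state A B)"
proof -
  obtain U d where U: "spectral_decomp (lists_n n) A U d" "\<And>k. k \<in> lists_n n \<Longrightarrow> d k \<ge> 0"
    using psd_ex_spectral[OF finite_lists_n assms(1)] by blast
  obtain W e where W: "spectral_decomp (lists_n n) B W e" "\<And>k. k \<in> lists_n n \<Longrightarrow> e k \<ge> 0"
    using psd_ex_spectral[OF finite_lists_n assms(2)] by blast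
  show ?thesis
    by (rule psd_spectral[OF finite_lists_n spectral_prod_state[OF U(1) W(1)]])
      (intro mult_nonneg_nonneg U(2) W(2); simp add: lists_n_def)
qed

lemma mtrace_mmul_add:
  "mtrace S (mmul S (\<lambda>i j. A i j + B i j) T) = mtrace S (mmul S A T) + mtrace S (mmul S B T)"
  by (simp add: mtrace_def mmul_def algebra_simps sum.distrib)

text \<open>Telescoping: \<Omega> \<otimes> \<Theta> - \<sigma> \<otimes> \<tau> is the sum of
  (\<Omega> - \<sigma>) \<otimes> \<Theta> and \<sigma> \<otimes> (\<Theta> - \<tau>), both
  positive.\<close>

lemma prod_state_trace_mono:
  fixes \<sigma> \<Omega> :: "'a::finite list op" and \<tau> \<Theta> :: "'b::finite list op"
  assumes "psd (lists_n n) \<sigma>" "psd (lists_n n) (\<lambda>i j. \<Omega> i j - \<sigma> i j)"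
    and "psd (lists_n n) \<Theta>" "psd (lists_n n) (\<lambda>i j. \<Theta> i j - \<tau> i j)" and "psd (lists_n n) T"
  shows "Re (mtrace (lists_n n) (mmul (lists_n n) (prod_state \<sigma> \<tau>) T))
      \<le> Re (mtrace (lists_n n) (mmul (lists_n n) (prod_state \<Omega> \<Theta>) T))"
proof -
  let ?D1 = "prod_state (\<lambda>i j. \<Omega> i j - \<sigma> i j) \<Theta>" and ?D2 = "prod_state \<sigma> (\<lambda>i j. \<Theta> i j - \<tau> i j)"
  have "prod_state \<Omega> \<Theta> = (\<lambda>i j. (\<lambda>i j. ?D1 i j + ?D2 i j) i j + prod_state \<sigma> \<tau> i j)"
    by (intro ext) (simp add: prod_state_def algebra_simps)
  then have "mtrace (lists_n n) (mmul (lists_n n) (prod_state \<Omega> \<Theta>) T)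
     = mtrace (lists_n n) (mmul (lists_n n) ?D1 T) + mtrace (lists_n n) (mmul (lists_n n) ?D2 T)
     + mtrace (lists_n n) (mmul (lists_n n) (prod_state \<sigma> \<tau>) T)"
    by (simp only: mtrace_mmul_add)
  moreover have "Re (mtrace (lists_n n) (mmul (lists_n n) ?D1 T)) \<ge> 0"
    "Re (mtrace (lists_n n) (mmul (lists_n n) ?D2 T)) \<ge> 0"
    by (intro psd_trace_nonneg psd_prod_state assms finite_lists_n)+
  ultimately show ?thesis by simp
qed

text \<open>Each level set of \<open>t\<close> is diagonalised separately and the pieces are glued.
  The second conclusion is the point: \<open>G\<close> commutes with every diagonal matrix that
  depends on the index through \<open>t\<close> only, so such a matrix shares an eigenbasis with
  \<open>M\<close>.\<close>

lemma ex_block_spectral_decomp: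
  assumes S: "finite S" and M: "hermitian_on S M"
    and t: "\<And>i j. i \<in> S \<Longrightarrow> j \<in> S \<Longrightarrow> M i j \<noteq> 0 \<Longrightarrow> t i = t j"
  obtains G m where "spectral_decomp S M G m" "\<And>x k. x \<in> S \<Longrightarrow> k \<in> S \<Longrightarrow> G x k \<noteq> 0 \<Longrightarrow> t x = t k"
proof -
  define B where "B = (\<lambda>c. {x \<in> S. t x = c})"
  have B: "finite (B c)" "hermitian_on (B c) M" for c
    using S M unfolding B_def hermitian_on_def by (simp, blast)
  then have "\<forall>c. \<exists>p. spectral_decomp (B c) M (fst p) (snd p)"
    using ex_spectral_decomp by (metis fst_conv snd_conv)
  then obtain p where p: "\<And>c. spectral_decomp (B c) M (fst (p c)) (snd (p c))" by metis
  define G where "G = (\<lambda>x k. if t x = t k then fst (p (t k)) x k else 0)"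
  define m where "m = (\<lambda>k. snd (p (t k)) k)"
  have up: "unitary_on (B c) (fst (p c))" for c using p by (simp add: spectral_decomp_def)
  have red: "(\<Sum>k\<in>S. f k) = (\<Sum>k\<in>B c. f k)" if "\<And>k. k \<in> S \<Longrightarrow> t k \<noteq> c \<Longrightarrow> f k = 0" for c and f :: "_ \<Rightarrow> complex"
    by (rule sum.mono_neutral_right) (use S that in \<open>auto simp: B_def\<close>)
  have "unitary_on S G"
  proof (rule unitary_onI)
    fix i j assume ij: "i \<in> S" "j \<in> S"
    have "(\<Sum>k\<in>S. G i k * cnj (G j k)) = (\<Sum>k\<in>B (t i). G i k * cnj (G j k))"
      by (rule red) (auto simp: G_def)
    also have "\<dots> = (if t i = t j then \<Sum>k\<in>B (t i). fst (p (t i)) i k * cnj (fst (p (t i)) j k) else 0)"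
      by (auto simp: G_def B_def intro!: sum.cong sum.neutral)
    also have "\<dots> = (if i = j then 1 else 0)"
      using unitary_rows[OF up, of i "t i" j] ij by (auto simp: B_def)
    finally show "(\<Sum>k\<in>S. G i k * cnj (G j k)) = (if i = j then 1 else 0)" .
    have "(\<Sum>k\<in>S. cnj (G k i) * G k j) = (\<Sum>k\<in>B (t i). cnj (G k i) * G k j)"
      by (rule red) (auto simp: G_def)
    also have "\<dots> = (if t i = t j then \<Sum>k\<in>B (t i). cnj (fst (p (t i)) k i) * fst (p (t i)) k j else 0)"
      by (auto simp: G_def B_def intro!: sum.cong sum.neutral)
    also have "\<dots> = (if i = j then 1 else 0)"
      using unitary_cols[OF up, of i "t i" j] ij by (auto simp: B_def)
    finally show "(\<Sum>k\<in>S. cnj (G k i) * G k j) = (if i = j then 1 else 0)" .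
  qed
  moreover have "M i j = (\<Sum>k\<in>S. G i k * complex_of_real (m k) * cnj (G j k))" if ij: "i \<in> S" "j \<in> S" for i j
  proof -
    have "(\<Sum>k\<in>S. G i k * complex_of_real (m k) * cnj (G j k)) = (\<Sum>k\<in>B (t i). G i k * complex_of_real (m k) * cnj (G j k))"
      by (rule red) (auto simp: G_def)
    also have "\<dots> = (if t i = t j then \<Sum>k\<in>B (t i). fst (p (t i)) i k * complex_of_real (snd (p (t i)) k) * cnj (fst (p (t i)) j k) else 0)"
      by (auto simp: G_def m_def B_def intro!: sum.cong sum.neutral)
    also have "\<dots> = M i j"
    proof (cases "t i = t j")
      case True
      then have "i \<in> B (t i)" "j \<in> B (t i)" using ij by (simp_all add: B_def)
      then show ?thesis using p[of "t i"] True unfolding spectral_decomp_def by simp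
    next
      case False
      then show ?thesis using t[OF ij] by auto
    qed
    finally show ?thesis by simp
  qed
  ultimately have "spectral_decomp S M G m" by (simp add: spectral_decomp_def)
  then show ?thesis by (rule that) (auto simp: G_def split: if_splits)
qed

text \<open>\<open>G\<close> mixes indices only inside a level set of \<open>t\<close>, so passing
  from \<open>W\<close> to the product of \<open>W\<close> and \<open>G\<close> preserves the norm
  of the component of \<open>v\<close> on a union of level sets. Events that see an index only
  through \<open>t\<close> have the same weight in both bases.\<close>

lemma block_parseval:
  assumes S: "finite S" and G: "unitary_on S G"
    and t: "\<And>x k. x \<in> S \<Longrightarrow> k \<in> S \<Longrightarrow> G x k \<noteq> 0 \<Longrightarrow> t x = t k"
  shows "(\<Sum>l\<in>S. if Q (t l) then (cmod (ip S (\<lambda>i. mmul S W G i l) v))\<^sup>2 else 0)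
    = (\<Sum>l\<in>S. if Q (t l) then (cmod (ip S (\<lambda>i. W i l) v))\<^sup>2 else 0)"
proof -
  define c where "c = (\<lambda>x. ip S (\<lambda>i. W i x) v)"
  define c' where "c' = (\<lambda>x. if Q (t x) then c x else 0)"
  have ipG: "ip S (\<lambda>i. mmul S W G i l) v = ip S (\<lambda>x. G x l) c" for l
  proof -
    have "ip S (\<lambda>i. mmul S W G i l) v = (\<Sum>i\<in>S. \<Sum>x\<in>S. cnj (G x l) * (cnj (W i x) * v i))"
      by (simp add: ip_def mmul_def sum_distrib_left sum_distrib_right mult_ac)
    also have "\<dots> = (\<Sum>x\<in>S. \<Sum>i\<in>S. cnj (G x l) * (cnj (W i x) * v i))" by (rule sum.swap)
    finally show ?thesis by (simp add: ip_def c_def sum_distrib_left)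
  qed
  have "(if Q (t l) then (cmod (ip S (\<lambda>i. mmul S W G i l) v))\<^sup>2 else 0) = (cmod (ip S (\<lambda>x. G x l) c'))\<^sup>2"
    if l: "l \<in> S" for l
  proof -
    have "cnj (G x l) * c' x = (if Q (t l) then cnj (G x l) * c x else 0)" if "x \<in> S" for x
      using t[OF that l] by (cases "G x l = 0") (auto simp: c'_def)
    then have "ip S (\<lambda>x. G x l) c' = (if Q (t l) then ip S (\<lambda>x. G x l) c else 0)"
      by (simp add: ip_def)
    then show ?thesis by (simp add: ipG)
  qed
  then have "(\<Sum>l\<in>S. if Q (t l) then (cmod (ip S (\<lambda>i. mmul S W G i l) v))\<^sup>2 else 0) = nsq S c'"
    using parseval[OF S G, of c'] by simp
  also have "\<dots> = (\<Sum>l\<in>S. if Q (t l) then (cmod (ip S (\<lambda>i. W i l) v))\<^sup>2 else 0)"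
    unfolding nsq_def by (rule sum.cong) (auto simp: c'_def c_def)
  finally show ?thesis .
qed

lemma spectral_mdiag_block:
  assumes S: "finite S" and G: "unitary_on S G"
    and t: "\<And>x k. x \<in> S \<Longrightarrow> k \<in> S \<Longrightarrow> G x k \<noteq> 0 \<Longrightarrow> D x = D k"
  shows "spectral_decomp S (mdiag D) G D"
  unfolding spectral_decomp_def
proof (intro conjI ballI G)
  fix i j assume ij: "i \<in> S" "j \<in> S"
  have "(\<Sum>k\<in>S. G i k * complex_of_real (D k) * cnj (G j k)) = (\<Sum>k\<in>S. complex_of_real (D i) * (G i k * cnj (G j k)))"
    by (rule sum.cong[OF refl]) (metis t ij(1) mult.assoc mult.commute mult_zero_left)
  also have "\<dots> = mdiag D i j"
    unfolding sum_distrib_left[symmetric] unitary_rows[OF G ij] by (simp add: mdiag_def)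
  finally show "mdiag D i j = (\<Sum>k\<in>S. G i k * complex_of_real (D k) * cnj (G j k))" by simp
qed

subsection \<open>A universal permutation invariant operator\<close>

lemma perm_list_eq_permute_list: "perm_list \<pi> xs = permute_list \<pi> xs"
  by (simp add: perm_list_def permute_list_def)

lemma bij_betw_perm_list:
  assumes "\<pi> permutes {..<n}"
  shows "bij_betw (perm_list \<pi>) (lists_n n) (lists_n n :: 'a::finite list set)"
proof -
  have sub: "perm_list \<pi> ` lists_n n \<subseteq> (lists_n n :: 'a list set)"
    by (auto simp: lists_n_def perm_list_def)
  have inj: "inj_on (perm_list \<pi>) (lists_n n :: 'a list set)"
  proof (rule inj_onI)
    fix x y :: "'a list" assume xy: "x \<in> lists_n n" "y \<in> lists_n n" "perm_list \<pi> x = perm_list \<pi> y"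
    have "x ! k = y ! k" if k: "k < n" for k
    proof -
      obtain j where j: "j < n" "k = \<pi> j"
        using permutes_image[OF assms] k by (metis imageE lessThan_iff)
      have "perm_list \<pi> x ! j = perm_list \<pi> y ! j" using xy by simp
      then show ?thesis using xy j by (simp add: perm_list_def lists_n_def)
    qed
    then show "x = y" using xy by (intro nth_equalityI) (auto simp: lists_n_def)
  qed
  show ?thesis using endo_inj_surj[OF finite_lists_n sub inj] inj by (simp add: bij_betw_def)
qed

lemma perm_list_in: "x \<in> lists_n n \<Longrightarrow> perm_list \<pi> x \<in> lists_n n"
  by (simp add: lists_n_def perm_list_def)

lemma symmetric_op_tpow:
  fixes M :: "'a op"
  shows "symmetric_op n (tpow n M)"
  unfolding symmetric_op_def
proof (intro allI impI ballI)
  fix \<pi> and x y :: "'a list" assume p: "\<pi> permutes {..<n}" and xy: "x \<in> lists_n n" "y \<in> lists_n n"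
  have "tpow n M (perm_list \<pi> x) (perm_list \<pi> y) = prod ((\<lambda>k. M (x ! k) (y ! k)) \<circ> \<pi>) {..<n}"
    unfolding tpow_def by (rule prod.cong) (use xy in \<open>auto simp: perm_list_def lists_n_def\<close>)
  also have "\<dots> = tpow n M x y" unfolding tpow_def by (rule prod.permute[OF p, symmetric])
  finally show "tpow n M (perm_list \<pi> x) (perm_list \<pi> y) = tpow n M x y" .
qed

lemma symmetric_op_mmul:
  fixes A B :: "'a::finite list op"
  assumes "symmetric_op n A" "symmetric_op n B"
  shows "symmetric_op n (mmul (lists_n n) A B)"
  unfolding symmetric_op_def
proof (intro allI impI ballI)
  fix \<pi> and x y :: "'a list" assume p: "\<pi> permutes {..<n}" and xy: "x \<in> lists_n n" "y \<in> lists_n n"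
  have "mmul (lists_n n) A B (perm_list \<pi> x) (perm_list \<pi> y)
      = (\<Sum>z\<in>lists_n n. A (perm_list \<pi> x) (perm_list \<pi> z) * B (perm_list \<pi> z) (perm_list \<pi> y))"
    unfolding mmul_def by (rule sum.reindex_bij_betw[OF bij_betw_perm_list[OF p], symmetric])
  also have "\<dots> = mmul (lists_n n) A B x y"
    unfolding mmul_def by (rule sum.cong) (use assms p xy in \<open>auto simp: symmetric_op_def\<close>)
  finally show "mmul (lists_n n) A B (perm_list \<pi> x) (perm_list \<pi> y) = mmul (lists_n n) A B x y" .
qed

lemma symmetric_op_madj: "symmetric_op n A \<Longrightarrow> symmetric_op n (madj A)"
  by (simp add: symmetric_op_def madj_def)

text \<open>Permuting the rows of \<open>U\<close> gives another spectral decomposition of the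
  invariant \<sigma> with the same eigenvalues, and the functional calculus does not depend on the
  decomposition. It will be applied to the square root.\<close>

lemma symmetric_op_fun:
  fixes U :: "'a::finite list op" and f :: "real \<Rightarrow> real"
  assumes sd: "spectral_decomp (lists_n n) \<sigma> U d" and sym: "symmetric_op n \<sigma>"
  shows "symmetric_op n (\<lambda>x y. \<Sum>k\<in>lists_n n. U x k * complex_of_real (f (d k)) * cnj (U y k))"
  unfolding symmetric_op_def
proof (intro allI impI ballI)
  fix \<pi> and x y :: "'a list" assume p: "\<pi> permutes {..<n}" and xy: "x \<in> lists_n n" "y \<in> lists_n n"
  define V where "V = (\<lambda>x k. U (perm_list \<pi> x) k)"
  have uU: "unitary_on (lists_n n) U" using sd by (simp add: spectral_decomp_def)
  have inj: "perm_list \<pi> i = perm_list \<pi> j \<longleftrightarrow> i = j" if "i \<in> lists_n n" "j \<in> lists_n n" for i j :: "'a list"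
    using bij_betw_perm_list[OF p] that by (auto simp: bij_betw_def inj_on_def)
  have "unitary_on (lists_n n) V"
  proof (rule unitary_onI)
    fix i j :: "'a list" assume ij: "i \<in> lists_n n" "j \<in> lists_n n"
    show "(\<Sum>k\<in>lists_n n. V i k * cnj (V j k)) = (if i = j then 1 else 0)"
      unfolding V_def using unitary_rows[OF uU perm_list_in[OF ij(1)] perm_list_in[OF ij(2)]] inj[OF ij] by simp
    have "(\<Sum>k\<in>lists_n n. cnj (V k i) * V k j) = (\<Sum>k\<in>lists_n n. cnj (U k i) * U k j)"
      unfolding V_def by (rule sum.reindex_bij_betw[OF bij_betw_perm_list[OF p]])
    then show "(\<Sum>k\<in>lists_n n. cnj (V k i) * V k j) = (if i = j then 1 else 0)"
      using unitary_cols[OF uU ij] by simp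
  qed
  moreover have "\<sigma> i j = (\<Sum>k\<in>lists_n n. V i k * complex_of_real (d k) * cnj (V j k))"
    if ij: "i \<in> lists_n n" "j \<in> lists_n n" for i j
  proof -
    have "\<sigma> i j = \<sigma> (perm_list \<pi> i) (perm_list \<pi> j)"
      using sym p ij unfolding symmetric_op_def by metis
    then show ?thesis using sd perm_list_in ij unfolding spectral_decomp_def V_def by metis
  qed
  ultimately have sdV: "spectral_decomp (lists_n n) \<sigma> V d" by (simp add: spectral_decomp_def)
  show "(\<Sum>k\<in>lists_n n. U (perm_list \<pi> x) k * complex_of_real (f (d k)) * cnj (U (perm_list \<pi> y) k))
      = (\<Sum>k\<in>lists_n n. U x k * complex_of_real (f (d k)) * cnj (U y k))"
    using spectral_fun_unique[OF finite_lists_n sdV sd xy, of f] by (simp add: V_def)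
qed

text \<open>Equal multisets of pairs differ by one permutation acting on both sequences at once, so
  an entry of an invariant operator depends only on the joint type of its two indices.\<close>

lemma symmetric_op_mset_zip:
  assumes "symmetric_op n X" "x \<in> lists_n n" "y \<in> lists_n n" "x' \<in> lists_n n" "y' \<in> lists_n n"
    and "mset (zip x' y') = mset (zip x y)"
  shows "X x' y' = X x y"
proof -
  have len: "length x = n" "length y = n" "length x' = n" "length y' = n"
    using assms by (auto simp: lists_n_def)
  obtain p where p: "p permutes {..<length (zip x y)}" "permute_list p (zip x y) = zip x' y'"
    using mset_eq_permutation[OF assms(6)] by blast
  have "zip (permute_list p x) (permute_list p y) = zip x' y'"
    using p len permute_list_zip[of p "{..<length x}" x y] by simp
  then have "map fst (zip (permute_list p x) (permute_list p y)) = map fst (zip x' y')"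
    "map snd (zip (permute_list p x) (permute_list p y)) = map snd (zip x' y')" by simp_all
  then have "x' = perm_list p x" "y' = perm_list p y"
    using len by (simp_all add: perm_list_eq_permute_list)
  then show ?thesis using assms p len unfolding symmetric_op_def by simp
qed

text \<open>The joint types of information theory; each labels one orbit of pairs of sequences under
  simultaneous permutation.\<close>

definition pair_types :: "nat \<Rightarrow> ('a::finite \<times> 'a) multiset set" where
  "pair_types n = (\<lambda>(x, y). mset (zip x y)) ` (lists_n n \<times> lists_n n)"

definition orbit_size :: "nat \<Rightarrow> ('a::finite \<times> 'a) multiset \<Rightarrow> nat" where
  "orbit_size n t = card {p \<in> lists_n n \<times> lists_n n. mset (zip (fst p) (snd p)) = t}"

text \<open>With \<open>E\<^sub>t\<close> the indicator matrices of the orbits of pairs of sequences, the matrices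
  \<open>E\<^sub>t / sqrt (orbit_size n t)\<close> form a Hilbert-Schmidt orthonormal basis of the permutation invariant
  operators, and this operator is the sum of \<open>X X\<^sup>*\<close> over that basis.\<close>

definition univ_op :: "nat \<Rightarrow> 'a::finite list op" where
  "univ_op n x z = (\<Sum>y\<in>lists_n n. if mset (zip x y) = mset (zip z y)
     then 1 / of_nat (orbit_size n (mset (zip x y))) else 0)"

lemma finite_pair_types: "finite (pair_types n)"
  by (simp add: pair_types_def)

lemma mset_zip_in_pair_types: "x \<in> lists_n n \<Longrightarrow> y \<in> lists_n n \<Longrightarrow> mset (zip x y) \<in> pair_types n"
  unfolding pair_types_def by force

lemma sum_pair_types:
  fixes h :: "'a::finite list \<Rightarrow> 'a list \<Rightarrow> 'b::comm_monoid_add"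
  shows "(\<Sum>x\<in>lists_n n. \<Sum>y\<in>lists_n n. h x y)
    = (\<Sum>t\<in>pair_types n. \<Sum>p\<in>{p \<in> lists_n n \<times> lists_n n. mset (zip (fst p) (snd p)) = t}. h (fst p) (snd p))"
proof -
  have "(\<Sum>x\<in>lists_n n. \<Sum>y\<in>lists_n n. h x y) = (\<Sum>p\<in>lists_n n \<times> lists_n n. h (fst p) (snd p))"
    by (simp add: sum.cartesian_product case_prod_unfold)
  also have "\<dots> = (\<Sum>t\<in>(\<lambda>p. mset (zip (fst p) (snd p))) ` (lists_n n \<times> lists_n n).
      \<Sum>p\<in>{p \<in> lists_n n \<times> lists_n n. mset (zip (fst p) (snd p)) = t}. h (fst p) (snd p))"
    by (rule sum.image_gen) simp
  finally show ?thesis by (simp add: pair_types_def case_prod_unfold)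
qed

lemma orbit_size_pos:
  assumes "t \<in> pair_types n"
  shows "orbit_size n t > 0"
proof -
  obtain x y where "x \<in> lists_n n" "y \<in> lists_n n" "t = mset (zip x y)"
    using assms by (auto simp: pair_types_def)
  then have "(x, y) \<in> {p \<in> lists_n n \<times> lists_n n. mset (zip (fst p) (snd p)) = t}" by simp
  then show ?thesis unfolding orbit_size_def by (subst card_gt_0_iff) (auto intro: finite_subset[OF _ finite_cartesian_product[OF finite_lists_n finite_lists_n]])
qed

text \<open>A multiset of size n is determined by its multiplicities, each at most n. This count is
  the source of the polynomial factors in the error bound.\<close>

lemma card_pair_types: "card (pair_types n :: ('a::finite \<times> 'a) multiset set) \<le> (n + 1) ^ CARD('a \<times> 'a)"
proof -
  have "count ` (pair_types n :: ('a \<times> 'a) multiset set) \<subseteq> (UNIV \<rightarrow>\<^sub>E {..n})"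
  proof (rule image_subsetI)
    fix t :: "('a \<times> 'a) multiset" assume "t \<in> pair_types n"
    then have "size t = n" by (auto simp: pair_types_def lists_n_def)
    then have "count t p \<le> n" for p using count_le_size by metis
    then show "count t \<in> UNIV \<rightarrow>\<^sub>E {..n}" by auto
  qed
  then have "card (count ` (pair_types n :: ('a \<times> 'a) multiset set)) \<le> card ((UNIV :: ('a \<times> 'a) set) \<rightarrow>\<^sub>E {..n})"
    by (intro card_mono finite_PiE) auto
  moreover have "inj_on count (pair_types n :: ('a \<times> 'a) multiset set)"
    by (auto simp: inj_on_def count_inject)
  ultimately show ?thesis by (simp add: card_image card_funcsetE)
qed

lemma hermitian_univ_op: "hermitian_on (lists_n n) (univ_op n :: 'a::finite list op)"
proof -
  have "cnj (univ_op n z x) = univ_op n x z" for x z :: "'a list"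
    unfolding univ_op_def cnj_sum by (intro sum.cong) auto
  then show ?thesis by (simp add: hermitian_on_def)
qed

text \<open>A nonzero entry needs a common second sequence \<open>y\<close> with equal joint types;
  projecting these to the first component equates the types of \<open>x\<close> and
  \<open>z\<close>. Hence the operator is block diagonal over types.\<close>

lemma univ_op_mset:
  assumes "x \<in> lists_n n" "z \<in> lists_n n" "univ_op n x z \<noteq> 0"
  shows "mset x = mset z"
proof -
  obtain y where y: "y \<in> lists_n n" and
    "(if mset (zip x y) = mset (zip z y) then 1 / complex_of_nat (orbit_size n (mset (zip x y))) else 0) \<noteq> 0"
    using assms(3) unfolding univ_op_def by (rule sum.not_neutral_contains_not_neutral)
  then have "mset (zip x y) = mset (zip z y)" by (metis (full_types))
  then have "mset (map fst (zip x y)) = mset (map fst (zip z y))" by (simp only: mset_map)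
  moreover have "map fst (zip x y) = x" "map fst (zip z y) = z"
    using assms y by (simp_all add: lists_n_def)
  ultimately show ?thesis by (simp only:)
qed

text \<open>Each orbit contributes its size times the reciprocal of its size.\<close>

lemma trace_univ_op: "mtrace (lists_n n) (univ_op n :: 'a::finite list op) = of_nat (card (pair_types n :: ('a \<times> 'a) multiset set))"
proof -
  have "mtrace (lists_n n) (univ_op n :: 'a list op)
     = (\<Sum>x\<in>lists_n n. \<Sum>y\<in>lists_n n. 1 / of_nat (orbit_size n (mset (zip x (y :: 'a list)))))"
    by (simp add: mtrace_def univ_op_def)
  also have "\<dots> = (\<Sum>t\<in>(pair_types n :: ('a \<times> 'a) multiset set). 1)"
    unfolding sum_pair_types
  proof (rule sum.cong)
    fix t :: "('a \<times> 'a) multiset" assume t: "t \<in> pair_types n"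
    let ?P = "{p \<in> lists_n n \<times> lists_n n. mset (zip (fst p) (snd p)) = t}"
    have "(\<Sum>p\<in>?P. 1 / of_nat (orbit_size n (mset (zip (fst p) (snd p))))) = (\<Sum>p\<in>?P. 1 / (of_nat (orbit_size n t) :: complex))"
      by (rule sum.cong) auto
    also have "\<dots> = 1" using orbit_size_pos[OF t] by (simp flip: orbit_size_def)
    finally show "(\<Sum>p\<in>?P. 1 / of_nat (orbit_size n (mset (zip (fst p) (snd p))))) = (1 :: complex)" .
  qed simp
  finally show ?thesis by simp
qed

text \<open>As a sum of squares this shows positivity, and it is exactly the right-hand side that
  Cauchy-Schwarz will produce for an invariant density operator.\<close>

lemma qform_univ_op:
  fixes v :: "'a::finite list \<Rightarrow> complex"
  shows "qform (lists_n n) (univ_op n) v = complex_of_real (\<Sum>y\<in>lists_n n. \<Sum>t\<in>pair_types n.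
    (cmod (\<Sum>x\<in>lists_n n. if mset (zip x y) = t then v x else 0))\<^sup>2 / orbit_size n t)"
proof -
  let ?S = "lists_n n :: 'a list set"
  have "qform ?S (univ_op n) v = (\<Sum>x\<in>?S. \<Sum>z\<in>?S. \<Sum>y\<in>?S.
      if mset (zip x y) = mset (zip z y) then cnj (v x) * v z / of_nat (orbit_size n (mset (zip x y))) else 0)"
    unfolding qform_def univ_op_def sum_distrib_left sum_distrib_right by (intro sum.cong) auto
  also have "\<dots> = (\<Sum>x\<in>?S. \<Sum>y\<in>?S. \<Sum>z\<in>?S.
      if mset (zip x y) = mset (zip z y) then cnj (v x) * v z / of_nat (orbit_size n (mset (zip x y))) else 0)"
    by (intro sum.cong[OF refl] sum.swap)
  also have "\<dots> = (\<Sum>y\<in>?S. \<Sum>x\<in>?S. \<Sum>z\<in>?S.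
      if mset (zip x y) = mset (zip z y) then cnj (v x) * v z / of_nat (orbit_size n (mset (zip x y))) else 0)"
    by (rule sum.swap)
  also have "\<dots> = (\<Sum>y\<in>?S. \<Sum>t\<in>pair_types n.
    complex_of_real ((cmod (\<Sum>x\<in>?S. if mset (zip x y) = t then v x else 0))\<^sup>2 / orbit_size n t))"
  proof (rule sum.cong[OF refl])
    fix y :: "'a list" assume y: "y \<in> ?S"
    define f where "f = (\<lambda>t x z. if mset (zip x y) = t then if mset (zip z y) = t
        then cnj (v x) * v z / of_nat (orbit_size n t) else 0 else 0)"
    have "(\<Sum>t\<in>pair_types n. complex_of_real ((cmod (\<Sum>x\<in>?S. if mset (zip x y) = t then v x else 0))\<^sup>2 / orbit_size n t))
        = (\<Sum>t\<in>pair_types n. \<Sum>x\<in>?S. \<Sum>z\<in>?S. f t x z)"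
    proof (rule sum.cong[OF refl])
      fix t
      define s where "s = (\<Sum>x\<in>?S. if mset (zip x y) = t then v x else 0)"
      have "complex_of_real ((cmod s)\<^sup>2 / orbit_size n t) = cnj s * s / of_nat (orbit_size n t)"
        by (simp add: cnj_mult_self)
      also have "\<dots> = (\<Sum>x\<in>?S. \<Sum>z\<in>?S. f t x z)"
        unfolding s_def cnj_sum sum_product sum_divide_distrib by (intro sum.cong) (auto simp: f_def)
      finally show "complex_of_real ((cmod (\<Sum>x\<in>?S. if mset (zip x y) = t then v x else 0))\<^sup>2 / orbit_size n t)
          = (\<Sum>x\<in>?S. \<Sum>z\<in>?S. f t x z)" by (simp add: s_def)
    qed
    also have "\<dots> = (\<Sum>x\<in>?S. \<Sum>t\<in>pair_types n. \<Sum>z\<in>?S. f t x z)" by (rule sum.swap)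
    also have "\<dots> = (\<Sum>x\<in>?S. \<Sum>z\<in>?S. \<Sum>t\<in>pair_types n. f t x z)" by (intro sum.cong[OF refl] sum.swap)
    also have "\<dots> = (\<Sum>x\<in>?S. \<Sum>z\<in>?S. if mset (zip x y) = mset (zip z y)
        then cnj (v x) * v z / of_nat (orbit_size n (mset (zip x y))) else 0)"
    proof (intro sum.cong[OF refl])
      fix x z :: "'a list" assume xz: "x \<in> ?S" "z \<in> ?S"
      have "(\<Sum>t\<in>pair_types n. f t x z) = (\<Sum>t\<in>pair_types n. if mset (zip x y) = t then f (mset (zip x y)) x z else 0)"
        by (rule sum.cong) (auto simp: f_def)
      also have "\<dots> = f (mset (zip x y)) x z"
        using mset_zip_in_pair_types[OF xz(1) y] by (simp add: finite_pair_types)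
      finally show "(\<Sum>t\<in>pair_types n. f t x z) = (if mset (zip x y) = mset (zip z y)
        then cnj (v x) * v z / of_nat (orbit_size n (mset (zip x y))) else 0)" by (auto simp: f_def)
    qed
    finally show "(\<Sum>x\<in>?S. \<Sum>z\<in>?S. if mset (zip x y) = mset (zip z y)
        then cnj (v x) * v z / of_nat (orbit_size n (mset (zip x y))) else 0)
      = (\<Sum>t\<in>pair_types n. complex_of_real ((cmod (\<Sum>x\<in>?S. if mset (zip x y) = t then v x else 0))\<^sup>2 / orbit_size n t))"
      by simp
  qed
  finally show ?thesis by simp
qed

lemma psd_univ_op: "psd (lists_n n) (univ_op n)"
  by (simp add: psd_iff_qform qform_univ_op sum_nonneg)

lemma qform_diff: "qform S (\<lambda>i j. A i j - B i j) v = qform S A v - qform S B v"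
  by (simp add: qform_def algebra_simps sum_subtractf)

text \<open>The square root \<open>X\<close> of \<open>\<sigma>\<close> is permutation invariant with Hilbert-Schmidt norm 1; expanding it in
  the orbit basis and applying the Cauchy-Schwarz inequality gives \<open>\<sigma> = X X\<^sup>* \<le> univ_op n\<close>.\<close>

lemma symmetric_density_le_univ_op:
  fixes \<sigma> :: "'a::finite list op"
  assumes dens: "density_op (lists_n n) \<sigma>" and sym: "symmetric_op n \<sigma>"
  shows "psd (lists_n n) (\<lambda>i j. univ_op n i j - \<sigma> i j)"
proof -
  let ?S = "lists_n n :: 'a list set"
  have psd: "psd ?S \<sigma>" and tr: "mtrace ?S \<sigma> = 1" using dens by (auto simp: density_op_def)
  obtain U d where U: "spectral_decomp ?S \<sigma> U d" and d: "\<And>k. k \<in> ?S \<Longrightarrow> d k \<ge> 0"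
    using psd_ex_spectral[OF finite_lists_n psd] by blast
  define X where "X = (\<lambda>x y. \<Sum>k\<in>?S. U x k * complex_of_real (sqrt (d k)) * cnj (U y k))"
  have X: "spectral_decomp ?S X U (\<lambda>k. sqrt (d k))"
    using U by (simp add: X_def spectral_decomp_def)
  have symX: "symmetric_op n X" unfolding X_def by (rule symmetric_op_fun[OF U sym])
  have q: "qform ?S \<sigma> v = complex_of_real (nsq ?S (mvec ?S X v))" for v
    unfolding qform_spectral[OF finite_lists_n U] nsq_mvec_spectral[OF finite_lists_n X]
    by (intro arg_cong[of _ _ complex_of_real] sum.cong) (simp_all add: d)
  have tr1: "(\<Sum>x\<in>?S. \<Sum>y\<in>?S. (cmod (X y x))\<^sup>2) = 1"
  proof -
    have "(\<Sum>y\<in>?S. (cmod (X y x))\<^sup>2) = Re (\<sigma> x x)" if x: "x \<in> ?S" for x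
    proof -
      have "mvec ?S X (\<lambda>m. if m = x then 1 else 0) y = X y x" for y
        using x by (simp add: mvec_def if_distrib[of "\<lambda>z. _ * z"] cong: if_cong)
      then show ?thesis
        using q[of "\<lambda>m. if m = x then 1 else 0"] qform_unit_vector[OF finite_lists_n x, of "\<lambda>m. if m = x then 1 else 0" \<sigma>]
        by (simp add: nsq_def)
    qed
    then have "(\<Sum>x\<in>?S. \<Sum>y\<in>?S. (cmod (X y x))\<^sup>2) = Re (mtrace ?S \<sigma>)"
      by (simp add: mtrace_def)
    then show ?thesis using tr by simp
  qed
  \<comment> \<open>The common value of \<open>X\<close> on an orbit. The indices are swapped so
    that the index summed against \<open>v\<close> comes first, as in
    \<open>qform_univ_op\<close>.\<close>
  define g where "g = (\<lambda>t. let p = (SOME p. p \<in> ?S \<times> ?S \<and> mset (zip (fst p) (snd p)) = t) in X (snd p) (fst p))"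
  have g: "X y x = g (mset (zip x y))" if xy: "x \<in> ?S" "y \<in> ?S" for x y
  proof -
    define p where "p = (SOME p. p \<in> ?S \<times> ?S \<and> mset (zip (fst p) (snd p)) = mset (zip x y))"
    have p: "p \<in> ?S \<times> ?S \<and> mset (zip (fst p) (snd p)) = mset (zip x y)"
      unfolding p_def by (rule someI[of _ "(x, y)"]) (use xy in simp)
    have "madj X (fst p) (snd p) = madj X x y"
      by (rule symmetric_op_mset_zip[OF symmetric_op_madj[OF symX]]) (use p xy in auto)
    then show ?thesis by (simp add: g_def p_def Let_def madj_def)
  qed
  have g1: "(\<Sum>t\<in>pair_types n. (cmod (g t))\<^sup>2 * orbit_size n t) = 1"
  proof -
    have "(\<Sum>x\<in>?S. \<Sum>y\<in>?S. (cmod (X y x))\<^sup>2) = (\<Sum>t\<in>pair_types n. (cmod (g t))\<^sup>2 * orbit_size n t)"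
      unfolding sum_pair_types
    proof (rule sum.cong[OF refl])
      fix t :: "('a \<times> 'a) multiset" assume "t \<in> pair_types n"
      let ?P = "{p \<in> ?S \<times> ?S. mset (zip (fst p) (snd p)) = t}"
      have "(\<Sum>p\<in>?P. (cmod (X (snd p) (fst p)))\<^sup>2) = (\<Sum>p\<in>?P. (cmod (g t))\<^sup>2)"
        by (rule sum.cong) (auto simp: g)
      then show "(\<Sum>p\<in>?P. (cmod (X (snd p) (fst p)))\<^sup>2) = (cmod (g t))\<^sup>2 * orbit_size n t"
        by (simp add: orbit_size_def)
    qed
    then show ?thesis using tr1 by simp
  qed
  have "Re (qform ?S \<sigma> v) \<le> Re (qform ?S (univ_op n) v)" for v
  proof -
    define s where "s = (\<lambda>(y :: 'a list) t. \<Sum>x\<in>?S. if mset (zip x y) = t then v x else 0)"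
    have "(cmod (mvec ?S X v y))\<^sup>2 \<le> (\<Sum>t\<in>pair_types n. (cmod (s y t))\<^sup>2 / orbit_size n t)" if y: "y \<in> ?S" for y
    proof -
      \<comment> \<open>The normalisation of the orbit basis: with it, the first Cauchy-Schwarz
        factor is the squared Hilbert-Schmidt norm of \<open>X\<close>, which is 1.\<close>
      define r where "r = (\<lambda>t :: ('a \<times> 'a) multiset. complex_of_real (sqrt (orbit_size n t)))"
      have r: "r t \<noteq> 0" "cmod (r t) = sqrt (orbit_size n t)" if "t \<in> pair_types n" for t :: "('a \<times> 'a) multiset"
        using orbit_size_pos[OF that] by (simp_all add: r_def)
      have "mvec ?S X v y = (\<Sum>x\<in>?S. \<Sum>t\<in>pair_types n. if mset (zip x y) = t then g t * v x else 0)"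
        unfolding mvec_def using mset_zip_in_pair_types[OF _ y] g[OF _ y]
        by (intro sum.cong) (simp_all add: finite_pair_types)
      also have "\<dots> = (\<Sum>t\<in>pair_types n. \<Sum>x\<in>?S. if mset (zip x y) = t then g t * v x else 0)"
        by (rule sum.swap)
      also have "\<dots> = (\<Sum>t\<in>pair_types n. g t * s y t)"
        unfolding s_def sum_distrib_left by (intro sum.cong) auto
      also have "\<dots> = ip (pair_types n) (\<lambda>t. cnj (g t * r t)) (\<lambda>t. s y t / r t)"
        unfolding ip_def by (rule sum.cong) (use r in auto)
      finally have "(cmod (mvec ?S X v y))\<^sup>2 \<le> nsq (pair_types n) (\<lambda>t. cnj (g t * r t)) * nsq (pair_types n) (\<lambda>t. s y t / r t)"
        using ip_cauchy_schwarz[OF finite_pair_types] by metis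
      also have "nsq (pair_types n) (\<lambda>t. cnj (g t * r t)) = 1"
        unfolding nsq_def g1[symmetric] by (rule sum.cong) (simp_all add: norm_mult power_mult_distrib r)
      also have "nsq (pair_types n) (\<lambda>t. s y t / r t) = (\<Sum>t\<in>pair_types n. (cmod (s y t))\<^sup>2 / orbit_size n t)"
        unfolding nsq_def by (rule sum.cong) (simp_all add: norm_divide power_divide r)
      finally show ?thesis by simp
    qed
    then have "nsq ?S (mvec ?S X v) \<le> (\<Sum>y\<in>?S. \<Sum>t\<in>pair_types n. (cmod (s y t))\<^sup>2 / orbit_size n t)"
      unfolding nsq_def by (rule sum_mono)
    then show ?thesis by (simp add: q qform_univ_op s_def)
  qed
  then show ?thesis by (simp add: psd_iff_qform qform_diff q qform_univ_op)
qed

subsection \<open>Upper bound on the error for symmetric alternatives\<close>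

lemma mtrace_mmul_commute: "mtrace S (mmul S A B) = mtrace S (mmul S B A)"
  unfolding mtrace_def mmul_def by (subst sum.swap) (simp add: mult.commute)

lemma mtrace_cong: "(\<And>i. i \<in> S \<Longrightarrow> A i i = B i i) \<Longrightarrow> mtrace S A = mtrace S B"
  by (simp add: mtrace_def)

text \<open>The universal operator placed in the product basis given by \<open>U\<close>. Being
  block diagonal over types there, it commutes with the tensor power of any operator that
  \<open>U\<close> diagonalises.\<close>

definition conj_univ_op :: "nat \<Rightarrow> 'a::finite op \<Rightarrow> 'a list op" where
  "conj_univ_op n U = mmul (lists_n n) (tpow n U) (mmul (lists_n n) (univ_op n) (madj (tpow n U)))"

lemma psd_conj_univ_op:
  fixes U :: "'a::finite op"
  shows "psd (lists_n n) (conj_univ_op n U)"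
  using psd_univ_op[of n, where 'a = 'a] by (simp add: psd_iff_qform conj_univ_op_def qform_conj)

text \<open>Rotation by a tensor power turns a permutation invariant density into another one, so
  the bound by \<open>univ_op\<close> carries over after rotating back.\<close>

lemma symmetric_density_le_conj_univ_op:
  fixes U :: "'a::finite op"
  assumes U: "unitary_on UNIV U" and dens: "density_op (lists_n n) \<sigma>" and sym: "symmetric_op n \<sigma>"
  shows "psd (lists_n n) (\<lambda>i j. conj_univ_op n U i j - \<sigma> i j)"
proof -
  let ?S = "lists_n n :: 'a list set" and ?W = "tpow n U"
  have uW: "unitary_on ?S ?W" by (rule unitary_tpow[OF U])
  define \<sigma>' where "\<sigma>' = mmul ?S (madj ?W) (mmul ?S \<sigma> ?W)"
  have q': "qform ?S \<sigma>' v = qform ?S \<sigma> (mvec ?S ?W v)" for v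
    using qform_conj[of ?S "madj ?W" \<sigma> v] by (simp add: \<sigma>'_def)
  have q: "qform ?S \<sigma> v = qform ?S \<sigma>' (mvec ?S (madj ?W) v)" for v
  proof -
    have "mvec ?S ?W (mvec ?S (madj ?W) v) i = v i" if "i \<in> ?S" for i
    proof -
      have "mvec ?S ?W (mvec ?S (madj ?W) v) i = mvec ?S mid v i"
        unfolding mvec_mmul[symmetric] by (rule mvec_cong_op) (simp add: unitary_mid[OF uW that])
      then show ?thesis using that
        by (simp add: mvec_def mid_def if_distrib[of "\<lambda>z. z * _"] cong: if_cong)
    qed
    then show ?thesis unfolding q' by (simp add: qform_def)
  qed
  have "mtrace ?S \<sigma>' = mtrace ?S (mmul ?S \<sigma> (mmul ?S ?W (madj ?W)))"
    unfolding \<sigma>'_def mtrace_mmul_commute[of ?S "madj ?W"] mmul_assoc ..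
  also have "\<dots> = mtrace ?S \<sigma>"
  proof (rule mtrace_cong)
    fix i :: "'a list" assume i: "i \<in> ?S"
    have "mmul ?S \<sigma> (mmul ?S ?W (madj ?W)) i i = mmul ?S \<sigma> mid i i"
      by (rule mmul_cong_right) (simp add: unitary_mid[OF uW _ i])
    then show "mmul ?S \<sigma> (mmul ?S ?W (madj ?W)) i i = \<sigma> i i" using i by (simp add: mmul_mid_right)
  qed
  finally have "density_op ?S \<sigma>'"
    using dens by (simp add: density_op_def psd_iff_qform q')
  moreover have "symmetric_op n \<sigma>'"
    unfolding \<sigma>'_def by (intro symmetric_op_mmul symmetric_op_madj symmetric_op_tpow sym)
  ultimately have "psd ?S (\<lambda>i j. univ_op n i j - \<sigma>' i j)" by (rule symmetric_density_le_univ_op)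
  then show ?thesis
    by (simp add: psd_iff_qform qform_diff conj_univ_op_def qform_conj q)
qed

text \<open>Provides one eigenbasis for both operators: an eigenvalue of the tensor power depends
  only on the type of its index and is therefore constant on the blocks of \<open>G\<close>.\<close>

lemma conj_univ_op_spectral:
  fixes U :: "'a::finite op" and M :: "'a op"
  assumes M: "spectral_decomp UNIV M U d"
  obtains G m where
    "spectral_decomp (lists_n n) (conj_univ_op n U) (mmul (lists_n n) (tpow n U) G) m"
    "spectral_decomp (lists_n n) (tpow n M) (mmul (lists_n n) (tpow n U) G) (eig_tpow n d)"
    "unitary_on (lists_n n) G"
    "\<And>x k. x \<in> lists_n n \<Longrightarrow> k \<in> lists_n n \<Longrightarrow> G x k \<noteq> 0 \<Longrightarrow> eig_tpow n d x = eig_tpow n d k"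
    "\<And>k. k \<in> lists_n n \<Longrightarrow> m k \<ge> 0"
    "(\<Sum>k\<in>lists_n n. m k) \<le> real ((n + 1) ^ CARD('a \<times> 'a))"
proof -
  let ?S = "lists_n n :: 'a list set"
  have U: "unitary_on UNIV U" using M by (simp add: spectral_decomp_def)
  have block: "mset i = mset j" if "i \<in> ?S" "j \<in> ?S" "univ_op n i j \<noteq> 0" for i j
    using that by (rule univ_op_mset)
  obtain G m where G: "spectral_decomp ?S (univ_op n) G m"
    and t: "\<And>x k. x \<in> ?S \<Longrightarrow> k \<in> ?S \<Longrightarrow> G x k \<noteq> 0 \<Longrightarrow> mset x = mset k"
    using ex_block_spectral_decomp[where t = mset, OF finite_lists_n hermitian_univ_op block] by blast
  have uG: "unitary_on ?S G" using G by (simp add: spectral_decomp_def)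
  have D: "eig_tpow n d x = prod_mset (image_mset d (mset x))" if "x \<in> ?S" for x
  proof -
    have "eig_tpow n d x = prod_list (map d x)"
      using that by (simp add: eig_tpow_def prod.list_conv_set_nth lists_n_def atLeast0LessThan)
    then show ?thesis by (simp add: prod_mset_prod_list flip: mset_map)
  qed
  have t': "eig_tpow n d x = eig_tpow n d k" if "x \<in> ?S" "k \<in> ?S" "G x k \<noteq> 0" for x k
    using t[OF that] D that by simp
  have 1: "spectral_decomp ?S (conj_univ_op n U) (mmul ?S (tpow n U) G) m"
    by (rule spectral_decomp_conj[OF finite_lists_n G unitary_tpow[OF U]]) (simp add: conj_univ_op_def)
  have 2: "spectral_decomp ?S (tpow n M) (mmul ?S (tpow n U) G) (eig_tpow n d)"
  proof (rule spectral_decomp_conj[OF finite_lists_n spectral_mdiag_block[OF finite_lists_n uG t'] unitary_tpow[OF U]])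
    fix i j :: "'a list" assume "i \<in> ?S" "j \<in> ?S"
    then show "tpow n M i j = mmul ?S (tpow n U) (mmul ?S (mdiag (eig_tpow n d)) (madj (tpow n U))) i j"
      using spectral_tpow[OF M, of n] by (simp add: spectral_decomp_iff)
  qed
  have 3: "m k \<ge> 0" if "k \<in> ?S" for k
    by (rule psd_eigenvalue_nonneg[OF finite_lists_n G psd_univ_op that])
  have "complex_of_real (\<Sum>k\<in>?S. m k) = complex_of_real (real (card (pair_types n :: ('a \<times> 'a) multiset set)))"
    using trace_eigenvalues[OF finite_lists_n G] by (simp add: trace_univ_op)
  then have "(\<Sum>k\<in>?S. m k) = real (card (pair_types n :: ('a \<times> 'a) multiset set))"
    by (simp only: of_real_eq_iff)
  then have 4: "(\<Sum>k\<in>?S. m k) \<le> real ((n + 1) ^ CARD('a \<times> 'a))"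
    using card_pair_types[of n, where 'a = 'a] by (simp only: of_nat_le_iff)
  show ?thesis by (rule that[OF 1 2 uG t' 3 4])
qed

section \<open>Partial traces and marginal distributions\<close>

lemma sum_delta_unitary:
  assumes "unitary_on S W" "finite S"
  shows "(\<Sum>l\<in>S. \<Sum>y\<in>S. \<Sum>y'\<in>S. f y y' * (cnj (W y l) * W y' l)) = (\<Sum>y\<in>S. f y y)"
proof -
  have "(\<Sum>l\<in>S. \<Sum>y\<in>S. \<Sum>y'\<in>S. f y y' * (cnj (W y l) * W y' l))
      = (\<Sum>y\<in>S. \<Sum>l\<in>S. \<Sum>y'\<in>S. f y y' * (cnj (W y l) * W y' l))" by (rule sum.swap)
  also have "\<dots> = (\<Sum>y\<in>S. \<Sum>y'\<in>S. \<Sum>l\<in>S. f y y' * (cnj (W y l) * W y' l))"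
    by (intro sum.cong[OF refl] sum.swap)
  also have "\<dots> = (\<Sum>y\<in>S. \<Sum>y'\<in>S. if y = y' then f y y' else 0)"
  proof (intro sum.cong[OF refl])
    fix y y' assume "y \<in> S" "y' \<in> S"
    then show "(\<Sum>l\<in>S. f y y' * (cnj (W y l) * W y' l)) = (if y = y' then f y y' else 0)"
      using unitary_rows[OF assms(1), of y' y] unfolding sum_distrib_left[symmetric]
      by (auto simp: mult.commute[of "cnj _"])
  qed
  finally show ?thesis using assms(2) by simp
qed

lemma qform_pair:
  fixes R :: "('a::finite \<times> 'b::finite) list op"
  shows "qform (lists_n n) R (\<lambda>z. u (map fst z) * v (map snd z))
    = (\<Sum>x\<in>lists_n n. \<Sum>y\<in>lists_n n. \<Sum>x'\<in>lists_n n. \<Sum>y'\<in>lists_n n.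
        cnj (u x) * R (zip x y) (zip x' y') * u x' * (cnj (v y) * v y'))"
  unfolding qform_def sum_lists_n_zip
  by (intro sum.cong refl) (simp add: lists_n_def mult_ac)

lemma tpow_ptrA:
  fixes \<rho> :: "('a::finite \<times> 'b::finite) op"
  assumes "x \<in> lists_n n" "x' \<in> lists_n n"
  shows "(\<Sum>y\<in>lists_n n. tpow n \<rho> (zip x y) (zip x' y)) = tpow n (ptrA \<rho>) x x'"
proof -
  have "(\<Sum>y\<in>lists_n n. tpow n \<rho> (zip x y) (zip x' y)) = (\<Sum>y\<in>lists_n n. \<Prod>k<n. \<rho> (x ! k, y ! k) (x' ! k, y ! k))"
    unfolding tpow_def by (intro sum.cong prod.cong) (use assms in \<open>auto simp: lists_n_def\<close>)
  then show ?thesis by (simp add: sum_prod_lists[of "\<lambda>k y. \<rho> (x ! k, y) (x' ! k, y)"] tpow_def ptrA_def)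
qed

lemma tpow_ptrB:
  fixes \<rho> :: "('a::finite \<times> 'b::finite) op"
  assumes "y \<in> lists_n n" "y' \<in> lists_n n"
  shows "(\<Sum>x\<in>lists_n n. tpow n \<rho> (zip x y) (zip x y')) = tpow n (ptrB \<rho>) y y'"
proof -
  have "(\<Sum>x\<in>lists_n n. tpow n \<rho> (zip x y) (zip x y')) = (\<Sum>x\<in>lists_n n. \<Prod>k<n. \<rho> (x ! k, y ! k) (x ! k, y' ! k))"
    unfolding tpow_def by (intro sum.cong prod.cong) (use assms in \<open>auto simp: lists_n_def\<close>)
  then show ?thesis by (simp add: sum_prod_lists[of "\<lambda>k x. \<rho> (x, y ! k) (x, y' ! k)"] tpow_def ptrB_def)
qed

text \<open>Completeness of the basis \<open>W\<close> forces y = y', so the partial trace may be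
  computed in any orthonormal basis of the traced factor.\<close>

lemma partial_trace_sum:
  assumes "unitary_on S W" "finite S"
  shows "(\<Sum>l\<in>S. \<Sum>x\<in>X. \<Sum>y\<in>S. \<Sum>x'\<in>X. \<Sum>y'\<in>S. cnj (u x) * R x y x' y' * u x' * (cnj (W y l) * W y' l))
    = (\<Sum>x\<in>X. \<Sum>x'\<in>X. cnj (u x) * (\<Sum>y\<in>S. R x y x' y) * u x')"
proof -
  let ?f = "\<lambda>l x y x' y'. cnj (u x) * R x y x' y' * u x' * (cnj (W y l) * W y' l)"
  have "(\<Sum>l\<in>S. \<Sum>x\<in>X. \<Sum>y\<in>S. \<Sum>x'\<in>X. \<Sum>y'\<in>S. ?f l x y x' y')
      = (\<Sum>l\<in>S. \<Sum>x\<in>X. \<Sum>x'\<in>X. \<Sum>y\<in>S. \<Sum>y'\<in>S. ?f l x y x' y')"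
    by (intro sum.cong[OF refl] sum.swap)
  also have "\<dots> = (\<Sum>x\<in>X. \<Sum>l\<in>S. \<Sum>x'\<in>X. \<Sum>y\<in>S. \<Sum>y'\<in>S. ?f l x y x' y')"
    by (rule sum.swap)
  also have "\<dots> = (\<Sum>x\<in>X. \<Sum>x'\<in>X. \<Sum>l\<in>S. \<Sum>y\<in>S. \<Sum>y'\<in>S. ?f l x y x' y')"
    by (intro sum.cong[OF refl] sum.swap)
  also have "\<dots> = (\<Sum>x\<in>X. \<Sum>x'\<in>X. \<Sum>y\<in>S. cnj (u x) * R x y x' y * u x')"
    by (simp only: sum_delta_unitary[OF assms])
  finally show ?thesis by (simp only: sum_distrib_left[symmetric] sum_distrib_right[symmetric])
qed

lemma partial_trace_sum':
  assumes "unitary_on S W" "finite S"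
  shows "(\<Sum>l\<in>S. \<Sum>x\<in>S. \<Sum>y\<in>X. \<Sum>x'\<in>S. \<Sum>y'\<in>X. cnj (u y) * R x y x' y' * u y' * (cnj (W x l) * W x' l))
    = (\<Sum>y\<in>X. \<Sum>y'\<in>X. cnj (u y) * (\<Sum>x\<in>S. R x y x y') * u y')"
proof -
  let ?f = "\<lambda>l x y x' y'. cnj (u y) * R x y x' y' * u y' * (cnj (W x l) * W x' l)"
  have "(\<Sum>x\<in>S. \<Sum>y\<in>X. \<Sum>x'\<in>S. \<Sum>y'\<in>X. ?f l x y x' y')
      = (\<Sum>y\<in>X. \<Sum>x\<in>S. \<Sum>y'\<in>X. \<Sum>x'\<in>S. ?f l x y x' y')" for l
    by (rule trans[OF sum.swap]) (intro sum.cong[OF refl] sum.swap)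
  then show ?thesis
    using partial_trace_sum[OF assms, where X = X and u = u and R = "\<lambda>y x y' x'. R x y x' y'"] by simp
qed

lemma sum_qform_ptrA:
  fixes \<rho> :: "('a::finite \<times> 'b::finite) op"
  assumes W: "unitary_on (lists_n n) W"
  shows "(\<Sum>l\<in>lists_n n. qform (lists_n n) (tpow n \<rho>) (\<lambda>z. u (map fst z) * W (map snd z) l))
    = qform (lists_n n) (tpow n (ptrA \<rho>)) u"
proof -
  have "(\<Sum>l\<in>lists_n n. qform (lists_n n) (tpow n \<rho>) (\<lambda>z. u (map fst z) * W (map snd z) l))
     = (\<Sum>l\<in>lists_n n. \<Sum>x\<in>lists_n n. \<Sum>y\<in>lists_n n. \<Sum>x'\<in>lists_n n. \<Sum>y'\<in>lists_n n.
          cnj (u x) * tpow n \<rho> (zip x y) (zip x' y') * u x' * (cnj (W y l) * W y' l))"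
    by (intro sum.cong[OF refl] qform_pair[where v = "\<lambda>y. W y l" for l])
  also have "\<dots> = (\<Sum>x\<in>lists_n n. \<Sum>x'\<in>lists_n n. cnj (u x) * (\<Sum>y\<in>lists_n n. tpow n \<rho> (zip x y) (zip x' y)) * u x')"
    by (rule partial_trace_sum[OF W finite_lists_n])
  finally show ?thesis by (simp add: qform_def tpow_ptrA)
qed

lemma sum_qform_ptrB:
  fixes \<rho> :: "('a::finite \<times> 'b::finite) op"
  assumes W: "unitary_on (lists_n n) W"
  shows "(\<Sum>l\<in>lists_n n. qform (lists_n n) (tpow n \<rho>) (\<lambda>z. W (map fst z) l * v (map snd z)))
    = qform (lists_n n) (tpow n (ptrB \<rho>)) v"
proof -
  have "qform (lists_n n) (tpow n \<rho>) (\<lambda>z. W (map fst z) l * v (map snd z))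
     = (\<Sum>x\<in>lists_n n. \<Sum>y\<in>lists_n n. \<Sum>x'\<in>lists_n n. \<Sum>y'\<in>lists_n n.
          cnj (v y) * tpow n \<rho> (zip x y) (zip x' y') * v y' * (cnj (W x l) * W x' l))" for l
    using qform_pair[where u = "\<lambda>x. W x l" and v = v] by (simp add: mult_ac)
  then have "(\<Sum>l\<in>lists_n n. qform (lists_n n) (tpow n \<rho>) (\<lambda>z. W (map fst z) l * v (map snd z)))
     = (\<Sum>y\<in>lists_n n. \<Sum>y'\<in>lists_n n. cnj (v y) * (\<Sum>x\<in>lists_n n. tpow n \<rho> (zip x y) (zip x y')) * v y')"
    by (simp only: partial_trace_sum'[OF W finite_lists_n])
  then show ?thesis by (simp add: qform_def tpow_ptrB)
qed

lemma cmod_ip_commute: "cmod (ip S u v) = cmod (ip S v u)"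
  by (subst ip_commute) simp

lemma eig_tpow_pair:
  "l \<in> lists_n n \<Longrightarrow> eig_tpow n (\<lambda>(k, l). dA k * dB l) l = eig_tpow n dA (map fst l) * eig_tpow n dB (map snd l)"
  by (simp add: eig_tpow_def lists_n_def case_prod_unfold prod.distrib)

lemma sum_eig_tpow:
  fixes d :: "'a::finite \<Rightarrow> real"
  shows "(\<Sum>k\<in>lists_n n. eig_tpow n d k) = (\<Sum>k\<in>UNIV. d k) ^ n"
  by (simp add: eig_tpow_def sum_prod_lists[of "\<lambda>i. d"])

lemma sum_ns_weight_right:
  assumes "finite S" "spectral_decomp S R U d"
  shows "(\<Sum>k\<in>S. ns_weight S U d W k l) = Re (qform S R (\<lambda>i. W i l))"
  unfolding ns_weight_def cmod_ip_commute[of S "\<lambda>i. W i l"] qform_spectral[OF assms] by simp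

text \<open>Markov's inequality: where \<open>m\<close> exceeds \<open>c * D\<close>, the mass
  \<open>D\<close> is below \<open>m / c\<close>, and the total of \<open>m\<close> is
  bounded.\<close>

lemma sum_excess_le:
  fixes D m :: "'i \<Rightarrow> real"
  assumes "c > 0" "\<And>i. i \<in> S \<Longrightarrow> m i \<ge> 0" "(\<Sum>i\<in>S. m i) \<le> N"
  shows "(\<Sum>i\<in>S. if m i > c * D i then D i else 0) \<le> N / c"
proof -
  have "(\<Sum>i\<in>S. if m i > c * D i then D i else 0) \<le> (\<Sum>i\<in>S. m i / c)"
    by (rule sum_mono) (use assms in \<open>auto simp: field_simps\<close>)
  also have "\<dots> \<le> N / c"
    unfolding sum_divide_distrib[symmetric] using assms by (intro divide_right_mono) auto
  finally show ?thesis .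
qed

text \<open>The spectral data of \<rho> make its tensor power positive, which supplies the lower
  bound 0 that \<open>Inf\<close> needs.\<close>

lemma alpha_hat_le:
  assumes "test_op (lists_n n) T" and dens: "density_op UNIV \<rho>" "spectral_decomp UNIV \<rho> U d" "\<And>k. d k \<ge> 0"
    and "\<And>\<sigma> \<tau>. density_op (lists_n n) \<sigma> \<Longrightarrow> symmetric_op n \<sigma> \<Longrightarrow> density_op (lists_n n) \<tau> \<Longrightarrow> symmetric_op n \<tau> \<Longrightarrow>
         Re (mtrace (lists_n n) (mmul (lists_n n) (prod_state \<sigma> \<tau>) T)) \<le> \<mu>"
  shows "alpha_hat \<rho> n \<mu> \<le> Re (mtrace (lists_n n) (mmul (lists_n n) (tpow n \<rho>) (\<lambda>i j. mid i j - T i j)))"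
  unfolding alpha_hat_def
proof (rule cInf_lower, goal_cases)
  case 1
  show ?case using assms by blast
next
  case 2
  have "psd (lists_n n) (tpow n \<rho>)"
    by (rule psd_spectral[OF finite_lists_n spectral_tpow[OF dens(2)] eig_tpow_nonneg[OF dens(3)]])
  then show ?case
    by (intro bdd_belowI[of _ 0]) (auto simp: test_op_def intro!: psd_trace_nonneg)
qed

text \<open>\<open>L\<close> sets the likelihood threshold and thereby the permitted error 1 / L;
  \<open>c\<close> is the tolerated ratio between a universal eigenvalue and the true one. The
  threshold loses the square of \<open>c\<close> because A and B contribute one factor each.\<close>

lemma alpha_hat_upper:
  fixes \<rho> :: "('a::finite \<times> 'b::finite) op" and n :: nat
  assumes dens: "density_op UNIV \<rho>" and \<rho>: "spectral_decomp UNIV \<rho> U d" and dpos: "\<And>k. d k \<ge> 0"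
    and A: "spectral_decomp UNIV (ptrA \<rho>) UA dA" and dApos: "\<And>k. dA k \<ge> 0"
    and B: "spectral_decomp UNIV (ptrB \<rho>) UB dB" and dBpos: "\<And>k. dB k \<ge> 0"
    and L: "L > 0" and c: "c > 0"
  defines "D \<equiv> eig_tpow n d" and "N \<equiv> eig_tpow n (\<lambda>(k, l). dA k * dB l)"
  shows "alpha_hat \<rho> n (1 / L)
    \<le> (\<Sum>k\<in>lists_n n. \<Sum>l\<in>lists_n n. if D k \<le> L * c\<^sup>2 * N l
          then ns_weight (lists_n n) (tpow n U) D (tpow n (tensor2 UA UB)) k l else 0)
      + (real ((n + 1) ^ CARD('a \<times> 'a)) + real ((n + 1) ^ CARD('b \<times> 'b))) / c"
proof -
  let ?S = "lists_n n :: ('a \<times> 'b) list set"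
  let ?SA = "lists_n n :: 'a list set" and ?SB = "lists_n n :: 'b list set"
  define DA DB where "DA = eig_tpow n dA" and "DB = eig_tpow n dB"
  obtain GA mA where GA:
    "spectral_decomp ?SA (conj_univ_op n UA) (mmul ?SA (tpow n UA) GA) mA"
    "spectral_decomp ?SA (tpow n (ptrA \<rho>)) (mmul ?SA (tpow n UA) GA) DA"
    "unitary_on ?SA GA"
    "\<And>x k. x \<in> ?SA \<Longrightarrow> k \<in> ?SA \<Longrightarrow> GA x k \<noteq> 0 \<Longrightarrow> DA x = DA k"
    "\<And>k. k \<in> ?SA \<Longrightarrow> mA k \<ge> 0"
    "(\<Sum>k\<in>?SA. mA k) \<le> real ((n + 1) ^ CARD('a \<times> 'a))"
    unfolding DA_def using conj_univ_op_spectral[OF A, of n] by blast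
  obtain GB mB where GB:
    "spectral_decomp ?SB (conj_univ_op n UB) (mmul ?SB (tpow n UB) GB) mB"
    "spectral_decomp ?SB (tpow n (ptrB \<rho>)) (mmul ?SB (tpow n UB) GB) DB"
    "unitary_on ?SB GB"
    "\<And>x k. x \<in> ?SB \<Longrightarrow> k \<in> ?SB \<Longrightarrow> GB x k \<noteq> 0 \<Longrightarrow> DB x = DB k"
    "\<And>k. k \<in> ?SB \<Longrightarrow> mB k \<ge> 0"
    "(\<Sum>k\<in>?SB. mB k) \<le> real ((n + 1) ^ CARD('b \<times> 'b))"
    unfolding DB_def using conj_univ_op_spectral[OF B, of n] by blast
  define WA WB where "WA = mmul ?SA (tpow n UA) GA" and "WB = mmul ?SB (tpow n UB) GB"
  define W where "W = prod_state WA WB"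
  define \<mu> where "\<mu> = (\<lambda>l :: ('a \<times> 'b) list. mA (map fst l) * mB (map snd l))"
  have sdW: "spectral_decomp ?S (prod_state (conj_univ_op n UA) (conj_univ_op n UB)) W \<mu>"
    unfolding W_def \<mu>_def WA_def WB_def by (rule spectral_prod_state[OF GA(1) GB(1)])
  have uW: "unitary_on ?S W" using sdW by (simp add: spectral_decomp_def)
  have uWA: "unitary_on ?SA WA" and uWB: "unitary_on ?SB WB"
    using GA(1) GB(1) by (auto simp: spectral_decomp_def WA_def WB_def)
  have uUA: "unitary_on UNIV UA" and uUB: "unitary_on UNIV UB"
    using A B by (auto simp: spectral_decomp_def)
  have Dpos: "D k \<ge> 0" for k unfolding D_def by (rule eig_tpow_nonneg[OF dpos])
  have DApos: "DA k \<ge> 0" for k unfolding DA_def by (rule eig_tpow_nonneg[OF dApos])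
  have DBpos: "DB k \<ge> 0" for k unfolding DB_def by (rule eig_tpow_nonneg[OF dBpos])
  have sdR: "spectral_decomp ?S (tpow n \<rho>) (tpow n U) D"
    unfolding D_def by (rule spectral_tpow[OF \<rho>])
  define q where "q = ns_weight ?S (tpow n U) D W"
  have qpos: "q k l \<ge> 0" for k l by (simp add: q_def ns_weight_def Dpos)
  \<comment> \<open>The outcome probabilities when the tensor power of \<rho> is measured in the
    product basis of \<open>WA\<close> and \<open>WB\<close>. These diagonalise the marginals of the
    state, so the marginals of \<open>Q\<close> are \<open>DA\<close> and \<open>DB\<close>.\<close>
  define Q where "Q = (\<lambda>l1 l2. Re (qform ?S (tpow n \<rho>) (\<lambda>z. WA (map fst z) l1 * WB (map snd z) l2)))"
  have col: "(\<Sum>k\<in>?S. \<Sum>l\<in>?S. if C (map fst l) (map snd l) then q k l else 0)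
      = (\<Sum>l\<in>?S. (\<lambda>l1 l2. if C l1 l2 then Q l1 l2 else 0) (map fst l) (map snd l))" for C
    by (subst sum.swap, rule sum.cong[OF refl])
      (simp add: q_def sum_ns_weight_right[OF finite_lists_n sdR], simp add: Q_def W_def prod_state_def)
  have marginalA: "(\<Sum>l2\<in>?SB. Q l1 l2) = DA l1" if "l1 \<in> ?SA" for l1
    using sum_qform_ptrA[OF uWB, of \<rho> "\<lambda>x. WA x l1"] qform_eigenvector[OF finite_lists_n GA(2) that]
    by (simp only: Q_def WA_def[symmetric] Re_sum[symmetric] Re_complex_of_real)
  have marginalB: "(\<Sum>l1\<in>?SA. Q l1 l2) = DB l2" if "l2 \<in> ?SB" for l2
    using sum_qform_ptrB[OF uWA, of \<rho> "\<lambda>y. WB y l2"] qform_eigenvector[OF finite_lists_n GB(2) that]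
    by (simp only: Q_def WB_def[symmetric] Re_sum[symmetric] Re_complex_of_real)
  obtain T where T: "test_op ?S T"
    "(\<Sum>k\<in>?S. D k * Re (qform ?S (\<lambda>i j. mid i j - T i j) (\<lambda>i. tpow n U i k)))
       \<le> (\<Sum>k\<in>?S. \<Sum>l\<in>?S. if D k \<le> L * \<mu> l then q k l else 0)"
    "(\<Sum>l\<in>?S. \<mu> l * Re (qform ?S T (\<lambda>i. W i l))) \<le> (\<Sum>k\<in>?S. D k) / L"
    unfolding q_def by (rule likelihood_ratio_test[OF finite_lists_n uW L Dpos])
  have "complex_of_real (\<Sum>k\<in>UNIV. d k) = complex_of_real 1"
    using trace_eigenvalues[OF finite_class.finite_UNIV \<rho>] dens by (simp add: density_op_def)
  then have sumD: "(\<Sum>k\<in>?S. D k) = 1"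
    unfolding D_def sum_eig_tpow by (simp only: of_real_eq_iff) simp
  \<comment> \<open>Domination by the universal operators reduces all symmetric alternatives to the
    single bound that \<open>T\<close> was built for.\<close>
  have "Re (mtrace ?S (mmul ?S (prod_state \<sigma> \<tau>) T)) \<le> 1 / L"
    if "density_op ?SA \<sigma>" "symmetric_op n \<sigma>" "density_op ?SB \<tau>" "symmetric_op n \<tau>" for \<sigma> \<tau>
  proof -
    have "Re (mtrace ?S (mmul ?S (prod_state \<sigma> \<tau>) T))
        \<le> Re (mtrace ?S (mmul ?S (prod_state (conj_univ_op n UA) (conj_univ_op n UB)) T))"
    proof (rule prod_state_trace_mono)
      show "psd ?SA \<sigma>" using that(1) by (simp add: density_op_def)
      show "psd ?S T" using T(1) by (simp add: test_op_def)
      show "psd ?SA (\<lambda>i j. conj_univ_op n UA i j - \<sigma> i j)"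
        by (rule symmetric_density_le_conj_univ_op[OF uUA that(1,2)])
      show "psd ?SB (\<lambda>i j. conj_univ_op n UB i j - \<tau> i j)"
        by (rule symmetric_density_le_conj_univ_op[OF uUB that(3,4)])
    qed (rule psd_conj_univ_op)
    also have "\<dots> \<le> 1 / L" using T(3) by (simp add: Re_trace_spectral[OF sdW] sumD)
    finally show ?thesis .
  qed
  from alpha_hat_le[OF T(1) dens \<rho> dpos this]
  have "alpha_hat \<rho> n (1 / L) \<le> (\<Sum>k\<in>?S. D k * Re (qform ?S (\<lambda>i j. mid i j - T i j) (\<lambda>i. tpow n U i k)))"
    by (simp add: Re_trace_spectral[OF sdR])
  also note T(2)
  \<comment> \<open>Either the threshold condition holds with the true eigenvalues, or a universal
    eigenvalue exceeds its true counterpart by more than the factor \<open>c\<close>.\<close>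
  also have "(\<Sum>k\<in>?S. \<Sum>l\<in>?S. if D k \<le> L * \<mu> l then q k l else 0)
     \<le> (\<Sum>k\<in>?S. \<Sum>l\<in>?S. (if D k \<le> L * c\<^sup>2 * N l then q k l else 0)
         + (if mA (map fst l) > c * DA (map fst l) then q k l else 0)
         + (if mB (map snd l) > c * DB (map snd l) then q k l else 0))"
  proof (intro sum_mono)
    fix k l assume kl: "k \<in> ?S" "l \<in> ?S"
    have m: "mA (map fst l) \<ge> 0" "mB (map snd l) \<ge> 0"
      using GA(5) GB(5) kl by (simp_all add: lists_n_def)
    have "D k \<le> L * c\<^sup>2 * N l" if "D k \<le> L * \<mu> l" "mA (map fst l) \<le> c * DA (map fst l)" "mB (map snd l) \<le> c * DB (map snd l)"
    proof -
      have "\<mu> l \<le> (c * DA (map fst l)) * (c * DB (map snd l))"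
        unfolding \<mu>_def by (rule mult_mono) (use that m c DApos in simp_all)
      also have "\<dots> = c\<^sup>2 * N l"
        using kl(2) by (simp add: N_def eig_tpow_pair DA_def DB_def power2_eq_square)
      finally have "L * \<mu> l \<le> L * (c\<^sup>2 * N l)" using L by simp
      then show ?thesis using that(1) by simp
    qed
    then show "(if D k \<le> L * \<mu> l then q k l else 0) \<le> (if D k \<le> L * c\<^sup>2 * N l then q k l else 0)
         + (if mA (map fst l) > c * DA (map fst l) then q k l else 0)
         + (if mB (map snd l) > c * DB (map snd l) then q k l else 0)"
      using qpos[of k l] by (auto simp: not_less)
  qed
  also have "\<dots> = (\<Sum>k\<in>?S. \<Sum>l\<in>?S. if D k \<le> L * c\<^sup>2 * N l then q k l else 0)
      + (\<Sum>k\<in>?S. \<Sum>l\<in>?S. if mA (map fst l) > c * DA (map fst l) then q k l else 0)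
      + (\<Sum>k\<in>?S. \<Sum>l\<in>?S. if mB (map snd l) > c * DB (map snd l) then q k l else 0)"
    by (simp only: sum.distrib)
  \<comment> \<open>The threshold now sees \<open>l\<close> only through \<open>N l\<close>, which
    is constant on the blocks of \<open>G\<close>; the eigenbasis of the universal operator can
    therefore be exchanged for the product eigenbasis.\<close>
  also have "(\<Sum>k\<in>?S. \<Sum>l\<in>?S. if D k \<le> L * c\<^sup>2 * N l then q k l else 0)
      = (\<Sum>k\<in>?S. \<Sum>l\<in>?S. if D k \<le> L * c\<^sup>2 * N l
          then ns_weight ?S (tpow n U) D (tpow n (tensor2 UA UB)) k l else 0)"
  proof (rule sum.cong[OF refl])
    fix k assume "k \<in> ?S"
    define v where "v = (\<lambda>i. tpow n U i k)"
    define G where "G = prod_state GA GB"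
    have uG: "unitary_on ?S G" unfolding G_def by (rule unitary_prod_state[OF GA(3) GB(3)])
    have W: "W = mmul ?S (prod_state (tpow n UA) (tpow n UB)) G"
      by (simp add: W_def WA_def WB_def G_def prod_state_mmul)
    have block: "N x = N l" if "x \<in> ?S" "l \<in> ?S" "G x l \<noteq> 0" for x l
    proof -
      have "DA (map fst x) = DA (map fst l)" "DB (map snd x) = DB (map snd l)"
        using that by (auto intro!: GA(4) GB(4) simp: G_def prod_state_def lists_n_def)
      then show ?thesis using that by (simp add: N_def eig_tpow_pair DA_def DB_def)
    qed
    have "(\<Sum>l\<in>?S. if D k \<le> L * c\<^sup>2 * N l then q k l else 0)
        = D k * (\<Sum>l\<in>?S. if D k \<le> L * c\<^sup>2 * N l then (cmod (ip ?S (\<lambda>i. W i l) v))\<^sup>2 else 0)"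
      unfolding sum_distrib_left by (rule sum.cong) (auto simp: q_def ns_weight_def v_def)
    also have "\<dots> = D k * (\<Sum>l\<in>?S. if D k \<le> L * c\<^sup>2 * N l
        then (cmod (ip ?S (\<lambda>i. prod_state (tpow n UA) (tpow n UB) i l) v))\<^sup>2 else 0)"
      unfolding W
      using block_parseval[where t = N and Q = "\<lambda>y. D k \<le> L * c\<^sup>2 * y", OF finite_lists_n uG block] by simp
    also have "\<dots> = D k * (\<Sum>l\<in>?S. if D k \<le> L * c\<^sup>2 * N l
        then (cmod (ip ?S (\<lambda>i. tpow n (tensor2 UA UB) i l) v))\<^sup>2 else 0)"
      using prod_state_tpow[of _ n _ UA UB] by (simp add: ip_def cong: if_cong)
    also have "\<dots> = (\<Sum>l\<in>?S. if D k \<le> L * c\<^sup>2 * N l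
          then ns_weight ?S (tpow n U) D (tpow n (tensor2 UA UB)) k l else 0)"
      unfolding sum_distrib_left by (rule sum.cong) (auto simp: ns_weight_def v_def)
    finally show "(\<Sum>l\<in>?S. if D k \<le> L * c\<^sup>2 * N l then q k l else 0)
        = (\<Sum>l\<in>?S. if D k \<le> L * c\<^sup>2 * N l
          then ns_weight ?S (tpow n U) D (tpow n (tensor2 UA UB)) k l else 0)" .
  qed
  also have "(\<Sum>k\<in>?S. \<Sum>l\<in>?S. if mA (map fst l) > c * DA (map fst l) then q k l else 0)
      \<le> real ((n + 1) ^ CARD('a \<times> 'a)) / c"
  proof -
    have "(\<Sum>k\<in>?S. \<Sum>l\<in>?S. if mA (map fst l) > c * DA (map fst l) then q k l else 0)
       = (\<Sum>l1\<in>?SA. \<Sum>l2\<in>?SB. if mA l1 > c * DA l1 then Q l1 l2 else 0)"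
      unfolding col[of "\<lambda>l1 l2. mA l1 > c * DA l1"] by (rule sum_lists_n_pair)
    also have "\<dots> = (\<Sum>l1\<in>?SA. if mA l1 > c * DA l1 then DA l1 else 0)"
      by (rule sum.cong) (simp_all add: marginalA)
    also have "\<dots> \<le> real ((n + 1) ^ CARD('a \<times> 'a)) / c"
      by (rule sum_excess_le[OF c GA(5,6)])
    finally show ?thesis .
  qed
  also have "(\<Sum>k\<in>?S. \<Sum>l\<in>?S. if mB (map snd l) > c * DB (map snd l) then q k l else 0)
      \<le> real ((n + 1) ^ CARD('b \<times> 'b)) / c"
  proof -
    have "(\<Sum>k\<in>?S. \<Sum>l\<in>?S. if mB (map snd l) > c * DB (map snd l) then q k l else 0)
       = (\<Sum>l1\<in>?SA. \<Sum>l2\<in>?SB. if mB l2 > c * DB l2 then Q l1 l2 else 0)"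
      unfolding col[of "\<lambda>l1 l2. mB l2 > c * DB l2"] by (rule sum_lists_n_pair)
    also have "\<dots> = (\<Sum>l2\<in>?SB. \<Sum>l1\<in>?SA. if mB l2 > c * DB l2 then Q l1 l2 else 0)"
      by (rule sum.swap)
    also have "\<dots> = (\<Sum>l2\<in>?SB. if mB l2 > c * DB l2 then DB l2 else 0)"
      by (rule sum.cong) (simp_all add: marginalB)
    also have "\<dots> \<le> real ((n + 1) ^ CARD('b \<times> 'b)) / c"
      by (rule sum_excess_le[OF c GB(5,6)])
    finally show ?thesis .
  qed
  finally show ?thesis by (simp add: add_divide_distrib)
qed

subsection \<open>Moderate deviations of independent sums\<close>

definition list_sum :: "nat \<Rightarrow> ('k \<Rightarrow> real) \<Rightarrow> 'k list \<Rightarrow> real" where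
  "list_sum n Y ks = (\<Sum>i<n. Y (ks ! i))"

definition tail_prob :: "('k::finite \<Rightarrow> real) \<Rightarrow> ('k \<Rightarrow> real) \<Rightarrow> nat \<Rightarrow> real \<Rightarrow> real" where
  "tail_prob P Y n b = (\<Sum>ks\<in>lists_n n. if list_sum n Y ks \<le> - real n * b then eig_tpow n P ks else 0)"

lemma list_sum_snoc: "xs \<in> lists_n n \<Longrightarrow> list_sum (Suc n) Y (xs @ [x]) = list_sum n Y xs + Y x"
  by (auto simp: list_sum_def lists_n_def nth_append intro!: sum.cong)

lemma eig_tpow_snoc: "xs \<in> lists_n n \<Longrightarrow> eig_tpow (Suc n) P (xs @ [x]) = eig_tpow n P xs * P x"
  by (auto simp: eig_tpow_def lists_n_def nth_append intro!: prod.cong)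

text \<open>The cross terms vanish because \<open>Z\<close> is centred under
  \<open>q\<close>.\<close>

lemma second_moment_list_sum:
  fixes q Z :: "'k::finite \<Rightarrow> real"
  assumes q1: "(\<Sum>k\<in>UNIV. q k) = 1" and qZ: "(\<Sum>k\<in>UNIV. q k * Z k) = 0"
  shows "(\<Sum>ks\<in>lists_n n. eig_tpow n q ks * (list_sum n Z ks)\<^sup>2) = real n * (\<Sum>k\<in>UNIV. q k * (Z k)\<^sup>2)"
proof -
  have 1: "(\<Sum>ks\<in>lists_n n. eig_tpow n q ks) = 1" for n by (simp add: sum_eig_tpow q1)
  show ?thesis
  proof (induction n)
    case 0
    then show ?case by (simp add: list_sum_def)
  next
    case (Suc n)
    have "(\<Sum>ks\<in>lists_n (Suc n). eig_tpow (Suc n) q ks * (list_sum (Suc n) Z ks)\<^sup>2)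
        = (\<Sum>xs\<in>lists_n n. \<Sum>x\<in>UNIV. eig_tpow n q xs * q x * (list_sum n Z xs + Z x)\<^sup>2)"
      unfolding sum_lists_n_Suc by (intro sum.cong) (simp_all add: list_sum_snoc eig_tpow_snoc)
    also have "\<dots> = (\<Sum>xs\<in>lists_n n. eig_tpow n q xs * (list_sum n Z xs)\<^sup>2 * (\<Sum>x\<in>UNIV. q x)
        + 2 * eig_tpow n q xs * list_sum n Z xs * (\<Sum>x\<in>UNIV. q x * Z x) + eig_tpow n q xs * (\<Sum>x\<in>UNIV. q x * (Z x)\<^sup>2))"
      unfolding sum_distrib_left sum.distrib[symmetric]
      by (intro sum.cong) (simp_all add: power2_eq_square algebra_simps)
    also have "\<dots> = real n * (\<Sum>k\<in>UNIV. q k * (Z k)\<^sup>2) + (\<Sum>k\<in>UNIV. q k * (Z k)\<^sup>2)"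
      by (simp add: q1 qZ sum.distrib Suc.IH sum_distrib_right[symmetric] 1)
    finally show ?case by (simp add: algebra_simps)
  qed
qed

lemma list_sum_shift: "list_sum n (\<lambda>k. Y k - m) ks = list_sum n Y ks - real n * m"
  by (simp add: list_sum_def sum_subtractf)

text \<open>The sign in the exponent suits lower tails, which are then estimated with t >=
  0.\<close>

definition mgf :: "('k::finite \<Rightarrow> real) \<Rightarrow> ('k \<Rightarrow> real) \<Rightarrow> real \<Rightarrow> real" where
  "mgf P Y t = (\<Sum>k\<in>UNIV. P k * exp (- t * Y k))"

text \<open>The mean of \<open>Y\<close> under the law proportional to
  \<open>P k * exp (- t * Y k)\<close>, which is minus the derivative of
  \<open>ln (mgf P Y t)\<close> in \<open>t\<close>.\<close>

definition tilted_mean :: "('k::finite \<Rightarrow> real) \<Rightarrow> ('k \<Rightarrow> real) \<Rightarrow> real \<Rightarrow> real" where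
  "tilted_mean P Y t = (\<Sum>k\<in>UNIV. P k * exp (- t * Y k) * Y k) / mgf P Y t"

lemma exp_list_sum: "exp (- t * list_sum n Y ks) = (\<Prod>i<n. exp (- t * Y (ks ! i)))"
  by (simp add: list_sum_def sum_distrib_left exp_sum)

locale finite_distr =
  fixes P Y :: "'k::finite \<Rightarrow> real" and V :: real
  assumes Ppos: "\<And>k. P k \<ge> 0" and P1: "(\<Sum>k\<in>UNIV. P k) = 1"
    and mean0: "(\<Sum>k\<in>UNIV. P k * Y k) = 0" and var: "(\<Sum>k\<in>UNIV. P k * (Y k)\<^sup>2) = V" and Vpos: "V > 0"
begin

lemma mgf_pos: "mgf P Y t > 0"
proof -
  obtain k where k: "P k \<noteq> 0" using P1 by fastforce
  then have "0 < P k * exp (- t * Y k)" using Ppos[of k] by (simp add: less_le)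
  also have "\<dots> \<le> mgf P Y t" unfolding mgf_def by (rule member_le_sum) (simp_all add: Ppos)
  finally show ?thesis .
qed

lemma chernoff:
  assumes "t \<ge> 0"
  shows "tail_prob P Y n b \<le> exp (real n * (ln (mgf P Y t) - t * b))"
proof -
  have "tail_prob P Y n b \<le> (\<Sum>ks\<in>lists_n n. exp (- t * (real n * b)) * (eig_tpow n P ks * exp (- t * list_sum n Y ks)))"
    unfolding tail_prob_def
  proof (rule sum_mono)
    fix ks :: "'k list"
    have pos: "eig_tpow n P ks \<ge> 0" by (rule eig_tpow_nonneg[OF Ppos])
    show "(if list_sum n Y ks \<le> - real n * b then eig_tpow n P ks else 0)
        \<le> exp (- t * (real n * b)) * (eig_tpow n P ks * exp (- t * list_sum n Y ks))"
    proof (cases "list_sum n Y ks \<le> - real n * b")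
      case True
      then have "t * (list_sum n Y ks + real n * b) \<le> 0"
        using assms by (intro mult_nonneg_nonpos) auto
      then have "1 \<le> exp (- t * (real n * b)) * exp (- t * list_sum n Y ks)"
        by (simp add: exp_add[symmetric] algebra_simps)
      then show ?thesis using True mult_left_mono[OF _ pos] by (fastforce simp: mult_ac)
    qed (simp add: pos)
  qed
  also have "\<dots> = exp (- t * (real n * b)) * mgf P Y t ^ n"
  proof -
    have "(\<Sum>ks\<in>lists_n n. eig_tpow n P ks * exp (- t * list_sum n Y ks)) = mgf P Y t ^ n"
      unfolding exp_list_sum eig_tpow_def prod.distrib[symmetric]
      by (subst sum_prod_lists) (simp add: mgf_def)
    then show ?thesis by (simp only: sum_distrib_left[symmetric])
  qed
  also have "mgf P Y t ^ n = exp (real n * ln (mgf P Y t))"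
    using mgf_pos[of t] by (simp add: exp_of_nat_mult)
  finally show ?thesis by (simp add: exp_add[symmetric] algebra_simps)
qed

text \<open>Change of measure to the tilted law \<open>q\<close>. The window of half-width n
  \<delta> around the tilted mean of the sum lies inside the tail event by the last hypothesis, and
  there the ratio of the original to the tilted probability is at least exp (n (ln M + t (m -
  \<delta>))). Chebyshev, with the variance bounded through \<open>B\<close>, gives the window its
  probability under \<open>q\<close>.\<close>

lemma tilting_lower_bound:
  assumes t: "t \<ge> 0" and \<delta>: "\<delta> > 0" and n: "n > 0" and B: "\<And>k. \<bar>Y k\<bar> \<le> B"
    and m: "tilted_mean P Y t + \<delta> \<le> - b"
  shows "tail_prob P Y n b
    \<ge> exp (real n * (ln (mgf P Y t) + t * (tilted_mean P Y t - \<delta>))) * (1 - B\<^sup>2 / (real n * \<delta>\<^sup>2))"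
proof -
  define M where "M = mgf P Y t"
  define q where "q = (\<lambda>k. P k * exp (- t * Y k) / M)"
  define m where "m = tilted_mean P Y t"
  have M: "M > 0" by (simp add: M_def mgf_pos)
  have qpos: "q k \<ge> 0" for k using Ppos M by (simp add: q_def)
  have q1: "(\<Sum>k\<in>UNIV. q k) = 1"
    using M by (simp add: q_def sum_divide_distrib[symmetric]) (simp add: M_def mgf_def)
  have qm: "(\<Sum>k\<in>UNIV. q k * Y k) = m"
    by (simp add: q_def m_def tilted_mean_def M_def sum_divide_distrib)
  define Z where "Z = (\<lambda>k. Y k - m)"
  have qZ: "(\<Sum>k\<in>UNIV. q k * Z k) = 0"
    by (simp add: Z_def right_diff_distrib sum_subtractf sum_distrib_right[symmetric] qm q1)
  have "(\<Sum>k\<in>UNIV. q k * (Z k)\<^sup>2) = (\<Sum>k\<in>UNIV. q k * (Y k)\<^sup>2) - m\<^sup>2"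
  proof -
    have "(\<Sum>k\<in>UNIV. q k * (Z k)\<^sup>2) = (\<Sum>k\<in>UNIV. q k * (Y k)\<^sup>2 - 2 * m * (q k * Y k) + m\<^sup>2 * q k)"
      by (rule sum.cong) (simp_all add: Z_def power2_eq_square algebra_simps)
    then show ?thesis
      by (simp add: sum.distrib sum_subtractf sum_distrib_left[symmetric] qm q1) (simp add: power2_eq_square)
  qed
  also have "\<dots> \<le> (\<Sum>k\<in>UNIV. q k * B\<^sup>2)"
  proof -
    have "(Y k)\<^sup>2 \<le> B\<^sup>2" for k using B[of k] by (metis abs_ge_zero power2_abs power_mono)
    then have "(\<Sum>k\<in>UNIV. q k * (Y k)\<^sup>2) \<le> (\<Sum>k\<in>UNIV. q k * B\<^sup>2)"
      by (intro sum_mono mult_left_mono qpos)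
    then show ?thesis using zero_le_power2[of m] by linarith
  qed
  also have "\<dots> = B\<^sup>2" by (simp add: sum_distrib_right[symmetric] q1)
  finally have varZ: "(\<Sum>k\<in>UNIV. q k * (Z k)\<^sup>2) \<le> B\<^sup>2" .
  define W where "W = (\<lambda>ks. \<bar>list_sum n Z ks\<bar> < real n * \<delta>)"
  have n\<delta>: "real n * \<delta> > 0" using n \<delta> by simp
  have "(\<Sum>ks\<in>lists_n n. if W ks then 0 else eig_tpow n q ks)
      \<le> (\<Sum>ks\<in>lists_n n. eig_tpow n q ks * (list_sum n Z ks)\<^sup>2 / (real n * \<delta>)\<^sup>2)"
  proof (rule sum_mono)
    fix ks :: "'k list"
    have pos: "eig_tpow n q ks \<ge> 0" by (rule eig_tpow_nonneg[OF qpos])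
    show "(if W ks then 0 else eig_tpow n q ks) \<le> eig_tpow n q ks * (list_sum n Z ks)\<^sup>2 / (real n * \<delta>)\<^sup>2"
    proof (cases "W ks")
      case False
      then have "(real n * \<delta>)\<^sup>2 \<le> (list_sum n Z ks)\<^sup>2"
        using n\<delta> by (metis W_def abs_of_pos less_le_not_le linorder_not_less power2_abs power_mono)
      then have "1 \<le> (list_sum n Z ks)\<^sup>2 / (real n * \<delta>)\<^sup>2"
        using n\<delta> by (simp only: le_divide_eq_1_pos zero_less_power)
      then show ?thesis using False mult_left_mono[OF _ pos] by fastforce
    qed (simp add: pos)
  qed
  also have "\<dots> = real n * (\<Sum>k\<in>UNIV. q k * (Z k)\<^sup>2) / (real n * \<delta>)\<^sup>2"
    by (simp only: sum_divide_distrib[symmetric] second_moment_list_sum[OF q1 qZ])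
  also have "\<dots> \<le> real n * B\<^sup>2 / (real n * \<delta>)\<^sup>2"
    by (intro divide_right_mono mult_left_mono varZ) auto
  also have "\<dots> = B\<^sup>2 / (real n * \<delta>\<^sup>2)" using n by (simp add: power2_eq_square)
  finally have cheb: "(\<Sum>ks\<in>lists_n n. if W ks then 0 else eig_tpow n q ks) \<le> B\<^sup>2 / (real n * \<delta>\<^sup>2)" .
  have "(\<Sum>ks\<in>lists_n n. if W ks then eig_tpow n q ks else 0) + (\<Sum>ks\<in>lists_n n. if W ks then 0 else eig_tpow n q ks)
      = (\<Sum>ks\<in>lists_n n. eig_tpow n q ks)"
    unfolding sum.distrib[symmetric] by (rule sum.cong) auto
  then have win: "1 - B\<^sup>2 / (real n * \<delta>\<^sup>2) \<le> (\<Sum>ks\<in>lists_n n. if W ks then eig_tpow n q ks else 0)"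
    using cheb by (simp add: sum_eig_tpow q1)
  define C where "C = exp (real n * (ln M + t * (m - \<delta>)))"
  have "C * (1 - B\<^sup>2 / (real n * \<delta>\<^sup>2)) \<le> C * (\<Sum>ks\<in>lists_n n. if W ks then eig_tpow n q ks else 0)"
    using win by (rule mult_left_mono) (simp add: C_def)
  also have "\<dots> = (\<Sum>ks\<in>lists_n n. C * (if W ks then eig_tpow n q ks else 0))" by (rule sum_distrib_left)
  also have "\<dots> \<le> tail_prob P Y n b"
    unfolding tail_prob_def
  proof (rule sum_mono)
    fix ks :: "'k list"
    have posP: "eig_tpow n P ks \<ge> 0" by (rule eig_tpow_nonneg[OF Ppos])
    have posq: "eig_tpow n q ks \<ge> 0" by (rule eig_tpow_nonneg[OF qpos])
    have Mn: "M ^ n = exp (real n * ln M)" using M by (simp add: exp_of_nat_mult)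
    have "eig_tpow n q ks * M ^ n = eig_tpow n P ks * exp (- t * list_sum n Y ks)"
      unfolding exp_list_sum eig_tpow_def q_def prod_dividef prod.distrib using M by simp
    then have eqP: "eig_tpow n P ks = eig_tpow n q ks * M ^ n * exp (t * list_sum n Y ks)"
      by (simp add: exp_minus)
    show "C * (if W ks then eig_tpow n q ks else 0) \<le> (if list_sum n Y ks \<le> - real n * b then eig_tpow n P ks else 0)"
    proof (cases "W ks")
      case True
      then have w: "\<bar>list_sum n Y ks - real n * m\<bar> < real n * \<delta>" by (simp add: W_def Z_def list_sum_shift)
      have "real n * (m + \<delta>) \<le> real n * (- b)" using assms(5) by (intro mult_left_mono) (simp_all add: m_def)
      then have cond: "list_sum n Y ks \<le> - real n * b" using w by (simp add: algebra_simps abs_less_iff)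
      have "real n * (m - \<delta>) \<le> list_sum n Y ks" using w by (simp add: algebra_simps abs_less_iff)
      then have "t * (real n * (m - \<delta>)) \<le> t * list_sum n Y ks" using t by (rule mult_left_mono)
      then have "C \<le> M ^ n * exp (t * list_sum n Y ks)"
        by (simp add: C_def Mn exp_add[symmetric] algebra_simps)
      then have "C * eig_tpow n q ks \<le> M ^ n * exp (t * list_sum n Y ks) * eig_tpow n q ks"
        using posq by (rule mult_right_mono)
      then show ?thesis using True cond by (simp add: eqP mult_ac)
    qed (simp add: posP)
  qed
  finally show ?thesis by (simp add: C_def M_def m_def)
qed

text \<open>The linear term of the exponential drops out because the mean is 0. The limit is taken
  from the right since the tilt parameters will be positive multiples of a_n.\<close>

lemma mgf_expansion: "((\<lambda>t. (mgf P Y t - 1) / t\<^sup>2) \<longlongrightarrow> V / 2) (at_right 0)"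
proof -
  have lim: "((\<lambda>t. (exp (- t * y) - 1 + t * y) / t\<^sup>2) \<longlongrightarrow> y\<^sup>2 / 2) (at_right 0)" for y :: real
    unfolding power2_eq_square[of y] by real_asymp
  have "((\<lambda>t. \<Sum>k\<in>UNIV. P k * ((exp (- t * Y k) - 1 + t * Y k) / t\<^sup>2)) \<longlongrightarrow> (\<Sum>k\<in>UNIV. P k * ((Y k)\<^sup>2 / 2))) (at_right 0)"
    by (intro tendsto_sum tendsto_mult tendsto_const lim)
  moreover have "(\<Sum>k\<in>UNIV. P k * ((Y k)\<^sup>2 / 2)) = V / 2"
    by (simp add: var[symmetric] sum_divide_distrib)
  moreover have "(\<Sum>k\<in>UNIV. P k * ((exp (- t * Y k) - 1 + t * Y k) / t\<^sup>2)) = (mgf P Y t - 1) / t\<^sup>2" for t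
  proof -
    have "(\<Sum>k\<in>UNIV. P k * ((exp (- t * Y k) - 1 + t * Y k) / t\<^sup>2))
        = (\<Sum>k\<in>UNIV. P k * exp (- t * Y k) - P k + t * (P k * Y k)) / t\<^sup>2"
      unfolding sum_divide_distrib by (rule sum.cong) (simp_all add: algebra_simps)
    then show ?thesis by (simp add: sum.distrib sum_subtractf sum_distrib_left[symmetric] P1 mean0 mgf_def)
  qed
  ultimately show ?thesis by (simp only:)
qed

lemma mgf_tendsto: "((\<lambda>t. mgf P Y t) \<longlongrightarrow> 1) (at_right 0)"
proof -
  have "((\<lambda>t. \<Sum>k\<in>UNIV. P k * exp (- t * Y k)) \<longlongrightarrow> (\<Sum>k\<in>UNIV. P k * exp (- 0 * Y k))) (at_right 0)"
    by (intro tendsto_intros)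
  then show ?thesis by (simp add: mgf_def P1)
qed

lemma ln_mgf_expansion: "((\<lambda>t. ln (mgf P Y t) / t\<^sup>2) \<longlongrightarrow> V / 2) (at_right 0)"
proof -
  have "((\<lambda>x::real. ln x / (x - 1)) \<longlongrightarrow> 1) (at_right 1)" by real_asymp
  \<comment> \<open>Positive variance keeps \<open>mgf\<close> strictly above 1 for small t > 0, so
    the one-sided limit of ln x / (x - 1) at 1 can be composed with it.\<close>
  moreover have "filterlim (\<lambda>t. mgf P Y t) (at_right 1) (at_right 0)"
  proof (rule tendsto_imp_filterlim_at_right)
    show "((\<lambda>t. mgf P Y t) \<longlongrightarrow> 1) (at_right 0)" by (rule mgf_tendsto)
    have "eventually (\<lambda>t. (mgf P Y t - 1) / t\<^sup>2 > 0) (at_right 0)"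
      using order_tendstoD(1)[OF mgf_expansion, of 0] Vpos by simp
    then show "eventually (\<lambda>t. mgf P Y t > 1) (at_right 0)"
      by (rule eventually_mono) (simp add: zero_less_divide_iff)
  qed
  ultimately have 1: "((\<lambda>t. ln (mgf P Y t) / (mgf P Y t - 1)) \<longlongrightarrow> 1) (at_right 0)"
    by (rule filterlim_compose)
  have "((\<lambda>t. ln (mgf P Y t) / (mgf P Y t - 1) * ((mgf P Y t - 1) / t\<^sup>2)) \<longlongrightarrow> 1 * (V / 2)) (at_right 0)"
    by (rule tendsto_mult[OF 1 mgf_expansion])
  moreover have "ln (mgf P Y t) / (mgf P Y t - 1) * ((mgf P Y t - 1) / t\<^sup>2) = ln (mgf P Y t) / t\<^sup>2" for t
    by (cases "mgf P Y t = 1") simp_all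
  ultimately show ?thesis by (simp only: mult_1)
qed

lemma tilted_mean_expansion: "((\<lambda>t. tilted_mean P Y t / t) \<longlongrightarrow> - V) (at_right 0)"
proof -
  have lim: "((\<lambda>t. (exp (- t * y) - 1) / t) \<longlongrightarrow> - y) (at_right 0)" for y :: real
    by real_asymp
  have "((\<lambda>t. (\<Sum>k\<in>UNIV. P k * Y k * ((exp (- t * Y k) - 1) / t)) / mgf P Y t) \<longlongrightarrow> (\<Sum>k\<in>UNIV. P k * Y k * - Y k) / 1) (at_right 0)"
    by (intro tendsto_divide tendsto_sum tendsto_mult tendsto_const lim mgf_tendsto) simp
  moreover have "(\<Sum>k\<in>UNIV. P k * Y k * - Y k) = - V"
    by (simp add: var[symmetric] power2_eq_square sum_negf mult.assoc)
  moreover have "(\<Sum>k\<in>UNIV. P k * Y k * ((exp (- t * Y k) - 1) / t)) / mgf P Y t = tilted_mean P Y t / t" for t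
  proof -
    have "(\<Sum>k\<in>UNIV. P k * Y k * ((exp (- t * Y k) - 1) / t)) = (\<Sum>k\<in>UNIV. P k * exp (- t * Y k) * Y k - P k * Y k) / t"
      unfolding sum_divide_distrib by (rule sum.cong) (simp_all add: algebra_simps)
    then show ?thesis by (simp add: tilted_mean_def sum_subtractf mean0)
  qed
  ultimately show ?thesis by simp
qed

lemma scaled_expansions:
  assumes apos: "\<And>n. a n > 0" and a0: "a \<longlonglongrightarrow> 0" and c: "c > 0"
  shows "(\<lambda>n. ln (mgf P Y (c * a n)) / (a n)\<^sup>2) \<longlonglongrightarrow> c\<^sup>2 * V / 2"
    and "(\<lambda>n. tilted_mean P Y (c * a n) / a n) \<longlonglongrightarrow> - c * V"
proof -
  have "(\<lambda>n. c * a n) \<longlonglongrightarrow> c * 0" by (intro tendsto_mult tendsto_const a0)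
  then have ca: "filterlim (\<lambda>n. c * a n) (at_right 0) sequentially"
    using apos c by (intro tendsto_imp_filterlim_at_right) simp_all
  have "(\<lambda>n. c\<^sup>2 * (ln (mgf P Y (c * a n)) / (c * a n)\<^sup>2)) \<longlonglongrightarrow> c\<^sup>2 * (V / 2)"
    by (intro tendsto_mult tendsto_const filterlim_compose[OF ln_mgf_expansion ca])
  then show "(\<lambda>n. ln (mgf P Y (c * a n)) / (a n)\<^sup>2) \<longlonglongrightarrow> c\<^sup>2 * V / 2"
    using c by (simp add: power_mult_distrib)
  have "(\<lambda>n. c * (tilted_mean P Y (c * a n) / (c * a n))) \<longlonglongrightarrow> c * (- V)"
    by (intro tendsto_mult tendsto_const filterlim_compose[OF tilted_mean_expansion ca])
  then show "(\<lambda>n. tilted_mean P Y (c * a n) / a n) \<longlonglongrightarrow> - c * V"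
    using c by simp
qed

lemma tail_prob_upper:
  assumes apos: "\<And>n. a n > 0" and a0: "a \<longlonglongrightarrow> 0" and s: "s > 0" and \<epsilon>: "\<epsilon> > 0"
  shows "eventually (\<lambda>n. tail_prob P Y n (s * a n) \<le> exp (- (real n * (a n)\<^sup>2) * (s\<^sup>2 / (2 * V) - \<epsilon>))) sequentially"
proof -
  \<comment> \<open>This minimises c^2 V / 2 - c s, the limiting exponent for the tilt c a_n at
    level s a_n; the minimum is - s^2 / (2 V).\<close>
  define c where "c = s / V"
  have c: "c > 0" using s Vpos by (simp add: c_def)
  have "c\<^sup>2 * V / 2 = s\<^sup>2 / (2 * V)" using Vpos by (simp add: c_def power2_eq_square)
  then have "eventually (\<lambda>n. ln (mgf P Y (c * a n)) / (a n)\<^sup>2 < s\<^sup>2 / (2 * V) + \<epsilon>) sequentially"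
    using order_tendstoD(2)[OF scaled_expansions(1)[OF apos a0 c], of "s\<^sup>2 / (2 * V) + \<epsilon>"] \<epsilon> by simp
  then show ?thesis
  proof (rule eventually_mono)
    fix n assume "ln (mgf P Y (c * a n)) / (a n)\<^sup>2 < s\<^sup>2 / (2 * V) + \<epsilon>"
    then have "ln (mgf P Y (c * a n)) \<le> (s\<^sup>2 / (2 * V) + \<epsilon>) * (a n)\<^sup>2"
      using apos[of n] by (simp add: divide_less_eq)
    moreover have "c * a n * (s * a n) = s\<^sup>2 / V * (a n)\<^sup>2" by (simp add: c_def power2_eq_square)
    moreover have "s\<^sup>2 / V = s\<^sup>2 / (2 * V) + s\<^sup>2 / (2 * V)" by simp
    ultimately have "ln (mgf P Y (c * a n)) - c * a n * (s * a n) \<le> - (a n)\<^sup>2 * (s\<^sup>2 / (2 * V) - \<epsilon>)"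
      by (simp only: distrib_right) (simp add: algebra_simps)
    then have "real n * (ln (mgf P Y (c * a n)) - c * a n * (s * a n)) \<le> real n * (- (a n)\<^sup>2 * (s\<^sup>2 / (2 * V) - \<epsilon>))"
      by (rule mult_left_mono) simp
    also have "\<dots> = - (real n * (a n)\<^sup>2) * (s\<^sup>2 / (2 * V) - \<epsilon>)" by simp
    finally have "exp (real n * (ln (mgf P Y (c * a n)) - c * a n * (s * a n)))
        \<le> exp (- (real n * (a n)\<^sup>2) * (s\<^sup>2 / (2 * V) - \<epsilon>))" by (simp only: exp_le_cancel_iff)
    moreover have "tail_prob P Y n (s * a n) \<le> exp (real n * (ln (mgf P Y (c * a n)) - c * a n * (s * a n)))"
      by (rule chernoff) (use c apos[of n] in simp)
    ultimately show "tail_prob P Y n (s * a n) \<le> exp (- (real n * (a n)\<^sup>2) * (s\<^sup>2 / (2 * V) - \<epsilon>))"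
      by (rule order_trans[rotated])
  qed
qed

lemma tail_prob_lower:
  assumes apos: "\<And>n. a n > 0" and a0: "a \<longlonglongrightarrow> 0" and s: "s > 0" and \<epsilon>: "\<epsilon> > 0"
    and na: "filterlim (\<lambda>n. real n * (a n)\<^sup>2) at_top sequentially"
  shows "eventually (\<lambda>n. tail_prob P Y n (s * a n) \<ge> exp (- (real n * (a n)\<^sup>2) * (s\<^sup>2 / (2 * V) + \<epsilon>))) sequentially"
proof -
  \<comment> \<open>The exponent obtained when the tilted mean is placed near - (s + 2 \<theta>) a_n
    and the window has half-width \<theta> a_n / 2 per copy; it tends to s^2 / (2 V) as \<theta>
    tends to 0.\<close>
  define g where "g = (\<lambda>\<theta>. (s + 2 * \<theta>)\<^sup>2 / (2 * V) + (s + 2 * \<theta>) / V * (\<theta> / 2))"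
  have "(g \<longlongrightarrow> (s + 2 * 0)\<^sup>2 / (2 * V) + (s + 2 * 0) / V * (0 / 2)) (at_right 0)"
    unfolding g_def using Vpos by (intro tendsto_intros) auto
  then have "eventually (\<lambda>\<theta>. g \<theta> < s\<^sup>2 / (2 * V) + \<epsilon> / 3) (at_right 0)"
    by (rule order_tendstoD(2)) (use \<epsilon> in simp)
  moreover have "eventually (\<lambda>\<theta>::real. \<theta> > 0) (at_right 0)" by (rule eventually_at_right_less)
  ultimately have "eventually (\<lambda>\<theta>. g \<theta> < s\<^sup>2 / (2 * V) + \<epsilon> / 3 \<and> \<theta> > 0) (at_right 0)"
    by (rule eventually_conj)
  then obtain \<theta> where \<theta>: "\<theta> > 0" "g \<theta> < s\<^sup>2 / (2 * V) + \<epsilon> / 3"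
    using eventually_happens'[OF trivial_limit_at_right_real] by blast
  \<comment> \<open>Overshooting \<open>s\<close> by 2 \<theta> leaves room both for the error in
    the tilted mean and for the window around it.\<close>
  define c where "c = (s + 2 * \<theta>) / V"
  have c: "c > 0" using s \<theta> Vpos by (simp add: c_def)
  have cV: "c * V = s + 2 * \<theta>" using Vpos by (simp add: c_def)
  define B where "B = (\<Sum>k\<in>UNIV. \<bar>Y k\<bar>)"
  have B: "\<bar>Y k\<bar> \<le> B" for k unfolding B_def by (rule member_le_sum) simp_all
  note exps = scaled_expansions[OF apos a0 c]
  have ev1: "eventually (\<lambda>n. tilted_mean P Y (c * a n) / a n < - (s + 2 * \<theta>) + \<theta> / 2) sequentially"
    by (rule order_tendstoD(2)[OF exps(2)]) (use \<theta> cV in simp)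
  have "(\<lambda>n. ln (mgf P Y (c * a n)) / (a n)\<^sup>2 + c * (tilted_mean P Y (c * a n) / a n - \<theta> / 2))
      \<longlonglongrightarrow> c\<^sup>2 * V / 2 + c * (- c * V - \<theta> / 2)"
    by (intro tendsto_intros exps)
  moreover have "c\<^sup>2 * V / 2 + c * (- c * V - \<theta> / 2) = - g \<theta>"
  proof -
    have "c\<^sup>2 * V / 2 + c * (- c * V - \<theta> / 2) = - (c * (c * V)) / 2 - c * \<theta> / 2"
      by (simp add: power2_eq_square algebra_simps)
    then show ?thesis unfolding cV by (simp add: g_def c_def power2_eq_square)
  qed
  ultimately have ev2: "eventually (\<lambda>n. ln (mgf P Y (c * a n)) / (a n)\<^sup>2 + c * (tilted_mean P Y (c * a n) / a n - \<theta> / 2)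
      > - (s\<^sup>2 / (2 * V) + \<epsilon> / 3) - \<epsilon> / 3) sequentially"
    by (intro order_tendstoD(1)) (use \<theta>(2) \<epsilon> in auto)
  \<comment> \<open>With \<delta> = \<theta> a_n / 2 this makes the Chebyshev term at most
    1/2.\<close>
  have ev3: "eventually (\<lambda>n. real n * (a n)\<^sup>2 \<ge> 8 * B\<^sup>2 / \<theta>\<^sup>2) sequentially"
    using na by (simp add: filterlim_at_top)
  \<comment> \<open>From here on exp (- x \<epsilon> / 3) is at most 1/2 and absorbs the remaining
    window probability.\<close>
  have ev4: "eventually (\<lambda>n. real n * (a n)\<^sup>2 \<ge> 3 * ln 2 / \<epsilon>) sequentially"
    using na by (simp add: filterlim_at_top)
  show ?thesis
    using ev1 ev2 ev3 ev4 eventually_gt_at_top[of 0]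
  proof eventually_elim
    case (elim n)
    define x where "x = real n * (a n)\<^sup>2"
    have an: "a n > 0" by (rule apos)
    have x: "x > 0" using elim(5) an by (simp add: x_def)
    define \<delta> where "\<delta> = \<theta> * a n / 2"
    have \<delta>: "\<delta> > 0" using \<theta> an by (simp add: \<delta>_def)
    have "tilted_mean P Y (c * a n) < (- (s + 2 * \<theta>) + \<theta> / 2) * a n"
      using elim(1) an by (simp add: divide_less_eq)
    moreover have "\<theta> * a n > 0" using \<theta> an by simp
    ultimately have m: "tilted_mean P Y (c * a n) + \<delta> \<le> - (s * a n)"
      by (simp add: \<delta>_def algebra_simps)
    have lower: "tail_prob P Y n (s * a n)
      \<ge> exp (real n * (ln (mgf P Y (c * a n)) + c * a n * (tilted_mean P Y (c * a n) - \<delta>))) * (1 - B\<^sup>2 / (real n * \<delta>\<^sup>2))"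
      by (rule tilting_lower_bound[OF _ \<delta> elim(5) B m]) (use c an in simp)
    have "real n * \<delta>\<^sup>2 = x * \<theta>\<^sup>2 / 4"
      by (simp add: \<delta>_def x_def power_mult_distrib power_divide)
    moreover have "B\<^sup>2 / (x * \<theta>\<^sup>2 / 4) \<le> 1 / 2"
      using elim(3) x \<theta>(1) unfolding x_def[symmetric] by (simp add: field_simps)
    ultimately have "B\<^sup>2 / (real n * \<delta>\<^sup>2) \<le> 1 / 2" by (simp only:)
    then have "1 / 2 \<le> 1 - B\<^sup>2 / (real n * \<delta>\<^sup>2)" by simp
    moreover have "exp (- x * (\<epsilon> / 3)) \<le> 1 / 2"
    proof -
      have "ln 2 \<le> x * (\<epsilon> / 3)" using elim(4) \<epsilon> unfolding x_def[symmetric] by (simp add: field_simps)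
      then have "exp (- x * (\<epsilon> / 3)) \<le> exp (- ln 2)" by simp
      then show ?thesis by (simp add: exp_minus)
    qed
    ultimately have cheb: "exp (- x * (\<epsilon> / 3)) \<le> 1 - B\<^sup>2 / (real n * \<delta>\<^sup>2)" by simp
    have "real n * (ln (mgf P Y (c * a n)) + c * a n * (tilted_mean P Y (c * a n) - \<delta>))
        = x * (ln (mgf P Y (c * a n)) / (a n)\<^sup>2 + c * (tilted_mean P Y (c * a n) / a n - \<theta> / 2))"
      using an by (simp add: x_def \<delta>_def field_simps power2_eq_square)
    also have "\<dots> \<ge> x * (- (s\<^sup>2 / (2 * V) + \<epsilon> / 3) - \<epsilon> / 3)"
      using elim(2) x by (intro mult_left_mono) auto
    finally have "exp (x * (- (s\<^sup>2 / (2 * V) + \<epsilon> / 3) - \<epsilon> / 3))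
        \<le> exp (real n * (ln (mgf P Y (c * a n)) + c * a n * (tilted_mean P Y (c * a n) - \<delta>)))" by simp
    then have "exp (x * (- (s\<^sup>2 / (2 * V) + \<epsilon> / 3) - \<epsilon> / 3)) * exp (- x * (\<epsilon> / 3)) \<le> tail_prob P Y n (s * a n)"
      using lower mult_mono[OF _ cheb] by (meson exp_ge_zero order_trans)
    moreover have "exp (x * (- (s\<^sup>2 / (2 * V) + \<epsilon> / 3) - \<epsilon> / 3)) * exp (- x * (\<epsilon> / 3)) = exp (- x * (s\<^sup>2 / (2 * V) + \<epsilon>))"
      by (simp add: exp_add[symmetric] algebra_simps)
    ultimately show ?case by (simp add: x_def)
  qed
qed

end

subsection \<open>Reduction to the Nussbaum-Szkola distribution\<close>

lemma qform_UNIV_pair: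
  fixes R :: "('a::finite \<times> 'b::finite) op"
  shows "qform UNIV R (\<lambda>z. u (fst z) * v (snd z))
    = (\<Sum>x\<in>UNIV. \<Sum>y\<in>UNIV. \<Sum>x'\<in>UNIV. \<Sum>y'\<in>UNIV. cnj (u x) * R (x, y) (x', y') * u x' * (cnj (v y) * v y'))"
  unfolding qform_def sum_UNIV_pair by (intro sum.cong refl) (simp add: mult_ac)

lemma sum_qform_ptrA_single:
  fixes \<rho> :: "('a::finite \<times> 'b::finite) op"
  assumes W: "unitary_on UNIV W"
  shows "(\<Sum>l\<in>UNIV. qform UNIV \<rho> (\<lambda>z. u (fst z) * W (snd z) l)) = qform UNIV (ptrA \<rho>) u"
proof -
  have "(\<Sum>l\<in>UNIV. qform UNIV \<rho> (\<lambda>z. u (fst z) * W (snd z) l))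
     = (\<Sum>l\<in>UNIV. \<Sum>x\<in>UNIV. \<Sum>y\<in>UNIV. \<Sum>x'\<in>UNIV. \<Sum>y'\<in>UNIV.
          cnj (u x) * \<rho> (x, y) (x', y') * u x' * (cnj (W y l) * W y' l))"
    by (intro sum.cong[OF refl] qform_UNIV_pair[where v = "\<lambda>y. W y l" for l])
  also have "\<dots> = (\<Sum>x\<in>UNIV. \<Sum>x'\<in>UNIV. cnj (u x) * (\<Sum>y\<in>UNIV. \<rho> (x, y) (x', y)) * u x')"
    by (rule partial_trace_sum[OF W, where R = "\<lambda>x y x' y'. \<rho> (x, y) (x', y')"]) simp
  finally show ?thesis by (simp add: qform_def ptrA_def)
qed

lemma sum_qform_ptrB_single:
  fixes \<rho> :: "('a::finite \<times> 'b::finite) op"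
  assumes W: "unitary_on UNIV W"
  shows "(\<Sum>l\<in>UNIV. qform UNIV \<rho> (\<lambda>z. W (fst z) l * v (snd z))) = qform UNIV (ptrB \<rho>) v"
proof -
  have "qform UNIV \<rho> (\<lambda>z. W (fst z) l * v (snd z))
     = (\<Sum>x\<in>UNIV. \<Sum>y\<in>UNIV. \<Sum>x'\<in>UNIV. \<Sum>y'\<in>UNIV.
          cnj (v y) * \<rho> (x, y) (x', y') * v y' * (cnj (W x l) * W x' l))" for l
    using qform_UNIV_pair[where u = "\<lambda>x. W x l" and v = v] by (simp add: mult_ac)
  then have "(\<Sum>l\<in>UNIV. qform UNIV \<rho> (\<lambda>z. W (fst z) l * v (snd z)))
     = (\<Sum>y\<in>UNIV. \<Sum>y'\<in>UNIV. cnj (v y) * (\<Sum>x\<in>UNIV. \<rho> (x, y) (x, y')) * v y')"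
    by (simp only: partial_trace_sum'[OF W finite, where R = "\<lambda>x y x' y'. \<rho> (x, y) (x', y')"])
  then show ?thesis by (simp add: qform_def ptrB_def)
qed

lemma psd_ptrA: "psd UNIV \<rho> \<Longrightarrow> psd UNIV (ptrA \<rho>)"
  unfolding psd_iff_qform sum_qform_ptrA_single[OF unitary_on_mid[OF finite], symmetric] by (simp add: sum_nonneg)

lemma psd_ptrB: "psd UNIV \<rho> \<Longrightarrow> psd UNIV (ptrB \<rho>)"
  unfolding psd_iff_qform sum_qform_ptrB_single[OF unitary_on_mid[OF finite], symmetric] by (simp add: sum_nonneg)

lemma density_ptrA: "density_op UNIV \<rho> \<Longrightarrow> density_op UNIV (ptrA \<rho>)"
  by (simp add: density_op_def psd_ptrA) (simp add: mtrace_def ptrA_def sum_UNIV_pair)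

lemma density_ptrB: "density_op UNIV \<rho> \<Longrightarrow> density_op UNIV (ptrB \<rho>)"
  by (simp add: density_op_def psd_ptrB) (simp add: mtrace_def ptrB_def sum_UNIV_pair, subst sum.swap, simp)

lemma mlog_spectral:
  assumes "finite S" "spectral_decomp S M U d"
  shows "spectral_decomp S (mlog S M) U (\<lambda>k. ln (d k))"
  using assms by (simp add: spectral_decomp_def mlog_def mfun_spectral[OF assms])

lemma vn_entropy_spectral:
  assumes "finite S" "spectral_decomp S M U d"
  shows "vn_entropy S M = - (\<Sum>k\<in>S. d k * ln (d k))"
  by (simp add: vn_entropy_def Re_trace_spectral[OF assms(2)] qform_eigenvector[OF assms(1) mlog_spectral[OF assms]])

lemma mvec_eigenvector:
  assumes S: "finite S" and M: "spectral_decomp S M U d" and ik: "i \<in> S" "k \<in> S"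
  shows "mvec S M (\<lambda>i. U i k) i = complex_of_real (d k) * U i k"
proof -
  have U: "unitary_on S U" using M by (simp add: spectral_decomp_def)
  have "mvec S M (\<lambda>i. U i k) i = (\<Sum>j\<in>S. \<Sum>l\<in>S. U i l * complex_of_real (d l) * (cnj (U j l) * U j k))"
    unfolding mvec_def using M ik
    by (intro sum.cong) (simp_all add: spectral_decomp_def sum_distrib_left sum_distrib_right mult_ac)
  also have "\<dots> = (\<Sum>l\<in>S. \<Sum>j\<in>S. U i l * complex_of_real (d l) * (cnj (U j l) * U j k))" by (rule sum.swap)
  also have "\<dots> = (\<Sum>l\<in>S. U i l * complex_of_real (d l) * (if l = k then 1 else 0))"
    unfolding sum_distrib_left[symmetric] using unitary_cols[OF U _ ik(2)] by (intro sum.cong) simp_all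
  also have "\<dots> = complex_of_real (d k) * U i k"
    using S ik by (simp add: if_distrib[of "\<lambda>z. _ * z"] cong: if_cong)
  finally show ?thesis .
qed

lemma spectral_hermitian:
  assumes "spectral_decomp S M U d"
  shows "hermitian_on S M"
  unfolding hermitian_on_def
proof (intro ballI)
  fix i j assume ij: "i \<in> S" "j \<in> S"
  have "cnj (M j i) = (\<Sum>k\<in>S. U i k * complex_of_real (d k) * cnj (U j k))"
    using assms ij by (simp add: spectral_decomp_def mult_ac)
  then show "M i j = cnj (M j i)" using assms ij by (simp add: spectral_decomp_def)
qed

text \<open>\<open>A\<close> and \<open>B\<close> need not commute, yet <w_l, (A - B) u_k> = (x_k -
  y_l) <w_l, u_k>, since \<open>A\<close> acts on the right eigenvector and \<open>B\<close> on the
  left one. Parseval in \<open>W\<close> then turns the trace into a second moment under the joint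
  weights.\<close>

lemma trace_square_difference:
  assumes S: "finite S" and R: "spectral_decomp S R U d" and A: "spectral_decomp S A U x" and B: "spectral_decomp S B W y"
    and L: "\<And>i j. i \<in> S \<Longrightarrow> j \<in> S \<Longrightarrow> L i j = A i j - B i j"
  shows "Re (mtrace S (mmul S R (mmul S L L)))
    = (\<Sum>k\<in>S. \<Sum>l\<in>S. ns_weight S U d W k l * (x k - y l)\<^sup>2)"
proof -
  have W: "unitary_on S W" using B by (simp add: spectral_decomp_def)
  have hA: "hermitian_on S A" and hB: "hermitian_on S B"
    using A B by (auto intro: spectral_hermitian)
  have hL: "hermitian_on S L"
    unfolding hermitian_on_def using hermitian_cnj[OF hA] hermitian_cnj[OF hB] by (simp add: L)
  have "d k * Re (qform S (mmul S L L) (\<lambda>i. U i k)) = (\<Sum>l\<in>S. ns_weight S U d W k l * (x k - y l)\<^sup>2)" if k: "k \<in> S" for k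
  proof -
    let ?u = "\<lambda>i. U i k"
    have "qform S (mmul S L L) ?u = nsq S (mvec S L ?u)"
      unfolding qform_ip mvec_mmul ip_hermitian[OF hL] ip_self ..
    moreover have "nsq S (mvec S L ?u) = (\<Sum>l\<in>S. (cmod (ip S (\<lambda>i. W i l) (mvec S L ?u)))\<^sup>2)"
      by (rule parseval[OF S W, symmetric])
    moreover have "ip S (\<lambda>i. W i l) (mvec S L ?u) = complex_of_real (x k - y l) * ip S (\<lambda>i. W i l) ?u" if l: "l \<in> S" for l
    proof -
      have "ip S (\<lambda>i. W i l) (mvec S L ?u) = ip S (\<lambda>i. W i l) (\<lambda>i. mvec S A ?u i - mvec S B ?u i)"
        by (rule ip_cong) (simp_all add: mvec_def L left_diff_distrib sum_subtractf)
      also have "\<dots> = ip S (\<lambda>i. W i l) (mvec S A ?u) - ip S (mvec S B (\<lambda>i. W i l)) ?u"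
        by (simp add: ip_diff_right ip_hermitian[OF hB])
      also have "ip S (\<lambda>i. W i l) (mvec S A ?u) = complex_of_real (x k) * ip S (\<lambda>i. W i l) ?u"
        unfolding ip_scale_right[symmetric] by (rule ip_cong) (simp_all add: mvec_eigenvector[OF S A _ k])
      also have "ip S (mvec S B (\<lambda>i. W i l)) ?u = complex_of_real (y l) * ip S (\<lambda>i. W i l) ?u"
        unfolding ip_def sum_distrib_left by (rule sum.cong) (simp_all add: mvec_eigenvector[OF S B _ l])
      finally show ?thesis by (simp add: left_diff_distrib)
    qed
    ultimately have "Re (qform S (mmul S L L) ?u) = (\<Sum>l\<in>S. (x k - y l)\<^sup>2 * (cmod (ip S (\<lambda>i. W i l) ?u))\<^sup>2)"
      by (simp add: norm_mult power_mult_distrib flip: of_real_diff)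
    then show ?thesis by (simp add: sum_distrib_left ns_weight_def mult_ac)
  qed
  then show ?thesis by (simp add: Re_trace_spectral[OF R])
qed

lemma test_op_zero: "finite S \<Longrightarrow> test_op S (\<lambda>_ _. 0)"
  by (simp add: test_op_def psd_iff_qform qform_mid nsq_nonneg) (simp add: qform_def)

lemma density_tpow:
  fixes \<sigma> :: "'a::finite op"
  assumes "density_op UNIV \<sigma>"
  shows "density_op (lists_n n) (tpow n \<sigma>)"
proof -
  have psd: "psd UNIV \<sigma>" and tr: "mtrace UNIV \<sigma> = 1" using assms by (auto simp: density_op_def)
  obtain U d where U: "spectral_decomp UNIV \<sigma> U d" and d: "\<And>k. d k \<ge> 0"
    using psd_ex_spectral[OF finite psd] by (metis UNIV_I)
  have "complex_of_real (\<Sum>k\<in>UNIV. d k) = 1" using trace_eigenvalues[OF finite U] tr by simp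
  then have "(\<Sum>k\<in>lists_n n. eig_tpow n d k) = 1"
    unfolding sum_eig_tpow by (metis of_real_eq_1_iff power_one)
  then have "mtrace (lists_n n) (tpow n \<sigma>) = 1"
    using trace_eigenvalues[OF finite_lists_n spectral_tpow[OF U], of n] by (simp only: of_real_1)
  then show ?thesis
    using psd_spectral[OF finite_lists_n spectral_tpow[OF U] eig_tpow_nonneg[OF d]] by (simp add: density_op_def)
qed

section \<open>The classical distribution attached to a bipartite state\<close>

locale bipartite_state =
  fixes \<rho> :: "('a::finite \<times> 'b::finite) op" and U d UA dA UB dB
  assumes dens: "density_op UNIV \<rho>"
    and sdU: "spectral_decomp UNIV \<rho> U d" and dpos: "\<And>k. d k \<ge> 0"
    and sdA: "spectral_decomp UNIV (ptrA \<rho>) UA dA" and dApos: "\<And>k. dA k \<ge> 0"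
    and sdB: "spectral_decomp UNIV (ptrB \<rho>) UB dB" and dBpos: "\<And>k. dB k \<ge> 0"
begin

definition "W = tensor2 UA UB"
definition "\<nu> = (\<lambda>(k, l). dA k * dB l)"
definition "PP = (\<lambda>(k, l). ns_weight UNIV U d W k l)"
text \<open>Centred, so that the estimates of \<open>finite_distr\<close> apply directly.\<close>

definition "YY = (\<lambda>(k, l). ln (d k) - ln (\<nu> l) - mutual_info \<rho>)"

lemma sdW: "spectral_decomp UNIV (tensor2 (ptrA \<rho>) (ptrB \<rho>)) W \<nu>"
  unfolding W_def \<nu>_def by (rule spectral_tensor2[OF sdA sdB])

lemma unitaries: "unitary_on UNIV U" "unitary_on UNIV W" "unitary_on UNIV UA" "unitary_on UNIV UB"
  using sdU sdW sdA sdB by (auto simp: spectral_decomp_def)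

lemma PP_nonneg: "PP z \<ge> 0"
  by (simp add: PP_def ns_weight_def dpos case_prod_unfold)

lemma sum_PP_row: "(\<Sum>l\<in>UNIV. PP (k, l)) = d k"
proof -
  have "(\<Sum>l\<in>UNIV. PP (k, l)) = d k * (\<Sum>l\<in>UNIV. (cmod (ip UNIV (\<lambda>i. W i l) (\<lambda>i. U i k)))\<^sup>2)"
    by (simp add: PP_def ns_weight_def sum_distrib_left)
  also have "\<dots> = d k * nsq UNIV (\<lambda>i. U i k)" by (simp only: parseval[OF finite unitaries(2)])
  also have "nsq UNIV (\<lambda>i. U i k) = 1"
    using ip_unitary_cols[OF unitaries(1), of k k] by (simp add: ip_self)
  finally show ?thesis by simp
qed

lemma sum_PP_col: "(\<Sum>k\<in>UNIV. PP (k, l)) = Re (qform UNIV \<rho> (\<lambda>z. UA (fst z) (fst l) * UB (snd z) (snd l)))"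
proof -
  have "(\<Sum>k\<in>UNIV. PP (k, l)) = Re (qform UNIV \<rho> (\<lambda>i. W i l))"
    unfolding PP_def using sum_ns_weight_right[OF finite sdU] by simp
  also have "(\<lambda>i. W i l) = (\<lambda>z. UA (fst z) (fst l) * UB (snd z) (snd l))"
    by (simp add: W_def tensor2_def case_prod_unfold)
  finally show ?thesis .
qed

text \<open>Measuring \<rho> locally in the eigenbasis of its marginal returns the eigenvalues of
  that marginal.\<close>

lemma sum_PP_A: "(\<Sum>l2\<in>UNIV. \<Sum>k\<in>UNIV. PP (k, (l1, l2))) = dA l1"
  using sum_qform_ptrA_single[OF unitaries(4), of \<rho> "\<lambda>x. UA x l1"] qform_eigenvector[OF finite sdA, of l1]
  by (simp add: sum_PP_col flip: Re_sum)

lemma sum_PP_B: "(\<Sum>l1\<in>UNIV. \<Sum>k\<in>UNIV. PP (k, (l1, l2))) = dB l2"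
  using sum_qform_ptrB_single[OF unitaries(3), of \<rho> "\<lambda>x. UB x l2"] qform_eigenvector[OF finite sdB, of l2]
  by (simp add: sum_PP_col flip: Re_sum)

text \<open>The convention \<open>ln 0 = 0\<close> is only met on pairs of weight zero.\<close>

lemma PP_support:
  assumes "PP (k, (l1, l2)) \<noteq> 0"
  shows "d k > 0" "dA l1 > 0" "dB l2 > 0"
proof -
  have pos: "PP (k, (l1, l2)) > 0" using assms PP_nonneg by (simp add: less_le)
  show "d k > 0" using assms dpos[of k] by (auto simp: PP_def ns_weight_def less_le)
  have "PP (k, (l1, l2)) \<le> (\<Sum>k\<in>UNIV. PP (k, (l1, l2)))"
    by (rule member_le_sum) (simp_all add: PP_nonneg)
  also have "\<dots> \<le> (\<Sum>l2\<in>UNIV. \<Sum>k\<in>UNIV. PP (k, (l1, l2)))"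
    by (rule member_le_sum) (simp_all add: PP_nonneg sum_nonneg)
  finally show "dA l1 > 0" using pos by (simp add: sum_PP_A)
  have "PP (k, (l1, l2)) \<le> (\<Sum>k\<in>UNIV. PP (k, (l1, l2)))"
    by (rule member_le_sum) (simp_all add: PP_nonneg)
  also have "\<dots> \<le> (\<Sum>l1\<in>UNIV. \<Sum>k\<in>UNIV. PP (k, (l1, l2)))"
    by (rule member_le_sum) (simp_all add: PP_nonneg sum_nonneg)
  finally show "dB l2 > 0" using pos by (simp add: sum_PP_B)
qed

lemma sum_d: "(\<Sum>k\<in>UNIV. d k) = 1"
proof -
  have "complex_of_real (\<Sum>k\<in>UNIV. d k) = complex_of_real 1"
    using trace_eigenvalues[OF finite sdU] dens by (simp add: density_op_def)
  then show ?thesis by (simp only: of_real_eq_iff)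
qed

lemma sum_PP: "(\<Sum>z\<in>UNIV. PP z) = 1"
  by (simp add: sum_UNIV_pair[of PP] sum_PP_row sum_d)

text \<open>The logarithm of a product eigenvalue is split only where both factors are positive,
  which covers the support of \<open>PP\<close>; each of the three entropies then comes from one
  marginal of \<open>PP\<close>.\<close>

lemma mutual_info_PP: "mutual_info \<rho> = (\<Sum>k\<in>UNIV. \<Sum>l\<in>UNIV. PP (k, l) * (ln (d k) - ln (\<nu> l)))"
proof -
  have 1: "(\<Sum>k\<in>UNIV. \<Sum>l\<in>UNIV. PP (k, l) * ln (d k)) = (\<Sum>k\<in>UNIV. d k * ln (d k))"
    by (simp add: sum_distrib_right[symmetric] sum_PP_row)
  have nu: "PP (k, (l1, l2)) * ln (\<nu> (l1, l2)) = PP (k, (l1, l2)) * ln (dA l1) + PP (k, (l1, l2)) * ln (dB l2)" for k l1 l2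
  proof (cases "PP (k, (l1, l2)) = 0")
    case False
    then show ?thesis using PP_support[OF False] by (simp add: \<nu>_def ln_mult distrib_left)
  qed simp
  have "(\<Sum>k\<in>UNIV. \<Sum>l\<in>UNIV. PP (k, l) * ln (\<nu> l)) = (\<Sum>l\<in>UNIV. \<Sum>k\<in>UNIV. PP (k, l) * ln (\<nu> l))"
    by (rule sum.swap)
  also have "\<dots> = (\<Sum>l1\<in>UNIV. \<Sum>l2\<in>UNIV. \<Sum>k\<in>UNIV. PP (k, (l1, l2)) * ln (dA l1))
      + (\<Sum>l1\<in>UNIV. \<Sum>l2\<in>UNIV. \<Sum>k\<in>UNIV. PP (k, (l1, l2)) * ln (dB l2))"
    by (simp only: sum_UNIV_pair nu sum.distrib)
  also have "(\<Sum>l1\<in>UNIV. \<Sum>l2\<in>UNIV. \<Sum>k\<in>UNIV. PP (k, (l1, l2)) * ln (dA l1)) = (\<Sum>l1\<in>UNIV. dA l1 * ln (dA l1))"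
    by (simp only: sum_distrib_right[symmetric] sum_PP_A)
  also have "(\<Sum>l1\<in>UNIV. \<Sum>l2\<in>UNIV. \<Sum>k\<in>UNIV. PP (k, (l1, l2)) * ln (dB l2))
      = (\<Sum>l2\<in>UNIV. \<Sum>l1\<in>UNIV. \<Sum>k\<in>UNIV. PP (k, (l1, l2)) * ln (dB l2))" by (rule sum.swap)
  also have "\<dots> = (\<Sum>l2\<in>UNIV. dB l2 * ln (dB l2))"
    by (simp only: sum_distrib_right[symmetric] sum_PP_B)
  finally show ?thesis
    by (simp add: mutual_info_def vn_entropy_spectral[OF finite sdU] vn_entropy_spectral[OF finite sdA]
        vn_entropy_spectral[OF finite sdB] right_diff_distrib sum_subtractf 1)
qed

lemma mean_YY: "(\<Sum>z\<in>UNIV. PP z * YY z) = 0"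
proof -
  have "(\<Sum>z\<in>UNIV. PP z * YY z) = (\<Sum>k\<in>UNIV. \<Sum>l\<in>UNIV. PP (k, l) * (ln (d k) - ln (\<nu> l)) - PP (k, l) * mutual_info \<rho>)"
    unfolding sum_UNIV_pair[of "\<lambda>z. PP z * YY z"] by (intro sum.cong) (simp_all add: YY_def algebra_simps)
  also have "\<dots> = mutual_info \<rho> - (\<Sum>k\<in>UNIV. \<Sum>l\<in>UNIV. PP (k, l)) * mutual_info \<rho>"
    by (simp only: sum_subtractf sum_distrib_right[symmetric] mutual_info_PP[symmetric])
  finally show ?thesis by (simp add: sum_PP_row sum_d)
qed

lemma var_YY: "(\<Sum>z\<in>UNIV. PP z * (YY z)\<^sup>2) = mutual_info_var \<rho>"
proof -
  \<comment> \<open>The scalar is attached to the logarithm of \<rho>, which keeps the eigenbasis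
    \<open>U\<close> and leaves a difference of two diagonalised operators.\<close>
  define A where "A = (\<lambda>i j. mlog UNIV \<rho> i j - complex_of_real (mutual_info \<rho>) * mid i j)"
  have A: "spectral_decomp UNIV A U (\<lambda>k. ln (d k) - mutual_info \<rho>)"
    using mlog_spectral[OF finite sdU] unitary_rows[OF unitaries(1)]
    by (simp add: spectral_decomp_def A_def mid_def left_diff_distrib right_diff_distrib sum_subtractf mult_ac)
      (simp add: sum_distrib_left[symmetric] sum_distrib_right[symmetric] mult_ac)
  have "mutual_info_var \<rho> = (\<Sum>k\<in>UNIV. \<Sum>l\<in>UNIV. ns_weight UNIV U d W k l * ((ln (d k) - mutual_info \<rho>) - ln (\<nu> l))\<^sup>2)"
    unfolding mutual_info_var_def Let_def
    by (rule trace_square_difference[OF finite sdU A mlog_spectral[OF finite sdW]]) (simp add: A_def)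
  then show ?thesis
    unfolding sum_UNIV_pair[of "\<lambda>z. PP z * (YY z)\<^sup>2"] by (simp add: PP_def YY_def algebra_simps)
qed

lemma ns_weight_tpow:
  assumes "length k = n" "length l = n"
  shows "ns_weight (lists_n n) (tpow n U) (eig_tpow n d) (tpow n W) k l = eig_tpow n PP (zip k l)"
proof -
  have "eig_tpow n PP (zip k l) = (\<Prod>i<n. PP (k ! i, l ! i))"
    unfolding eig_tpow_def by (rule prod.cong) (use assms in auto)
  then show ?thesis
    by (simp add: ns_weight_def ip_tpow eig_tpow_def PP_def prod_norm[symmetric] prod_power_distrib prod.distrib)
qed

text \<open>On sequences of nonzero weight all eigenvalues are positive, and logarithms turn the
  threshold condition into the tail condition; elsewhere both sides contribute 0.\<close>

lemma likelihood_threshold_tail: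
  "(\<Sum>k\<in>lists_n n. \<Sum>l\<in>lists_n n. if eig_tpow n d k \<le> exp (real n * (mutual_info \<rho> - b)) * eig_tpow n \<nu> l
      then ns_weight (lists_n n) (tpow n U) (eig_tpow n d) (tpow n W) k l else 0)
   = tail_prob PP YY n b"
proof -
  have "tail_prob PP YY n b = (\<Sum>k\<in>lists_n n. \<Sum>l\<in>lists_n n.
      if list_sum n YY (zip k l) \<le> - real n * b then eig_tpow n PP (zip k l) else 0)"
    unfolding tail_prob_def by (rule sum_lists_n_zip)
  moreover have "(if eig_tpow n d k \<le> exp (real n * (mutual_info \<rho> - b)) * eig_tpow n \<nu> l
      then ns_weight (lists_n n) (tpow n U) (eig_tpow n d) (tpow n W) k l else 0)
    = (if list_sum n YY (zip k l) \<le> - real n * b then eig_tpow n PP (zip k l) else 0)"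
    if "k \<in> lists_n n" "l \<in> lists_n n" for k l
  proof (cases "eig_tpow n PP (zip k l) = 0")
    case True
    have "length k = n" "length l = n" using that by (auto simp: lists_n_def)
    from ns_weight_tpow[OF this] True show ?thesis by simp
  next
    case False
    have len: "length k = n" "length l = n" using that by (auto simp: lists_n_def)
    have "PP (k ! i, l ! i) \<noteq> 0" if "i < n" for i
      using False that len by (auto simp: eig_tpow_def)
    then have pos: "d (k ! i) > 0" "\<nu> (l ! i) > 0" if "i < n" for i
      using PP_support[of "k ! i" "fst (l ! i)" "snd (l ! i)"] that by (auto simp: \<nu>_def case_prod_unfold)
    have D: "eig_tpow n d k = exp (\<Sum>i<n. ln (d (k ! i)))" and N: "eig_tpow n \<nu> l = exp (\<Sum>i<n. ln (\<nu> (l ! i)))"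
      using pos by (auto simp: eig_tpow_def exp_sum intro!: prod.cong)
    have "list_sum n YY (zip k l) = (\<Sum>i<n. ln (d (k ! i)) - ln (\<nu> (l ! i)) - mutual_info \<rho>)"
      unfolding list_sum_def by (rule sum.cong) (use len in \<open>auto simp: YY_def\<close>)
    then have "list_sum n YY (zip k l) = (\<Sum>i<n. ln (d (k ! i))) - (\<Sum>i<n. ln (\<nu> (l ! i))) - real n * mutual_info \<rho>"
      by (simp add: sum_subtractf)
    then have "eig_tpow n d k \<le> exp (real n * (mutual_info \<rho> - b)) * eig_tpow n \<nu> l
        \<longleftrightarrow> list_sum n YY (zip k l) \<le> - real n * b"
      unfolding D N exp_add[symmetric] exp_le_cancel_iff right_diff_distrib by linarith
    then show ?thesis by (simp add: ns_weight_tpow[OF len])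
  qed
  ultimately show ?thesis by (simp cong: sum.cong)
qed

text \<open>Here \<open>c\<close> is a rate: each of the two eigenvalue comparisons tolerates a
  factor exp (n c), which shifts the tail level by 2 c in total.\<close>

lemma alpha_hat_le_tail:
  assumes "c > 0"
  shows "alpha_hat \<rho> n (exp (- real n * R)) \<le> tail_prob PP YY n (mutual_info \<rho> - R - 2 * c)
    + (real ((n + 1) ^ CARD('a \<times> 'a)) + real ((n + 1) ^ CARD('b \<times> 'b))) / exp (real n * c)"
proof -
  have "exp (real n * R) * (exp (real n * c))\<^sup>2 = exp (real n * (mutual_info \<rho> - (mutual_info \<rho> - R - 2 * c)))"
    by (simp add: exp_add[symmetric] power2_eq_square algebra_simps)
  moreover have "1 / exp (real n * R) = exp (- real n * R)" by (simp add: exp_minus inverse_eq_divide)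
  ultimately show ?thesis
    using alpha_hat_upper[OF dens sdU dpos sdA dApos sdB dBpos, of "exp (real n * R)" "exp (real n * c)" n]
    by (simp only: exp_gt_zero simp_thms W_def[symmetric] \<nu>_def[symmetric] likelihood_threshold_tail True_implies_equals)
qed

text \<open>The marginals of \<rho> are one admissible pair of alternatives. The converse weights
  their permitted error exp (- n R) with the threshold exp (n (I - b)), and this product is the
  subtracted term; the level \<open>b\<close> remains free.\<close>

lemma alpha_hat_iid_ge_tail:
  "alpha_hat_iid \<rho> n (exp (- real n * R)) \<ge> tail_prob PP YY n b / 2 - exp (real n * (mutual_info \<rho> - b - R))"
proof -
  let ?S = "lists_n n :: ('a \<times> 'b) list set"
  let ?E = "exp (- real n * R)" and ?\<eta> = "exp (real n * (mutual_info \<rho> - b))"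
  have bound: "tail_prob PP YY n b / 2 - exp (real n * (mutual_info \<rho> - b - R))
      \<le> Re (mtrace ?S (mmul ?S (tpow n \<rho>) (\<lambda>i j. mid i j - T i j)))"
    if T: "test_op ?S T" and le: "\<And>\<sigma> \<tau>. density_op UNIV \<sigma> \<Longrightarrow> density_op UNIV \<tau> \<Longrightarrow>
         Re (mtrace ?S (mmul ?S (prod_state (tpow n \<sigma>) (tpow n \<tau>)) T)) \<le> ?E" for T
  proof -
    let ?R = "tpow n \<rho>" and ?Q = "tpow n (tensor2 (ptrA \<rho>) (ptrB \<rho>))"
    have "mtrace ?S (mmul ?S (prod_state (tpow n (ptrA \<rho>)) (tpow n (ptrB \<rho>))) T) = mtrace ?S (mmul ?S ?Q T)"
      by (intro mtrace_cong mmul_cong_left prod_state_tpow)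
    then have Q: "Re (mtrace ?S (mmul ?S ?Q T)) \<le> ?E"
      using le[OF density_ptrA[OF dens] density_ptrB[OF dens]] by simp
    have \<nu>pos: "\<nu> l \<ge> 0" for l by (simp add: \<nu>_def dApos dBpos case_prod_unfold)
    have "tail_prob PP YY n b / 2
       \<le> (\<Sum>k\<in>?S. \<Sum>l\<in>?S. min (eig_tpow n d k) (?\<eta> * eig_tpow n \<nu> l)
           * (cmod (ip ?S (\<lambda>i. tpow n W i l) (\<lambda>i. tpow n U i k)))\<^sup>2) / 2"
      unfolding likelihood_threshold_tail[symmetric]
      by (intro divide_right_mono sum_mono)
        (auto simp: ns_weight_def min_def eig_tpow_nonneg dpos \<nu>pos)
    also have "\<dots> \<le> Re (mtrace ?S (mmul ?S ?R (\<lambda>i j. mid i j - T i j))) + ?\<eta> * Re (mtrace ?S (mmul ?S ?Q T))"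
      by (rule nussbaum_szkola_converse[OF finite_lists_n spectral_tpow[OF sdU] spectral_tpow[OF sdW] T])
        (simp_all add: eig_tpow_nonneg dpos \<nu>pos)
    also have "\<dots> \<le> Re (mtrace ?S (mmul ?S ?R (\<lambda>i j. mid i j - T i j))) + ?\<eta> * ?E"
      using Q by simp
    finally show ?thesis by (simp add: exp_add[symmetric] algebra_simps)
  qed
  \<comment> \<open>The zero test satisfies the constraint, so the infimum ranges over a nonempty
    set.\<close>
  have "test_op ?S (\<lambda>_ _. 0)" by (rule test_op_zero[OF finite_lists_n])
  then show ?thesis
    unfolding alpha_hat_iid_def
    by (intro cInf_greatest)
      (force simp: mtrace_def mmul_def, use bound in blast)
qed

text \<open>Tensor powers are permutation invariant densities, so the i.i.d. constraint admits more
  tests. The nonnegative level keeps the zero test admissible, which the comparison of infima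
  requires.\<close>

lemma alpha_hat_iid_le:
  assumes "\<mu> \<ge> 0"
  shows "alpha_hat_iid \<rho> n \<mu> \<le> alpha_hat \<rho> n \<mu>"
  unfolding alpha_hat_def alpha_hat_iid_def
proof (rule cInf_superset_mono, goal_cases)
  case 1
  show ?case
    using test_op_zero[OF finite_lists_n] assms by (force simp: mtrace_def mmul_def)
next
  case 2
  have "psd (lists_n n) (tpow n \<rho>)"
    by (rule psd_spectral[OF finite_lists_n spectral_tpow[OF sdU] eig_tpow_nonneg[OF dpos]])
  then show ?case
    by (intro bdd_belowI[of _ 0]) (auto simp: test_op_def intro!: psd_trace_nonneg)
next
  case 3
  show ?case
  proof (rule Collect_mono, intro impI, elim exE conjE, goal_cases)
    case (1 x T)
    have "Re (mtrace (lists_n n) (mmul (lists_n n) (prod_state (tpow n \<sigma>) (tpow n \<tau>)) T)) \<le> \<mu>"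
      if "density_op UNIV \<sigma>" "density_op UNIV \<tau>" for \<sigma> \<tau>
      using 1(3) density_tpow[OF that(1), of n] density_tpow[OF that(2), of n] symmetric_op_tpow[of n \<sigma>]
        symmetric_op_tpow[of n \<tau>] by blast
    then show ?case using 1(1,2) by blast
  qed
qed

end

subsection \<open>The exponent\<close>

text \<open>The lower bound also forces \<open>u n\<close> to be positive eventually, which the
  passage to logarithms requires.\<close>

lemma exponent_limit:
  fixes x u :: "nat \<Rightarrow> real"
  assumes x: "filterlim x at_top sequentially"
    and lower: "\<And>\<epsilon>. \<epsilon> > 0 \<Longrightarrow> eventually (\<lambda>n. u n \<ge> exp (- x n * (v + \<epsilon>))) sequentially"
    and upper: "\<And>\<epsilon>. \<epsilon> > 0 \<Longrightarrow> eventually (\<lambda>n. u n \<le> exp (- x n * (v - \<epsilon>))) sequentially"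
  shows "(\<lambda>n. - (1 / x n) * ln (u n)) \<longlonglongrightarrow> v"
proof (rule tendstoI)
  fix e :: real assume e: "e > 0"
  have xpos: "eventually (\<lambda>n. x n \<ge> 1) sequentially" using x by (simp add: filterlim_at_top)
  show "eventually (\<lambda>n. dist (- (1 / x n) * ln (u n)) v < e) sequentially"
    using lower[OF half_gt_zero[OF e]] upper[OF half_gt_zero[OF e]] xpos
  proof eventually_elim
    case (elim n)
    have u: "u n > 0" using elim(1) exp_gt_zero[of "- x n * (v + e / 2)"] by linarith
    have "- x n * (v + e / 2) \<le> ln (u n)" using elim(1) u by (simp add: ln_ge_iff)
    moreover have "ln (u n) \<le> - x n * (v - e / 2)" using elim(2) u by (metis exp_gt_zero ln_exp ln_le_cancel_iff)
    ultimately have "v - e / 2 \<le> - (1 / x n) * ln (u n)" "- (1 / x n) * ln (u n) \<le> v + e / 2"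
      using elim(3) by (simp_all add: field_simps)
    then show ?case using e by (simp add: dist_real_def abs_less_iff)
  qed
qed

lemma moderate_sequence:
  assumes apos: "\<And>n. a n > 0" and grow: "filterlim (\<lambda>n. sqrt (real n) * a n) at_top sequentially"
  shows "filterlim (\<lambda>n. real n * (a n)\<^sup>2) at_top sequentially"
    and "eventually (\<lambda>n. sqrt (real n) \<le> real n * a n) sequentially"
proof -
  have "filterlim (\<lambda>n. (sqrt (real n) * a n) * (sqrt (real n) * a n)) at_top sequentially"
    by (rule filterlim_at_top_mult_at_top[OF grow grow])
  then show "filterlim (\<lambda>n. real n * (a n)\<^sup>2) at_top sequentially"
    by (simp add: power2_eq_square mult_ac flip: mult.assoc[of "sqrt _" "sqrt _"])
  have "eventually (\<lambda>n. 1 \<le> sqrt (real n) * a n) sequentially" using grow by (simp add: filterlim_at_top)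
  then show "eventually (\<lambda>n. sqrt (real n) \<le> real n * a n) sequentially"
  proof (rule eventually_mono)
    fix n assume "1 \<le> sqrt (real n) * a n"
    then have "sqrt (real n) * 1 \<le> sqrt (real n) * (sqrt (real n) * a n)" by (intro mult_left_mono) auto
    then show "sqrt (real n) \<le> real n * a n" by (simp flip: mult.assoc)
  qed
qed

text \<open>The exponential is split into two equal factors. One absorbs the polynomials, since n
  a_n is eventually at least sqrt n; the other beats the rate \<open>K\<close>, however large, since
  a_n tends to 0.\<close>

lemma polynomial_exp_negligible:
  fixes p q :: nat
  assumes apos: "\<And>n. a n > 0" and a0: "a \<longlonglongrightarrow> 0"
    and grow: "filterlim (\<lambda>n. sqrt (real n) * a n) at_top sequentially" and \<kappa>: "\<kappa> > 0"
  shows "eventually (\<lambda>n. (real ((n + 1) ^ p) + real ((n + 1) ^ q)) / exp (real n * (\<kappa> * a n))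
    \<le> exp (- (real n * (a n)\<^sup>2) * K)) sequentially"
proof -
  have *: "((\<lambda>n::nat. (real n + 1) ^ p * exp (- sqrt (real n) * (\<kappa> / 2))) \<longlongrightarrow> 0) sequentially" for p
    using \<kappa> by real_asymp
  have "((\<lambda>n::nat. (real n + 1) ^ p * exp (- sqrt (real n) * (\<kappa> / 2))
      + (real n + 1) ^ q * exp (- sqrt (real n) * (\<kappa> / 2))) \<longlongrightarrow> 0 + 0) sequentially"
    by (intro tendsto_add *)
  then have 1: "eventually (\<lambda>n::nat. (real n + 1) ^ p * exp (- sqrt (real n) * (\<kappa> / 2))
      + (real n + 1) ^ q * exp (- sqrt (real n) * (\<kappa> / 2)) < 1) sequentially"
    by (rule order_tendstoD(2)) simp
  have "(\<lambda>n. a n * K) \<longlonglongrightarrow> 0 * K" by (intro tendsto_mult tendsto_const a0)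
  then have 2: "eventually (\<lambda>n. a n * K < \<kappa> / 2) sequentially"
    by (rule order_tendstoD(2)) (use \<kappa> in simp)
  show ?thesis
    using 1 2 moderate_sequence(2)[OF apos grow]
  proof eventually_elim
    case (elim n)
    define f where "f = (real n + 1) ^ p + (real n + 1) ^ q"
    have f: "f \<ge> 0" by (simp add: f_def)
    have "sqrt (real n) * (\<kappa> / 2) \<le> real n * a n * (\<kappa> / 2)"
      using elim(3) \<kappa> by (intro mult_right_mono) auto
    then have e1: "exp (- (real n * a n * (\<kappa> / 2))) \<le> exp (- sqrt (real n) * (\<kappa> / 2))" by simp
    have "f * exp (- (real n * a n * (\<kappa> / 2))) \<le> f * exp (- sqrt (real n) * (\<kappa> / 2))"
      using e1 f by (rule mult_left_mono)
    also have "\<dots> \<le> 1" using elim(1) by (simp add: f_def distrib_right)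
    finally have f1: "f * exp (- (real n * a n * (\<kappa> / 2))) \<le> 1" .
    have "real n * a n * (a n * K) \<le> real n * a n * (\<kappa> / 2)"
      using elim(2) apos[of n] by (intro mult_left_mono) auto
    then have e2: "exp (- (real n * a n * (\<kappa> / 2))) \<le> exp (- (real n * (a n)\<^sup>2) * K)"
      by (simp add: power2_eq_square mult_ac)
    have "(real ((n + 1) ^ p) + real ((n + 1) ^ q)) / exp (real n * (\<kappa> * a n)) = f * exp (- (real n * (\<kappa> * a n)))"
      by (simp add: f_def exp_minus field_simps)
    also have "exp (- (real n * (\<kappa> * a n))) = exp (- (real n * a n * (\<kappa> / 2))) * exp (- (real n * a n * (\<kappa> / 2)))"
      by (simp add: exp_add[symmetric])
    also have "f * (exp (- (real n * a n * (\<kappa> / 2))) * exp (- (real n * a n * (\<kappa> / 2))))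
        \<le> 1 * exp (- (real n * (a n)\<^sup>2) * K)"
      unfolding mult.assoc[symmetric] by (rule mult_mono[OF f1 e2]) simp_all
    finally show ?case by simp
  qed
qed

theorem mainTheorem5:
  fixes a :: "nat \<Rightarrow> real"
    and \<rho> :: "('a::finite \<times> 'b::finite) op"
  assumes apos: "\<forall>n. a n > 0"
    and alim: "a \<longlonglongrightarrow> 0"
    and agrow: "filterlim (\<lambda>n. sqrt (real n) * a n) at_top sequentially"
    and dens: "density_op UNIV \<rho>"
    and Vpos: "mutual_info_var \<rho> > 0"
  shows "((\<lambda>n. - (1 / (real n * (a n)\<^sup>2)) *
            ln (alpha_hat \<rho> n (exp (- real n * (mutual_info \<rho> - a n)))))
           \<longlonglongrightarrow> 1 / (2 * mutual_info_var \<rho>)) \<and>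
         ((\<lambda>n. - (1 / (real n * (a n)\<^sup>2)) *
            ln (alpha_hat_iid \<rho> n (exp (- real n * (mutual_info \<rho> - a n)))))
           \<longlonglongrightarrow> 1 / (2 * mutual_info_var \<rho>))"
proof -
  have psd: "psd UNIV \<rho>" using dens by (simp add: density_op_def)
  obtain U d where U: "spectral_decomp UNIV \<rho> U d" "\<And>k. d k \<ge> 0"
    using psd_ex_spectral[OF finite psd] by (metis UNIV_I)
  obtain UA dA where A: "spectral_decomp UNIV (ptrA \<rho>) UA dA" "\<And>k. dA k \<ge> 0"
    using psd_ex_spectral[OF finite psd_ptrA[OF psd]] by (metis UNIV_I)
  obtain UB dB where B: "spectral_decomp UNIV (ptrB \<rho>) UB dB" "\<And>k. dB k \<ge> 0"
    using psd_ex_spectral[OF finite psd_ptrB[OF psd]] by (metis UNIV_I)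
  interpret bipartite_state \<rho> U d UA dA UB dB
    by unfold_locales (use dens U A B in auto)
  define V where "V = mutual_info_var \<rho>"
  have V: "V > 0" using Vpos by (simp add: V_def)
  interpret finite_distr PP YY V
    by unfold_locales (simp_all add: PP_nonneg sum_PP mean_YY var_YY V_def Vpos)
  define x where "x = (\<lambda>n. real n * (a n)\<^sup>2)"
  define E where "E = (\<lambda>n. exp (- real n * (mutual_info \<rho> - a n)))"
  have apos': "a n > 0" for n using apos by simp
  have x: "filterlim x at_top sequentially"
    unfolding x_def by (rule moderate_sequence(1)[OF apos' agrow])
  have iid_le: "alpha_hat_iid \<rho> n (E n) \<le> alpha_hat \<rho> n (E n)" for n
    by (rule alpha_hat_iid_le) (simp add: E_def)
  have upper: "eventually (\<lambda>n. alpha_hat \<rho> n (E n) \<le> exp (- x n * (1 / (2 * V) - \<epsilon>))) sequentially" if \<epsilon>: "\<epsilon> > 0" for \<epsilon>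
  proof -
    \<comment> \<open>Lowering the level to (1 - \<kappa>) a_n costs at most \<kappa> / V <=
      \<epsilon> / 3 in the exponent. Another third of \<epsilon> goes to the tail estimate, and the
      last one absorbs the factor 2 from adding two terms.\<close>
    define \<kappa> where "\<kappa> = min (1 / 2) (\<epsilon> * V / 3)"
    have \<kappa>: "\<kappa> > 0" "\<kappa> \<le> 1 / 2" "\<kappa> / V \<le> \<epsilon> / 3" using \<epsilon> V by (auto simp: \<kappa>_def divide_le_eq min_def)
    have "1 / (2 * V) - \<kappa> / V \<le> (1 - \<kappa>)\<^sup>2 / (2 * V)"
    proof -
      have "(1 - 2 * \<kappa>) / (2 * V) \<le> (1 - \<kappa>)\<^sup>2 / (2 * V)"
        using V by (intro divide_right_mono) (simp_all add: power2_eq_square algebra_simps)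
      then show ?thesis by (simp add: diff_divide_distrib)
    qed
    then have rate: "1 / (2 * V) - \<epsilon> + \<epsilon> / 3 \<le> (1 - \<kappa>)\<^sup>2 / (2 * V) - \<epsilon> / 3" using \<kappa>(3) by linarith
    have ev1: "eventually (\<lambda>n. tail_prob PP YY n ((1 - \<kappa>) * a n) \<le> exp (- x n * ((1 - \<kappa>)\<^sup>2 / (2 * V) - \<epsilon> / 3))) sequentially"
      unfolding x_def by (rule tail_prob_upper[OF apos' alim]) (use \<kappa> \<epsilon> in auto)
    have ev2: "eventually (\<lambda>n. (real ((n + 1) ^ CARD('a \<times> 'a)) + real ((n + 1) ^ CARD('b \<times> 'b))) / exp (real n * (\<kappa> / 2 * a n))
        \<le> exp (- x n * (1 / (2 * V) - \<epsilon> + \<epsilon> / 3))) sequentially"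
      unfolding x_def by (rule polynomial_exp_negligible[OF apos' alim agrow]) (use \<kappa> in simp)
    have ev3: "eventually (\<lambda>n. x n \<ge> 3 * ln 2 / \<epsilon>) sequentially" using x by (simp add: filterlim_at_top)
    have ev4: "eventually (\<lambda>n. x n \<ge> 0) sequentially" using x by (simp add: filterlim_at_top)
    show ?thesis
      using ev1 ev2 ev3 ev4
    proof eventually_elim
      case (elim n)
      \<comment> \<open>Slack \<kappa> a_n / 2 for each of the two marginals lowers the level from
        a_n to (1 - \<kappa>) a_n.\<close>
      have "alpha_hat \<rho> n (E n) \<le> tail_prob PP YY n ((1 - \<kappa>) * a n)
        + (real ((n + 1) ^ CARD('a \<times> 'a)) + real ((n + 1) ^ CARD('b \<times> 'b))) / exp (real n * (\<kappa> / 2 * a n))"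
        using alpha_hat_le_tail[of "\<kappa> / 2 * a n" n "mutual_info \<rho> - a n"] \<kappa> apos'[of n]
        by (simp add: E_def left_diff_distrib)
      also have "\<dots> \<le> exp (- x n * (1 / (2 * V) - \<epsilon> + \<epsilon> / 3)) + exp (- x n * (1 / (2 * V) - \<epsilon> + \<epsilon> / 3))"
      proof (rule add_mono[OF order_trans[OF elim(1)] elim(2)])
        have "x n * (1 / (2 * V) - \<epsilon> + \<epsilon> / 3) \<le> x n * ((1 - \<kappa>)\<^sup>2 / (2 * V) - \<epsilon> / 3)"
          using rate elim(4) by (rule mult_left_mono)
        then show "exp (- x n * ((1 - \<kappa>)\<^sup>2 / (2 * V) - \<epsilon> / 3)) \<le> exp (- x n * (1 / (2 * V) - \<epsilon> + \<epsilon> / 3))" by simp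
      qed
      also have "\<dots> = exp (ln 2 - x n * (1 / (2 * V) - \<epsilon> + \<epsilon> / 3))" by (simp add: exp_diff exp_minus inverse_eq_divide)
      also have "\<dots> \<le> exp (- x n * (1 / (2 * V) - \<epsilon>))"
      proof -
        have "ln 2 \<le> x n * (\<epsilon> / 3)" using elim(3) \<epsilon> by (simp add: field_simps)
        moreover have "x n * (1 / (2 * V) - \<epsilon> + \<epsilon> / 3) = x n * (1 / (2 * V) - \<epsilon>) + x n * (\<epsilon> / 3)"
          by (rule distrib_left)
        ultimately show ?thesis unfolding exp_le_cancel_iff minus_mult_left[symmetric] by linarith
      qed
      finally show ?case .
    qed
  qed
  have lower: "eventually (\<lambda>n. alpha_hat_iid \<rho> n (E n) \<ge> exp (- x n * (1 / (2 * V) + \<epsilon>))) sequentially" if \<epsilon>: "\<epsilon> > 0" for \<epsilon>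
  proof -
    \<comment> \<open>Raising the level to (1 + \<kappa>) a_n turns the subtracted term of the
      converse into exp (- n \<kappa> a_n). The shift costs at most \<epsilon> / 2, the tail
      estimate \<epsilon> / 6, and the remaining \<epsilon> / 3 absorbs a factor 4.\<close>
    define \<kappa> where "\<kappa> = min (1 / 2) (\<epsilon> * V / 3)"
    have \<kappa>: "\<kappa> > 0" "\<kappa> \<le> 1 / 2" "\<kappa> / V \<le> \<epsilon> / 3" using \<epsilon> V by (auto simp: \<kappa>_def divide_le_eq min_def)
    define r where "r = (1 + \<kappa>)\<^sup>2 / (2 * V) + \<epsilon> / 6"
    have "(1 + \<kappa>)\<^sup>2 / (2 * V) \<le> (1 + 3 * \<kappa>) / (2 * V)"
      using V \<kappa> by (intro divide_right_mono) (simp_all add: power2_eq_square algebra_simps)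
    also have "\<dots> = 1 / (2 * V) + 3 / 2 * (\<kappa> / V)" by (simp add: add_divide_distrib)
    finally have rate: "r + \<epsilon> / 3 \<le> 1 / (2 * V) + \<epsilon>" using \<kappa>(3) unfolding r_def by linarith
    have ev1: "eventually (\<lambda>n. tail_prob PP YY n ((1 + \<kappa>) * a n) \<ge> exp (- x n * r)) sequentially"
      unfolding x_def r_def by (rule tail_prob_lower[OF apos' alim]) (use \<kappa> \<epsilon> x[unfolded x_def] in auto)
    \<comment> \<open>With both powers 0 the numerator is 2. The surplus 1 in the rate supplies a
      further factor 1/2 as soon as \<open>x n \<ge> ln 2\<close>.\<close>
    have ev2: "eventually (\<lambda>n. (real ((n + 1) ^ 0) + real ((n + 1) ^ 0)) / exp (real n * (\<kappa> * a n)) \<le> exp (- x n * (r + 1))) sequentially"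
      unfolding x_def by (rule polynomial_exp_negligible[OF apos' alim agrow]) (use \<kappa> in simp)
    have ev3: "eventually (\<lambda>n. x n \<ge> 3 * ln 4 / \<epsilon>) sequentially" "eventually (\<lambda>n. x n \<ge> ln 2) sequentially"
      using x by (simp_all add: filterlim_at_top)
    show ?thesis
      using ev1 ev2 ev3
    proof eventually_elim
      case (elim n)
      have xn: "x n \<ge> 0" using elim(4) ln_gt_zero[of "2::real"] by linarith
      have "exp (- x n * (r + 1)) = exp (- x n * r) * exp (- x n)"
        by (simp add: exp_add[symmetric] algebra_simps)
      also have "exp (- x n) \<le> 1 / 2"
      proof -
        have "exp (- x n) \<le> exp (- ln 2)" using elim(4) by simp
        then show ?thesis by (simp add: exp_minus)
      qed
      finally have "exp (- x n * (r + 1)) \<le> exp (- x n * r) / 2" by (simp add: mult_left_mono)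
      moreover have "2 * exp (- (real n * (\<kappa> * a n))) \<le> exp (- x n * (r + 1))"
        using elim(2) by (simp add: exp_minus inverse_eq_divide)
      ultimately have small: "exp (- (real n * (\<kappa> * a n))) \<le> exp (- x n * r) / 4" by linarith
      have "exp (- x n * (1 / (2 * V) + \<epsilon>)) \<le> exp (- x n * r) / 4"
      proof -
        have "x n * (r + \<epsilon> / 3) \<le> x n * (1 / (2 * V) + \<epsilon>)" using rate xn by (rule mult_left_mono)
        moreover have "ln 4 \<le> x n * (\<epsilon> / 3)" using elim(3) \<epsilon> by (simp add: field_simps)
        ultimately have "exp (- x n * (1 / (2 * V) + \<epsilon>)) \<le> exp (- x n * r - ln 4)" by (simp add: distrib_left)
        then show ?thesis by (simp add: exp_diff)
      qed
      \<comment> \<open>Half of the tail bound minus at most a quarter of it leaves the quarter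
        obtained above.\<close>
      also have "\<dots> \<le> tail_prob PP YY n ((1 + \<kappa>) * a n) / 2 - exp (- (real n * (\<kappa> * a n)))"
        using elim(1) small by linarith
      also have "\<dots> \<le> alpha_hat_iid \<rho> n (E n)"
        using alpha_hat_iid_ge_tail[of n "(1 + \<kappa>) * a n" "mutual_info \<rho> - a n"]
        by (simp add: E_def distrib_right algebra_simps)
      finally show ?case .
    qed
  qed
  \<comment> \<open>The comparison of the two errors passes the i.i.d. lower bound up to
    \<open>alpha_hat\<close> here, and the symmetric upper bound down to
    \<open>alpha_hat_iid\<close> afterwards.\<close>
  have "(\<lambda>n. - (1 / x n) * ln (alpha_hat \<rho> n (E n))) \<longlonglongrightarrow> 1 / (2 * V)"
  proof (rule exponent_limit[OF x _ upper])
    fix \<epsilon> :: real assume "\<epsilon> > 0"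
    from lower[OF this] show "eventually (\<lambda>n. alpha_hat \<rho> n (E n) \<ge> exp (- x n * (1 / (2 * V) + \<epsilon>))) sequentially"
      by (rule eventually_mono) (use iid_le order_trans in blast)
  qed
  moreover have "(\<lambda>n. - (1 / x n) * ln (alpha_hat_iid \<rho> n (E n))) \<longlonglongrightarrow> 1 / (2 * V)"
  proof (rule exponent_limit[OF x lower])
    fix \<epsilon> :: real assume "\<epsilon> > 0"
    from upper[OF this] show "eventually (\<lambda>n. alpha_hat_iid \<rho> n (E n) \<le> exp (- x n * (1 / (2 * V) - \<epsilon>))) sequentially"
      by (rule eventually_mono) (use iid_le order_trans in blast)
  qed
  ultimately show ?thesis by (simp add: x_def E_def V_def)
qed

end
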